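(* For all $(\xi_1,\xi_2)\in\mathbb{C}^2$ with $|\mathrm{Im}(\xi_1)|<\kappa$ and $|\mathrm{Im}(\xi_2)|<\kappa$, the function $\tilde W$ satisfies the two relations $$\tilde W(\xi_1,\xi_2)=\frac{\gamma(\xi_1,\xi_2)}{4\pi^2}\int_{-\infty-i\kappa}^{\infty-i\kappa}d\xi_2'\int_{-\infty+i\kappa}^{\infty+i\kappa}d\xi_1'\,\frac{\gamma(\xi_1,-\xi_2')\,\tilde K(\xi_1',\xi_2')\,\tilde W(\xi_1',\xi_2')}{(\xi_1'-\xi_1)(\xi_2'-\xi_2)}+\frac{i\,\gamma(\xi_1,\xi_2)\,\gamma(\xi_1,k_2)}{(\xi_1+k_1)(\xi_2+k_2)}$$ and $$\tilde W(\xi_1,\xi_2)=\frac{\gamma(\xi_2,\xi_1)}{4\pi^2}\int_{-\infty-i\kappa}^{\infty-i\kappa}d\xi_1'\int_{-\infty+i\kappa}^{\infty+i\kappa}d\xi_2'\,\frac{\gamma(\xi_2,-\xi_1')\,\tilde K(\xi_1',\xi_2')\,\tilde W(\xi_1',\xi_2')}{(\xi_1'-\xi_1)(\xi_2'-\xi_2)}+\frac{i\,\gamma(\xi_2,\xi_1)\,\gamma(\xi_2,k_1)}{(\xi_1+k_1)(\xi_2+k_2)}.$$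
   Context: Parameters: $k^2=1+i\epsilon$ with $\epsilon>0$ small and $k$ close to $1$; $k_1,k_2\in\mathbb{C}$ have positive real parts and small positive imaginary parts; $\kappa=\tfrac14\min(\epsilon/2,\mathrm{Im}(k_1),\mathrm{Im}(k_2))$. Quarter-plane problem: $u^{\rm in}=\exp\{i(k_1x_1+k_2x_2-\sqrt{k^2-k_1^2-k_2^2}\,x_3)\}$ and $u^{\rm t}=u^{\rm in}+u$. The scattered field $u$ is even in $x_3$, smooth for $x_3>0$, continuous as $x_3\to0^+$, and satisfies: $\Delta u+k^2u=0$ off the quarter-plane $\{x_3=0,x_1>0,x_2>0\}$; $u(x_1,x_2,0)=-e^{i(k_1x_1+k_2x_2)}$ if $x_1>0$ and $x_2>0$; $\partial u/\partial x_3(x_1,x_2,0)=0$ if $x_1<0$ or $x_2<0$; $u\to0$ as $r=(x_1^2+x_2^2+x_3^2)^{1/2}\to\infty$; edge conditions: there are functions $e_1,e_2$ with $|u^{\rm t}|<e_1(x_1)(x_2^2+x_3^2)^{1/4}$ as $x_2^2+x_3^2\to0$ for fixed $x_1>0$, and $|u^{\rm t}|<e_2(x_2)(x_1^2+x_3^2)^{1/4}$ as $x_1^2+x_3^2\to0$ for fixed $x_2>0$; vertex condition: $|u^{\rm t}|<c(\theta,\varphi)r^{\lambda}$ as $r\to0$ for some function $c$ of the spherical angles and some $\lambda>-1/2$. Standing assumption (exponential decay): there is $C_\epsilon$ with $|u(x_1,x_2,0^+)|<C_\epsilon\exp\{-4\kappa\sqrt{x_1^2+x_2^2}\}$ as $\sqrt{x_1^2+x_2^2}\to\infty$.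 Spectral functions: $\mathfrak{F}[\phi](\xi_1,\xi_2)=\iint_{\mathbb{R}^2}\phi(x_1,x_2)e^{i(\xi_1x_1+\xi_2x_2)}dx_1dx_2$; $\tilde U=\mathfrak{F}[u(\cdot,\cdot,0^+)]$, $\tilde W=\mathfrak{F}[\partial u/\partial x_3(\cdot,\cdot,0^+)]$. With $\tilde K(\xi_1,\xi_2)=(k^2-\xi_1^2-\xi_2^2)^{-1/2}$ (square root close to positive real for real $\xi_1,\xi_2$ with $\xi_1^2+\xi_2^2<1$, and with positive imaginary part for all real $\xi_1,\xi_2$) the functional equation $\tilde K\tilde W=i\tilde U$ holds. $\tilde W$ is analytic for $\mathrm{Im}(\xi_1)>-2\kappa$, $\mathrm{Im}(\xi_2)>-2\kappa$. The function $\tilde U'=\tilde U-\frac{1}{(\xi_1+k_1)(\xi_2+k_2)}$ is 3/4-based, i.e. its inverse Fourier transform vanishes for $x_1>0,x_2>0$. Growth conditions satisfied by $\tilde W$: there are functions $E_1,E_2$ with $|\tilde W|<E_1(\xi_1)|\xi_2|^{-1/2}$ as $|\xi_2|\to\infty$, $\mathrm{Im}(\xi_2)>0$, and $|\tilde W|<E_2(\xi_2)|\xi_1|^{-1/2}$ as $|\xi_1|\to\infty$, $\mathrm{Im}(\xi_1)>0$; and there are $\lambda>-1/2$ and a function $C(\beta,\psi_1,\psi_2)$, $0<\beta<\pi/2$, $0<\psi_{1,2}<\pi$, with $|\tilde W(\xi_1,\xi_2)|<C(\beta,\psi_1,\psi_2)\Lambda^{-1-\lambda}$ for $\xi_1=\Lambda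 e^{i\psi_1}\cos\beta$, $\xi_2=\Lambda e^{i\psi_2}\sin\beta$, $\Lambda$ large real. The function $\gamma(\xi_1,\xi_2)=\sqrt{\sqrt{k^2-\xi_1^2}+\xi_2}$, where on the physical sheet the square roots are the arithmetic ones (positive for positive real argument), the inner root having positive imaginary part for real $\xi_1$. One has $\tilde K(\xi_1,\xi_2)^{-1}=\gamma(\xi_1,\xi_2)\gamma(\xi_1,-\xi_2)=\gamma(\xi_2,\xi_1)\gamma(\xi_2,-\xi_1)$. *)

theory Defs
  imports "HOL-Analysis.Analysis"
begin

type_synonym point = "real \<times> real \<times> real"

section \<open>Differential operators\<close>

text \<open>\<open>C_on n f S\<close>: f is n times continuously differentiable on the open set S.\<close>

primrec C_on :: "nat \<Rightarrow> ('a::euclidean_space \<Rightarrow> 'b::real_normed_vector) \<Rightarrow> 'a set \<Rightarrow> bool" where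
  "C_on 0 f S \<longleftrightarrow> continuous_on S f"
| "C_on (Suc n) f S \<longleftrightarrow>
     (\<exists>f'. (\<forall>x\<in>S. (f has_derivative f' x) (at x)) \<and> (\<forall>h. C_on n (\<lambda>x. f' x h) S))"

definition smooth_on :: "('a::euclidean_space \<Rightarrow> 'b::real_normed_vector) \<Rightarrow> 'a set \<Rightarrow> bool" where
  "smooth_on f S \<longleftrightarrow> (\<forall>n. C_on n f S)"

definition partial_deriv ::
    "'a::euclidean_space \<Rightarrow> ('a \<Rightarrow> 'b::real_normed_vector) \<Rightarrow> 'a \<Rightarrow> 'b" where
  "partial_deriv b f x = vector_derivative (\<lambda>t. f (x + t *\<^sub>R b)) (at 0)"

definition laplacian :: "('a::euclidean_space \<Rightarrow> 'b::real_normed_vector) \<Rightarrow> 'a \<Rightarrow> 'b" where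
  "laplacian f x = (\<Sum>b\<in>Basis. partial_deriv b (partial_deriv b f) x)"

definition d3 :: "(point \<Rightarrow> complex) \<Rightarrow> point \<Rightarrow> complex" where
  "d3 = partial_deriv (0, 0, 1)"

text \<open>The trace \<open>f(x1, x2, 0+)\<close>.\<close>

definition trace_up :: "(point \<Rightarrow> complex) \<Rightarrow> real \<times> real \<Rightarrow> complex" where
  "trace_up f = (\<lambda>(x1, x2). Lim (at_right 0) (\<lambda>x3. f (x1, x2, x3)))"

text \<open>Holomorphy in two complex variables: the real derivative exists and is complex linear.\<close>

definition holomorphic2_on :: "(complex \<Rightarrow> complex \<Rightarrow> complex) \<Rightarrow> (complex \<times> complex) set \<Rightarrow> bool" where
  "holomorphic2_on f S \<longleftrightarrow>
     (\<forall>p\<in>S. \<exists>a b. ((\<lambda>(z1, z2). f z1 z2) has_derivative (\<lambda>(h1, h2). a * h1 + b * h2)) (at p))"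

section \<open>The quarter-plane problem\<close>

definition closed_quarter_plane :: "point set" where
  "closed_quarter_plane = {(x1, x2, x3). x3 = 0 \<and> 0 \<le> x1 \<and> 0 \<le> x2}"

definition kappa :: "real \<Rightarrow> complex \<Rightarrow> complex \<Rightarrow> real" where
  "kappa eps k1 k2 = min (eps / 2) (min (Im k1) (Im k2)) / 4"

text \<open>The parameter \<open>k3\<close> stands for the square root of \<open>k^2 - k1^2 - k2^2\<close>.\<close>

definition u_in :: "complex \<Rightarrow> complex \<Rightarrow> complex \<Rightarrow> point \<Rightarrow> complex" where
  "u_in k1 k2 k3 = (\<lambda>(x1, x2, x3). exp (\<i> * (k1 * x1 + k2 * x2 - k3 * x3)))"

definition edge_conditions :: "(point \<Rightarrow> complex) \<Rightarrow> bool" where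
  "edge_conditions ut \<longleftrightarrow>
     (\<exists>e1. \<forall>x1>0. \<forall>\<^sub>F (x2, x3) in at (0, 0).
        norm (ut (x1, x2, x3)) < e1 x1 * (x2\<^sup>2 + x3\<^sup>2) powr (1/4)) \<and>
     (\<exists>e2. \<forall>x2>0. \<forall>\<^sub>F (x1, x3) in at (0, 0).
        norm (ut (x1, x2, x3)) < e2 x2 * (x1\<^sup>2 + x3\<^sup>2) powr (1/4))"

definition vertex_condition :: "(point \<Rightarrow> complex) \<Rightarrow> bool" where
  "vertex_condition ut \<longleftrightarrow>
     (\<exists>c lam. lam > -1/2 \<and> (\<forall>\<theta>\<in>{0..pi}. \<forall>\<phi>\<in>{0..<2 * pi}. \<forall>\<^sub>F r in at_right 0.
        norm (ut (r * sin \<theta> * cos \<phi>, r * sin \<theta> * sin \<phi>, r * cos \<theta>)) < c \<theta> \<phi> * r powr lam))"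

text \<open>
  The field may be singular at the vertex (the exponent in the vertex condition may be negative),
  so continuity down to \<open>x3 = 0\<close> excludes the origin.  The Helmholtz equation is imposed in the
  classical sense off the closed quarter-plane, since no derivatives exist on its two edges.
\<close>

definition quarter_plane_problem ::
    "complex \<Rightarrow> complex \<Rightarrow> complex \<Rightarrow> complex \<Rightarrow> (point \<Rightarrow> complex) \<Rightarrow> bool" where
  "quarter_plane_problem k k1 k2 k3 u \<longleftrightarrow>
     (\<forall>x1 x2 x3. u (x1, x2, - x3) = u (x1, x2, x3)) \<and>
     smooth_on u {(x1, x2, x3). 0 < x3} \<and>
     continuous_on ({(x1, x2, x3). 0 \<le> x3} - {(0, 0, 0)}) u \<and>
     C_on 2 u (- closed_quarter_plane) \<and>
     (\<forall>x\<in>- closed_quarter_plane. laplacian u x + k\<^sup>2 * u x = 0) \<and>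
     (\<forall>x1 x2. 0 < x1 \<and> 0 < x2 \<longrightarrow> u (x1, x2, 0) = - exp (\<i> * (k1 * x1 + k2 * x2))) \<and>
     (\<forall>x1 x2. x1 < 0 \<or> x2 < 0 \<longrightarrow> d3 u (x1, x2, 0) = 0) \<and>
     (\<forall>x1 x2. 0 < x1 \<and> 0 < x2 \<longrightarrow> (\<exists>l. ((\<lambda>x3. d3 u (x1, x2, x3)) \<longlongrightarrow> l) (at_right 0))) \<and>
     (u \<longlongrightarrow> 0) at_infinity \<and>
     edge_conditions (\<lambda>x. u_in k1 k2 k3 x + u x) \<and>
     vertex_condition (\<lambda>x. u_in k1 k2 k3 x + u x)"

definition exp_decay :: "real \<Rightarrow> (point \<Rightarrow> complex) \<Rightarrow> bool" where
  "exp_decay \<kappa> u \<longleftrightarrow>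
     (\<exists>C. \<forall>\<^sub>F (x1, x2) in at_infinity.
        norm (trace_up u (x1, x2)) < C * exp (- 4 * \<kappa> * sqrt (x1\<^sup>2 + x2\<^sup>2)))"

section \<open>Spectral functions\<close>

definition fourier_integrand ::
    "(real \<times> real \<Rightarrow> complex) \<Rightarrow> complex \<Rightarrow> complex \<Rightarrow> real \<times> real \<Rightarrow> complex" where
  "fourier_integrand \<phi> \<xi>1 \<xi>2 = (\<lambda>(x1, x2). \<phi> (x1, x2) * exp (\<i> * (\<xi>1 * x1 + \<xi>2 * x2)))"

definition fourier2 :: "(real \<times> real \<Rightarrow> complex) \<Rightarrow> complex \<Rightarrow> complex \<Rightarrow> complex" where
  "fourier2 \<phi> \<xi>1 \<xi>2 = (LINT x|lborel. fourier_integrand \<phi> \<xi>1 \<xi>2 x)"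

definition U_spec :: "(point \<Rightarrow> complex) \<Rightarrow> complex \<Rightarrow> complex \<Rightarrow> complex" where
  "U_spec u = fourier2 (trace_up u)"

definition W_spec :: "(point \<Rightarrow> complex) \<Rightarrow> complex \<Rightarrow> complex \<Rightarrow> complex" where
  "W_spec u = fourier2 (trace_up (d3 u))"

text \<open>
  The square root with nonnegative imaginary part, positive on the positive reals.  The principal
  root \<open>csqrt\<close> would be the wrong branch for \<open>k^2 - \<xi>1^2 - \<xi>2^2\<close> and \<open>k^2 - \<xi>1^2\<close>: these are in the
  upper half-plane for real arguments but cross the negative real axis when the arguments move
  into the strips used below.  With \<open>sqrt_up\<close> both roots are analytic there: for \<open>0 < \<epsilon> < 1\<close> and
  \<open>\<bar>Im \<xi>j\<bar> \<le> \<kappa> \<le> \<epsilon>/8\<close> these quantities avoid the cut, the nonnegative real axis.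
\<close>

definition sqrt_up :: "complex \<Rightarrow> complex" where
  "sqrt_up z = (if Im (csqrt z) < 0 then - csqrt z else csqrt z)"

definition K_spec :: "complex \<Rightarrow> complex \<Rightarrow> complex \<Rightarrow> complex" where
  "K_spec k \<xi>1 \<xi>2 = 1 / sqrt_up (k\<^sup>2 - \<xi>1\<^sup>2 - \<xi>2\<^sup>2)"

text \<open>
  In the strips above the imaginary part of the inner root exceeds \<open>\<kappa>\<close>, so every argument of the
  outer root that occurs lies in the upper half-plane, where \<open>csqrt\<close> is the arithmetic branch.
\<close>

definition gamma :: "complex \<Rightarrow> complex \<Rightarrow> complex \<Rightarrow> complex" where
  "gamma k \<xi>1 \<xi>2 = csqrt (sqrt_up (k\<^sup>2 - \<xi>1\<^sup>2) + \<xi>2)"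

definition growth_conditions :: "real \<Rightarrow> (complex \<Rightarrow> complex \<Rightarrow> complex) \<Rightarrow> bool" where
  "growth_conditions \<kappa> W \<longleftrightarrow>
     (\<exists>E1. \<forall>\<xi>1. Im \<xi>1 > - 2 * \<kappa> \<longrightarrow>
        (\<forall>\<^sub>F \<xi>2 in inf at_infinity (principal {z. Im z > 0}).
           norm (W \<xi>1 \<xi>2) < E1 \<xi>1 * norm \<xi>2 powr (-1/2))) \<and>
     (\<exists>E2. \<forall>\<xi>2. Im \<xi>2 > - 2 * \<kappa> \<longrightarrow>
        (\<forall>\<^sub>F \<xi>1 in inf at_infinity (principal {z. Im z > 0}).
           norm (W \<xi>1 \<xi>2) < E2 \<xi>2 * norm \<xi>1 powr (-1/2))) \<and>
     (\<exists>lam C. lam > -1/2 \<and>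
        (\<forall>\<beta>\<in>{0<..<pi/2}. \<forall>\<psi>1\<in>{0<..<pi}. \<forall>\<psi>2\<in>{0<..<pi}. \<forall>\<^sub>F L in at_top.
           norm (W (L * exp (\<i> * \<psi>1) * cos \<beta>) (L * exp (\<i> * \<psi>2) * sin \<beta>))
             < C \<beta> \<psi>1 \<psi>2 * L powr (-1 - lam)))"

section \<open>Integrals along horizontal lines\<close>

text \<open>The line \<open>Im \<xi> = c\<close>, traversed from left to right.\<close>

definition line_integrable :: "real \<Rightarrow> (complex \<Rightarrow> complex) \<Rightarrow> bool" where
  "line_integrable c f \<longleftrightarrow> integrable lborel (\<lambda>t. f (Complex t c))"

definition line_integral :: "real \<Rightarrow> (complex \<Rightarrow> complex) \<Rightarrow> complex" where
  "line_integral c f = (LINT t|lborel. f (Complex t c))"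

text \<open>
  \<open>iterated_integrable c d F\<close>: the iterated integral, inner variable on \<open>Im = c\<close> and outer variable
  on \<open>Im = d\<close>, converges absolutely at both stages.  It accompanies \<open>line_integral\<close>, whose value
  for a non-integrable function is by convention 0.
\<close>

definition iterated_integrable :: "real \<Rightarrow> real \<Rightarrow> (complex \<Rightarrow> complex \<Rightarrow> complex) \<Rightarrow> bool" where
  "iterated_integrable c d F \<longleftrightarrow>
     (\<forall>\<eta>. Im \<eta> = d \<longrightarrow> line_integrable c (\<lambda>\<zeta>. F \<zeta> \<eta>)) \<and>
     line_integrable d (\<lambda>\<eta>. line_integral c (\<lambda>\<zeta>. F \<zeta> \<eta>))"

definition iterated_integral :: "real \<Rightarrow> real \<Rightarrow> (complex \<Rightarrow> complex \<Rightarrow> complex) \<Rightarrow> complex" where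
  "iterated_integral c d F = line_integral d (\<lambda>\<eta>. line_integral c (\<lambda>\<zeta>. F \<zeta> \<eta>))"

end

theory Submission
  imports Defs "HOL-Complex_Analysis.Complex_Analysis"
begin

text \<open>
  The proof is two Wiener--Hopf steps, one per variable.  Write \<open>U\<close> for the transform of the trace of
  the field; the functional equation, known for real arguments, extends by the identity theorem to
  \<open>K W = \<i> U\<close> on the strips where both sides are holomorphic (\<open>functional_strip\<close>).

  Inner integral.  The trace splits into its restrictions to \<open>x1 \<ge> 0\<close> and \<open>x1 < 0\<close>, so
  \<open>U = U_right + U_left\<close> with summands holomorphic in an upper and in a lower half-plane of \<open>\<xi>1'\<close>.
  Integrating against \<open>1 / (\<xi>1' - \<xi>1)\<close> over a line above \<open>\<xi>1\<close> kills \<open>U_right\<close> and, by Cauchy's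
  formula, evaluates \<open>U_left\<close> at \<open>\<xi>1\<close> (\<open>inner_line_integral\<close>).

  Outer integral.  What remains is the integral of \<open>\<gamma>(\<xi>1, -\<xi>2') U_left(\<xi>1, \<xi>2') / (\<xi>2' - \<xi>2)\<close> over a
  line below \<open>\<xi>2\<close>, and \<open>U_left = U - U_upper_right - U_lower_right\<close>.  Each term is evaluated by closing
  the contour on the side where it is holomorphic.  By \<open>1 / K = \<gamma>(\<xi>1, \<xi>2) \<gamma>(\<xi>1, -\<xi>2)\<close> the first term is
  a multiple of \<open>W / \<gamma>\<close>, holomorphic above, and gives \<open>W(\<xi>1, \<xi>2) / \<gamma>(\<xi>1, \<xi>2)\<close>
  (\<open>outer_U\<close>).  The second is the explicit transform of the incident wave on the quarter-plane, whose
  pole at \<open>-k2\<close> produces the forcing term (\<open>outer_U_upper_right\<close>).  The third is holomorphic below and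
  contributes nothing.  The second relation is the first one with the two variables exchanged.

  Two analytic points make the contour arguments work.  Since \<open>W\<close> is the transform of an integrable
  function on the quarter-plane, it is bounded, and \<open>K\<close> decays like the inverse norm of
  \<open>(\<xi>1, \<xi>2)\<close>; all integrals on the lines therefore converge absolutely (\<open>KW_decay\<close>,
  \<open>U_left_decay\<close>, \<open>gamma_line_integrable\<close>).  Inside the half-planes, however, the separate pieces of
  \<open>U\<close> are merely bounded, too little to close a contour.  The missing decay is supplied by a
  second pole far away on the imaginary axis, which is then sent to infinity by dominated
  convergence (\<open>line_integral_pole_to_infinity\<close>).
\<close>

section \<open>Horizontal lines as limits of rectangles\<close>

abbreviation upper_infinity :: "real \<Rightarrow> complex filter" where
  "upper_infinity c \<equiv> inf at_infinity (principal {z. c \<le> Im z})"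

lemma line_integral_from_segments:
  fixes f :: "complex \<Rightarrow> complex"
  assumes int: "line_integrable c f"
    and cont: "continuous_on {z. Im z = c} f"
  shows "(\<lambda>n. contour_integral (linepath (Complex (- real n) c) (Complex (real n) c)) f)
    \<longlonglongrightarrow> line_integral c f"
proof -
  define h where "h = (\<lambda>t. f (Complex t c))"
  have inth: "integrable lborel h"
    using int by (simp add: h_def line_integrable_def)
  have conth: "continuous_on S h" for S
    unfolding h_def Complex_eq
    by (rule continuous_on_compose2[OF cont]) (auto intro!: continuous_intros)
  have "(\<lambda>n. LINT t|lborel. indicator {- real n..real n} t *\<^sub>R h t) \<longlonglongrightarrow> (LINT t|lborel. h t)"
  proof (rule integral_dominated_convergence[where w = "\<lambda>t. norm (h t)"])
    show "AE t in lborel. (\<lambda>n. indicator {- real n..real n} t *\<^sub>R h t) \<longlonglongrightarrow> h t"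
    proof (rule AE_I2)
      fix t :: real
      have "eventually (\<lambda>n. indicator {- real n..real n} t *\<^sub>R h t = h t) sequentially"
        using eventually_ge_at_top[of "nat \<lceil>\<bar>t\<bar>\<rceil>"]
        by eventually_elim (auto simp: indicator_def abs_le_iff nat_le_iff ceiling_le_iff)
      then show "(\<lambda>n. indicator {- real n..real n} t *\<^sub>R h t) \<longlonglongrightarrow> h t"
        by (rule tendsto_eventually)
    qed
  qed (use inth in \<open>auto simp: indicator_def\<close>)
  moreover have "eventually (\<lambda>n. (LINT t|lborel. indicator {- real n..real n} t *\<^sub>R h t) =
      contour_integral (linepath (Complex (- real n) c) (Complex (real n) c)) f) sequentially"
    using eventually_gt_at_top[of 0]
  proof eventually_elim
    case (elim n)
    have "(LINT t|lborel. indicator {- real n..real n} t *\<^sub>R h t) = integral {- real n..real n} h"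
      using set_borel_integral_eq_integral(2)[of "{- real n..real n}" h] inth
      unfolding set_lebesgue_integral_def set_integrable_def
      by (simp add: borel_integrable_atLeastAtMost' conth integrable_mult_indicator)
    also have "\<dots> = contour_integral (linepath (complex_of_real (- real n)) (of_real (real n)))
        (\<lambda>z. f (z + \<i> * of_real c))"
      using elim by (subst contour_integral_linepath_Reals_eq) (auto simp: h_def Complex_eq)
    also have "\<dots> = contour_integral (linepath (Complex (- real n) c) (Complex (real n) c)) f"
      unfolding contour_integral_integral vector_derivative_linepath_at
      by (intro integral_cong arg_cong2[where f = "(*)"] arg_cong[where f = f])
        (auto simp: linepath_def complex_eq_iff algebra_simps)
    finally show ?case .
  qed
  ultimately show ?thesis
    unfolding line_integral_def h_def[symmetric] by (rule Lim_transform_eventually)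
qed

text \<open>
  Each of the three other sides of the rectangle has length of order \<open>R\<close> and lies at distance of
  order \<open>R\<close> from the origin, where the integrand is \<open>o(1/R)\<close>; they disappear in the limit.
\<close>

lemma line_integral_from_rectangles:
  fixes f :: "complex \<Rightarrow> complex"
  assumes int: "line_integrable c f"
    and cont: "continuous_on {z. Im z = c} f"
    and lim: "((\<lambda>z. z * f z) \<longlongrightarrow> 0) (upper_infinity c)"
    and rect: "\<forall>\<^sub>F R in at_top. (f has_contour_integral J) (rectpath (Complex (- R) c) (Complex R (c + R)))"
  shows "line_integral c f = J"
proof -
  let ?bottom = "\<lambda>R. contour_integral (linepath (Complex (- R) c) (Complex R c)) f"
  have close: "\<forall>\<^sub>F n in sequentially. norm (J - ?bottom (real n)) \<le> e" if "e > 0" for e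
  proof -
    \<comment> \<open>the right, top and left sides contribute at most \<open>2 * d\<close>, \<open>4 * d\<close> and \<open>2 * d\<close>\<close>
    define d where "d = e / 8"
    have "d > 0" using that by (simp add: d_def)
    then have "\<forall>\<^sub>F z in upper_infinity c. norm (z * f z) < d"
      using lim by (auto simp: tendsto_iff)
    then obtain B where B: "\<And>z. norm z \<ge> B \<Longrightarrow> Im z \<ge> c \<Longrightarrow> norm (z * f z) < d"
      by (auto simp: eventually_inf_principal eventually_at_infinity)
    from rect obtain R0 where R0: "\<And>R. R \<ge> R0 \<Longrightarrow>
        (f has_contour_integral J) (rectpath (Complex (- R) c) (Complex R (c + R)))"
      by (auto simp: eventually_at_top_linorder)
    have "\<forall>\<^sub>F n in sequentially. real n \<ge> max R0 (max (2 * \<bar>B\<bar>) (max (2 * \<bar>c\<bar>) 1))"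
      by (rule eventually_compose_filterlim[OF eventually_ge_at_top filterlim_real_sequentially])
    then show ?thesis
    proof eventually_elim
      case (elim n)
      define R where "R = real n"
      have R: "R \<ge> R0" "R \<ge> 2 * \<bar>B\<bar>" "R \<ge> 2 * \<bar>c\<bar>" "R > 0"
        using elim by (auto simp: R_def)
      define a1 a2 a3 a4 where a: "a1 = Complex (- R) c" "a2 = Complex R c"
        "a3 = Complex R (c + R)" "a4 = Complex (- R) (c + R)"
      have hci: "(f has_contour_integral J)
          (linepath a1 a2 +++ linepath a2 a3 +++ linepath a3 a4 +++ linepath a4 a1)"
        using R0[OF R(1)] by (simp add: rectpath_def a Let_def)
      then have "f contour_integrable_on
          (linepath a1 a2 +++ linepath a2 a3 +++ linepath a3 a4 +++ linepath a4 a1)"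
        by (auto simp: contour_integrable_on_def)
      then have ci: "f contour_integrable_on linepath a1 a2" "f contour_integrable_on linepath a2 a3"
          "f contour_integrable_on linepath a3 a4" "f contour_integrable_on linepath a4 a1"
        by auto
      have J: "J = contour_integral (linepath a1 a2) f + (contour_integral (linepath a2 a3) f +
          (contour_integral (linepath a3 a4) f + contour_integral (linepath a4 a1) f))"
        using contour_integral_unique[OF hci] ci by simp
      have far: "norm (f z) \<le> d / (R / 2)" if "Im z \<ge> c" "norm z \<ge> R / 2" for z
      proof -
        have "norm z > 0" using that R by linarith
        have "B \<le> norm z" using that R by linarith
        then have "norm z * norm (f z) \<le> d"
          using B[of z] that(1) by (auto simp: norm_mult)
        then have "norm (f z) \<le> d / norm z"
          using \<open>norm z > 0\<close> by (simp add: field_simps)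
        also have "\<dots> \<le> d / (R / 2)"
          using that R \<open>d > 0\<close> by (intro divide_left_mono mult_pos_pos) auto
        finally show ?thesis .
      qed
      have side: "norm (contour_integral (linepath a2 a3) f) \<le> d / (R / 2) * norm (a3 - a2)"
      proof (rule contour_integral_bound_linepath[OF ci(2)])
        fix z assume "z \<in> closed_segment a2 a3"
        then have "Re z = R" "Im z \<ge> c"
          using R by (auto simp: a closed_segment_same_Re closed_segment_eq_real_ivl)
        then show "norm (f z) \<le> d / (R / 2)"
          using abs_Re_le_cmod[of z] R by (intro far) auto
      qed (use R \<open>d > 0\<close> in auto)
      have side': "norm (contour_integral (linepath a4 a1) f) \<le> d / (R / 2) * norm (a1 - a4)"
      proof (rule contour_integral_bound_linepath[OF ci(4)])
        fix z assume "z \<in> closed_segment a4 a1"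
        then have "Re z = - R" "Im z \<ge> c"
          using R by (auto simp: a closed_segment_same_Re closed_segment_eq_real_ivl)
        then show "norm (f z) \<le> d / (R / 2)"
          using abs_Re_le_cmod[of z] R by (intro far) auto
      qed (use R \<open>d > 0\<close> in auto)
      have top: "norm (contour_integral (linepath a3 a4) f) \<le> d / (R / 2) * norm (a4 - a3)"
      proof (rule contour_integral_bound_linepath[OF ci(3)])
        fix z assume "z \<in> closed_segment a3 a4"
        then have "Im z = c + R"
          using R by (auto simp: a closed_segment_same_Im closed_segment_eq_real_ivl)
        then show "norm (f z) \<le> d / (R / 2)"
          using abs_Im_le_cmod[of z] R by (intro far) auto
      qed (use R \<open>d > 0\<close> in auto)
      have "a4 - a3 = of_real (- 2 * R)" by (simp add: a complex_eq_iff)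
      then have n: "norm (a3 - a2) = R" "norm (a1 - a4) = R" "norm (a4 - a3) = 2 * R"
        using R by (simp_all only: norm_of_real) (auto simp: a cmod_def)
      have "norm (J - contour_integral (linepath a1 a2) f) \<le>
          norm (contour_integral (linepath a2 a3) f) + (norm (contour_integral (linepath a3 a4) f) +
            norm (contour_integral (linepath a4 a1) f))"
        unfolding J by (simp, intro norm_triangle_le add_left_mono norm_triangle_ineq)
      also have "\<dots> \<le> 2 * d + (4 * d + 2 * d)"
        using side side' top R by (auto simp: n intro!: add_mono)
      also have "\<dots> = e"
        using that by (simp add: d_def)
      finally show ?case unfolding a R_def .
    qed
  qed
  have "(?bottom \<circ> real) \<longlonglongrightarrow> J"
  proof (rule tendstoI)
    fix e :: real assume "e > 0"
    show "\<forall>\<^sub>F n in sequentially. dist ((?bottom \<circ> real) n) J < e"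
      using close[of "e / 2"] \<open>e > 0\<close>
      by (auto elim!: eventually_mono simp: dist_norm norm_minus_commute)
  qed
  moreover have "(?bottom \<circ> real) \<longlonglongrightarrow> line_integral c f"
    using line_integral_from_segments[OF int cont] by (simp add: o_def)
  ultimately show ?thesis
    by (meson LIMSEQ_unique)
qed

section \<open>Cauchy's formula in half-planes\<close>

text \<open>
  A pole above the line is eventually inside the rectangle; for a pole below it the integrand is
  holomorphic on a half-plane that contains the whole rectangle.
\<close>

lemma Cauchy_integral_rectangle:
  fixes g :: "complex \<Rightarrow> complex"
  assumes hol: "g holomorphic_on {z. a < Im z}" and "a < c" and p: "Im p \<noteq> c"
  shows "\<forall>\<^sub>F R in at_top. ((\<lambda>z. g z / (z - p)) has_contour_integral
    (if c < Im p then 2 * of_real pi * \<i> * g p else 0)) (rectpath (Complex (- R) c) (Complex R (c + R)))"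
proof -
  have "\<forall>\<^sub>F R in at_top. R > \<bar>Re p\<bar> + \<bar>Im p\<bar> + \<bar>c\<bar>"
    by (rule eventually_gt_at_top)
  then show ?thesis
  proof eventually_elim
    case (elim R)
    let ?r = "rectpath (Complex (- R) c) (Complex R (c + R))"
    have im: "path_image ?r \<subseteq> {z. c \<le> Im z}"
      using elim path_image_rectpath_subset_cbox[of "Complex (- R) c" "Complex R (c + R)"]
      by (force simp: in_cbox_complex_iff)
    show ?case
    proof (cases "c < Im p")
      case True
      then have box: "p \<in> box (Complex (- R) c) (Complex R (c + R))"
        using elim by (auto simp: in_box_complex_iff)
      have "((\<lambda>z. g z / (z - p)) has_contour_integral
          (2 * pi * \<i> * winding_number ?r p * g p)) ?r"
      proof (rule Cauchy_integral_formula_convex_simple)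
        show "convex {z. a < Im z}" by (rule convex_halfspace_Im_gt)
        show "p \<in> interior {z. a < Im z}"
          using True \<open>a < c\<close> by (simp add: interior_open open_halfspace_Im_gt)
        show "path_image ?r \<subseteq> {z. a < Im z} - {p}"
          using im \<open>a < c\<close> box path_image_rectpath_inter_box[of "Complex (- R) c" "Complex R (c + R)"]
            elim by fastforce
      qed (use hol in auto)
      then show ?thesis
        using True winding_number_rectpath[OF box] by simp
    next
      case False
      have "((\<lambda>z. g z / (z - p)) has_contour_integral 0) ?r"
      proof (rule Cauchy_theorem_convex_simple)
        show "(\<lambda>z. g z / (z - p)) holomorphic_on {z. max a (Im p) < Im z}"
          by (intro holomorphic_intros holomorphic_on_subset[OF hol]) auto
        show "path_image ?r \<subseteq> {z. max a (Im p) < Im z}"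
          using im False p \<open>a < c\<close> by force
        show "convex {z. max a (Im p) < Im z}" by (rule convex_halfspace_Im_gt)
      qed auto
      then show ?thesis
        using False by simp
    qed
  qed
qed

lemma filterlim_shift_at_infinity:
  "filterlim (\<lambda>z::complex. z - p) at_infinity at_infinity"
  using tendsto_add_filterlim_at_infinity'[OF filterlim_ident tendsto_const, of "- p"] by simp

lemma tendsto_div_shift_at_infinity:
  "((\<lambda>z::complex. z / (z - p)) \<longlongrightarrow> 1) at_infinity"
proof -
  have "((\<lambda>z. 1 + p / (z - p)) \<longlongrightarrow> 1 + 0) at_infinity"
    by (intro tendsto_intros tendsto_divide_0[OF tendsto_const filterlim_shift_at_infinity])
  moreover have "\<forall>\<^sub>F z in at_infinity. 1 + p / (z - p) = z / (z - p)"
    unfolding eventually_at_infinity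
  proof (rule exI[of _ "norm p + 1"], intro allI impI)
    fix z :: complex assume "norm p + 1 \<le> norm z"
    then have "z - p \<noteq> 0" by auto
    then show "1 + p / (z - p) = z / (z - p)" by (simp add: divide_simps)
  qed
  ultimately show ?thesis
    by (auto elim: Lim_transform_eventually)
qed

text \<open>
  The second denominator provides the decay that closes the contour even when \<open>g\<close> itself does not
  decay: \<open>g(z) = o(z)\<close> is enough.  The value follows from partial fractions on the rectangles, not on
  the line, where the two separate fractions need not be integrable.
\<close>

lemma Cauchy_two_poles_upper:
  fixes g :: "complex \<Rightarrow> complex"
  assumes hol: "g holomorphic_on {z. a < Im z}" and "a < c"
    and lim: "((\<lambda>z. g z / z) \<longlongrightarrow> 0) (upper_infinity c)"
    and p: "Im p \<noteq> c" and q: "Im q \<noteq> c" and "p \<noteq> q"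
    and int: "line_integrable c (\<lambda>z. g z / ((z - p) * (z - q)))"
  shows "line_integral c (\<lambda>z. g z / ((z - p) * (z - q))) =
    2 * of_real pi * \<i> * ((if c < Im p then g p else 0) - (if c < Im q then g q else 0)) / (p - q)"
proof (rule line_integral_from_rectangles[OF int])
  let ?J = "\<lambda>p. if c < Im p then 2 * of_real pi * \<i> * g p else 0"
  show "continuous_on {z. Im z = c} (\<lambda>z. g z / ((z - p) * (z - q)))"
    using p q \<open>a < c\<close>
    by (intro continuous_intros holomorphic_on_imp_continuous_on holomorphic_on_subset[OF hol]) auto
  have "((\<lambda>z. g z / z * (z / (z - p) * (z / (z - q)))) \<longlongrightarrow> 0 * (1 * 1)) (upper_infinity c)"
    by (intro tendsto_mult lim tendsto_mono[OF _ tendsto_div_shift_at_infinity]) auto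
  moreover have "\<forall>\<^sub>F z in upper_infinity c. g z / z * (z / (z - p) * (z / (z - q))) =
      z * (g z / ((z - p) * (z - q)))"
  proof (rule filter_leD[OF inf.cobounded1])
    show "\<forall>\<^sub>F z in at_infinity. g z / z * (z / (z - p) * (z / (z - q))) =
        z * (g z / ((z - p) * (z - q)))"
      unfolding eventually_at_infinity by (rule exI[of _ 1]) auto
  qed
  ultimately show "((\<lambda>z. z * (g z / ((z - p) * (z - q)))) \<longlongrightarrow> 0) (upper_infinity c)"
    by (auto elim: Lim_transform_eventually)
  have *: "g z / ((z - p) * (z - q)) = (g z / (z - p) - g z / (z - q)) / (p - q)"
    if "z \<noteq> p" "z \<noteq> q" for z
    using that \<open>p \<noteq> q\<close> by (simp add: divide_simps) (simp add: algebra_simps)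
  show "\<forall>\<^sub>F R in at_top. ((\<lambda>z. g z / ((z - p) * (z - q))) has_contour_integral
      2 * of_real pi * \<i> * ((if c < Im p then g p else 0) - (if c < Im q then g q else 0)) / (p - q))
      (rectpath (Complex (- R) c) (Complex R (c + R)))"
    using Cauchy_integral_rectangle[OF hol \<open>a < c\<close> p] Cauchy_integral_rectangle[OF hol \<open>a < c\<close> q]
      eventually_gt_at_top[of "\<bar>Re p\<bar> + \<bar>Im p\<bar> + \<bar>c\<bar>"]
      eventually_gt_at_top[of "\<bar>Re q\<bar> + \<bar>Im q\<bar> + \<bar>c\<bar>"]
  proof eventually_elim
    case (elim R)
    let ?r = "rectpath (Complex (- R) c) (Complex R (c + R))"
    have off: "w \<notin> path_image ?r" if "Im w \<noteq> c" "\<bar>Re w\<bar> + \<bar>Im w\<bar> + \<bar>c\<bar> < R" for w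
      using that by (subst path_image_rectpath) auto
    have "((\<lambda>z. (g z / (z - p) - g z / (z - q)) / (p - q)) has_contour_integral
        (?J p - ?J q) / (p - q)) ?r"
      by (intro has_contour_integral_div has_contour_integral_diff elim)
    moreover have "(?J p - ?J q) / (p - q) = 2 * of_real pi * \<i> *
        ((if c < Im p then g p else 0) - (if c < Im q then g q else 0)) / (p - q)"
      by (simp add: algebra_simps)
    ultimately have "((\<lambda>z. (g z / (z - p) - g z / (z - q)) / (p - q)) has_contour_integral
        2 * of_real pi * \<i> * ((if c < Im p then g p else 0) - (if c < Im q then g q else 0)) / (p - q)) ?r"
      by simp
    then show ?case
      by (rule has_contour_integral_eq) (use * off[OF p] off[OF q] elim in force)
  qed
qed

text \<open>
  The tool that replaces decay of \<open>g\<close>: the factor \<open>(p - q n) / (z - q n)\<close> is bounded on the line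
  uniformly in \<open>n\<close> and tends to 1, so an absolutely convergent one-pole integral is a limit of
  two-pole integrals.  The lower bound on \<open>N\<close> keeps \<open>q n\<close> below the line and away from \<open>p\<close>.
\<close>

lemma line_integral_pole_to_infinity:
  fixes g :: "complex \<Rightarrow> complex" and N :: real
  defines "q \<equiv> (\<lambda>n. - \<i> * of_real (N + real n))"
  assumes N: "norm p + \<bar>c\<bar> + 1 \<le> N"
    and int: "line_integrable c (\<lambda>z. g z / (z - p))"
  shows "Im (q n) < c" and "p \<noteq> q n"
    and "line_integrable c (\<lambda>z. g z / ((z - p) * (z - q n)))"
    and "(\<lambda>n. (p - q n) * line_integral c (\<lambda>z. g z / ((z - p) * (z - q n))))
      \<longlonglongrightarrow> line_integral c (\<lambda>z. g z / (z - p))"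
proof -
  have N1: "N \<ge> 1" using N norm_ge_zero[of p] by linarith
  have Imq: "Im (q n) = - (N + real n)" for n by (simp add: q_def)
  show qc: "Im (q n) < c" for n
    using N norm_ge_zero[of p] of_nat_0_le_iff[of n, where 'a = real] unfolding Imq by linarith
  show qp: "p \<noteq> q n" for n
  proof
    assume "p = q n"
    then have "\<bar>Im p\<bar> \<ge> N" using N1 by (simp add: Imq)
    then show False using N abs_Im_le_cmod[of p] by linarith
  qed
  define f where "f = (\<lambda>n z. (p - q n) * (g z / ((z - p) * (z - q n))))"
  have ratio: "norm ((p - q n) / (Complex t c - q n)) \<le> 2 * N + 1" for n t
  proof -
    have "norm (Complex t c - q n) \<ge> \<bar>Im (Complex t c - q n)\<bar>" by (rule abs_Im_le_cmod)
    then have z: "norm (Complex t c - q n) \<ge> c + N + real n" using N1 by (auto simp: Imq)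
    have "norm (p - q n) \<le> norm p + norm (q n)" by (rule norm_triangle_ineq4)
    moreover have "norm (q n) = N + real n"
      using N1 by (simp add: q_def norm_mult del: of_real_add)
    ultimately have "norm (p - q n) \<le> norm p + N + real n" by simp
    also have "\<dots> \<le> (2 * N + 1) * (c + N + real n)"
    proof -
      have "(2 * N + 1) * (c + N + real n) = (2 * N) * (c + N + real n) + (c + N + real n)"
        by (simp add: algebra_simps)
      moreover have "c + N + real n \<ge> 1" using N norm_ge_zero[of p] by linarith
      then have "(2 * N) * (c + N + real n) \<ge> 2 * N * 1"
        using N1 by (intro mult_left_mono) auto
      ultimately show ?thesis using N N1 by linarith
    qed
    also have "\<dots> \<le> (2 * N + 1) * norm (Complex t c - q n)"
      using z N1 by (intro mult_left_mono) auto
    finally show ?thesis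
      using qc[of n] N1 by (auto simp: norm_divide divide_simps)
  qed
  have f_eq: "f n z = g z / (z - p) * ((p - q n) / (z - q n))" for n z
    by (simp add: f_def)
  have meas: "(\<lambda>t. g (Complex t c) / (Complex t c - p)) \<in> borel_measurable lborel"
    using int by (auto simp: line_integrable_def)
  have Cmeas: "(\<lambda>t. Complex t c) \<in> borel_measurable borel"
    unfolding Complex_eq by measurable
  have measf: "(\<lambda>t. f n (Complex t c)) \<in> borel_measurable lborel" for n
    unfolding f_eq using meas Cmeas by measurable
  have bound: "norm (f n (Complex t c)) \<le> (2 * N + 1) * norm (g (Complex t c) / (Complex t c - p))" for n t
    using mult_left_mono[OF ratio[of n t] norm_ge_zero[of "g (Complex t c) / (Complex t c - p)"]]
    unfolding f_eq norm_mult by (simp only: mult_ac)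
  have intw: "integrable lborel (\<lambda>t. (2 * N + 1) * norm (g (Complex t c) / (Complex t c - p)))"
    using int by (auto simp: line_integrable_def)
  have "line_integrable c (f n)" for n
    unfolding line_integrable_def
    by (rule Bochner_Integration.integrable_bound[OF intw measf]) (use bound N1 in auto)
  then show "line_integrable c (\<lambda>z. g z / ((z - p) * (z - q n)))" for n
    using qp[of n] integrable_mult_right[of "1 / (p - q n)" lborel "\<lambda>t. f n (Complex t c)"]
    unfolding f_def line_integrable_def by simp
  have "(\<lambda>n. line_integral c (f n)) \<longlonglongrightarrow> line_integral c (\<lambda>z. g z / (z - p))"
    unfolding line_integral_def
  proof (rule integral_dominated_convergence[OF _ _ intw])
    show "AE t in lborel. (\<lambda>n. f n (Complex t c)) \<longlonglongrightarrow> g (Complex t c) / (Complex t c - p)"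
    proof (rule AE_I2)
      fix t
      have "filterlim (\<lambda>n. Complex t c - q n) at_infinity sequentially"
      proof -
        have "filterlim (\<lambda>n. N + real n) at_top sequentially"
          by (intro filterlim_tendsto_add_at_top[OF tendsto_const filterlim_real_sequentially])
        then have "filterlim (\<lambda>n. complex_of_real (N + real n)) at_infinity sequentially"
          by (rule filterlim_compose[OF filterlim_of_real_at_infinity])
        then have "filterlim (\<lambda>n. \<i> * complex_of_real (N + real n)) at_infinity sequentially"
          by (intro tendsto_mult_filterlim_at_infinity[OF tendsto_const]) auto
        then show ?thesis
          using tendsto_add_filterlim_at_infinity[OF tendsto_const[of "Complex t c"]]
          by (auto simp: q_def)
      qed
      then have "(\<lambda>n. (p - Complex t c) / (Complex t c - q n)) \<longlonglongrightarrow> 0"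
        by (rule tendsto_divide_0[OF tendsto_const])
      then have "(\<lambda>n. 1 + (p - Complex t c) / (Complex t c - q n)) \<longlonglongrightarrow> 1 + 0"
        by (intro tendsto_intros)
      moreover have "1 + (p - Complex t c) / (Complex t c - q n) = (p - q n) / (Complex t c - q n)" for n
      proof -
        have "Im (Complex t c - q n) \<noteq> 0" using qc[of n] by simp
        then have "Complex t c - q n \<noteq> 0" by (metis zero_complex.simps(2))
        then show ?thesis by (simp add: divide_simps)
      qed
      ultimately have "(\<lambda>n. (p - q n) / (Complex t c - q n)) \<longlonglongrightarrow> 1" by simp
      from tendsto_mult[OF tendsto_const[of "g (Complex t c) / (Complex t c - p)"] this]
      show "(\<lambda>n. f n (Complex t c)) \<longlonglongrightarrow> g (Complex t c) / (Complex t c - p)"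
        by (simp add: f_eq)
    qed
  qed (use meas measf bound in auto)
  moreover have "line_integral c (f n) = (p - q n) * line_integral c (\<lambda>z. g z / ((z - p) * (z - q n)))" for n
    unfolding f_def line_integral_def by (rule integral_mult_right_zero)
  ultimately show "(\<lambda>n. (p - q n) * line_integral c (\<lambda>z. g z / ((z - p) * (z - q n))))
      \<longlonglongrightarrow> line_integral c (\<lambda>z. g z / (z - p))"
    by simp
qed

text \<open>
  With the far pole below the line, every term of the approximating sequence already has the limit value.
\<close>

lemma Cauchy_one_pole_upper:
  fixes g :: "complex \<Rightarrow> complex"
  assumes hol: "g holomorphic_on {z. a < Im z}" and "a < c"
    and lim: "((\<lambda>z. g z / z) \<longlongrightarrow> 0) (upper_infinity c)"
    and p: "Im p \<noteq> c"
    and int: "line_integrable c (\<lambda>z. g z / (z - p))"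
  shows "line_integral c (\<lambda>z. g z / (z - p)) = 2 * of_real pi * \<i> * (if c < Im p then g p else 0)"
proof -
  note far = line_integral_pole_to_infinity[OF order_refl int]
  have "(p - q) * line_integral c (\<lambda>z. g z / ((z - p) * (z - q))) =
      2 * of_real pi * \<i> * (if c < Im p then g p else 0)"
    if "Im q < c" "p \<noteq> q" "line_integrable c (\<lambda>z. g z / ((z - p) * (z - q)))" for q
    using that by (subst Cauchy_two_poles_upper[OF hol \<open>a < c\<close> lim p _ _ that(3)]) auto
  from this[OF far(1-3)] show ?thesis
    using LIMSEQ_unique[OF far(4)] by (simp only: tendsto_const)
qed

abbreviation lower_infinity :: "real \<Rightarrow> complex filter" where
  "lower_infinity c \<equiv> inf at_infinity (principal {z. Im z \<le> c})"

lemma uminus_Complex: "- Complex a b = Complex (- a) (- b)"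
  by (simp add: complex_eq_iff)

lemma line_integral_reflect: "line_integral c f = line_integral (- c) (\<lambda>z. f (- z))"
  unfolding line_integral_def
  by (subst lborel_integral_real_affine[where c = "-1" and t = 0]) (auto simp: uminus_Complex)

lemma line_integrable_reflect: "line_integrable c f \<longleftrightarrow> line_integrable (- c) (\<lambda>z. f (- z))"
  unfolding line_integrable_def
  by (subst lborel_integrable_real_affine_iff[where c = "-1" and t = 0, symmetric])
    (auto simp: uminus_Complex)

lemma filterlim_uminus_lower_infinity: "filterlim uminus (lower_infinity c) (upper_infinity (- c))"
  unfolding filterlim_iff eventually_inf_principal eventually_at_infinity
  by (metis (mono_tags, lifting) mem_Collect_eq minus_le_iff norm_minus_cancel uminus_complex.simps(2))

lemma tendsto_div_reflect:
  fixes g :: "complex \<Rightarrow> complex"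
  assumes "((\<lambda>z. g z / z) \<longlongrightarrow> 0) (lower_infinity c)"
  shows "((\<lambda>z. g (- z) / z) \<longlongrightarrow> 0) (upper_infinity (- c))"
  using tendsto_minus[OF filterlim_compose[OF assms filterlim_uminus_lower_infinity]] by simp

lemma holomorphic_on_reflect:
  assumes "g holomorphic_on {z. Im z < b}"
  shows "(\<lambda>z. g (- z)) holomorphic_on {z. - b < Im z}"
proof -
  have "g \<circ> uminus holomorphic_on {z. - b < Im z}"
    by (rule holomorphic_on_compose_gen[OF _ assms]) (auto intro!: holomorphic_intros)
  then show ?thesis by (simp add: o_def)
qed

text \<open>
  Obtained from the upper half-plane by the reflection \<open>z \<mapsto> -z\<close>, which reverses the orientation.
\<close>

lemma Cauchy_two_poles_lower:
  fixes g :: "complex \<Rightarrow> complex"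
  assumes hol: "g holomorphic_on {z. Im z < b}" and "c < b"
    and lim: "((\<lambda>z. g z / z) \<longlongrightarrow> 0) (lower_infinity c)"
    and p: "Im p \<noteq> c" and q: "Im q \<noteq> c" and "p \<noteq> q"
    and int: "line_integrable c (\<lambda>z. g z / ((z - p) * (z - q)))"
  shows "line_integral c (\<lambda>z. g z / ((z - p) * (z - q))) =
    - 2 * of_real pi * \<i> * ((if Im p < c then g p else 0) - (if Im q < c then g q else 0)) / (p - q)"
proof -
  have eq: "(\<lambda>z. g (- z) / ((- z - p) * (- z - q))) = (\<lambda>z. g (- z) / ((z - (- p)) * (z - (- q))))"
    by (rule ext) (simp add: algebra_simps)
  have "line_integral c (\<lambda>z. g z / ((z - p) * (z - q))) =
      line_integral (- c) (\<lambda>z. g (- z) / ((z - (- p)) * (z - (- q))))"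
    by (subst line_integral_reflect) (simp only: eq)
  also have "\<dots> = 2 * of_real pi * \<i> * ((if - c < Im (- p) then g (- (- p)) else 0)
      - (if - c < Im (- q) then g (- (- q)) else 0)) / (- p - (- q))"
  proof (rule Cauchy_two_poles_upper[OF holomorphic_on_reflect[OF hol] _ tendsto_div_reflect[OF lim]])
    show "line_integrable (- c) (\<lambda>z. g (- z) / ((z - (- p)) * (z - (- q))))"
      using int by (subst (asm) line_integrable_reflect) (simp only: eq)
  qed (use assms in auto)
  also have "\<dots> = - 2 * of_real pi * \<i> *
      ((if Im p < c then g p else 0) - (if Im q < c then g q else 0)) / (p - q)"
  proof -
    have "- p - (- q) = - (p - q)" by simp
    then show ?thesis by (simp only: divide_minus_right) simp
  qed
  finally show ?thesis .
qed

lemma Cauchy_one_pole_lower: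
  fixes g :: "complex \<Rightarrow> complex"
  assumes hol: "g holomorphic_on {z. Im z < b}" and "c < b"
    and lim: "((\<lambda>z. g z / z) \<longlongrightarrow> 0) (lower_infinity c)"
    and p: "Im p \<noteq> c"
    and int: "line_integrable c (\<lambda>z. g z / (z - p))"
  shows "line_integral c (\<lambda>z. g z / (z - p)) = - 2 * of_real pi * \<i> * (if Im p < c then g p else 0)"
proof -
  have eq: "(\<lambda>z. g (- z) / (- z - p)) = (\<lambda>z. - (g (- z) / (z - (- p))))"
    by (rule ext) (simp add: minus_divide_right)
  have "line_integral c (\<lambda>z. g z / (z - p)) = - line_integral (- c) (\<lambda>z. g (- z) / (z - (- p)))"
    by (subst line_integral_reflect) (simp only: eq line_integral_def integral_minus)
  also have "line_integral (- c) (\<lambda>z. g (- z) / (z - (- p))) =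
      2 * of_real pi * \<i> * (if - c < Im (- p) then g (- (- p)) else 0)"
  proof (rule Cauchy_one_pole_upper[OF holomorphic_on_reflect[OF hol] _ tendsto_div_reflect[OF lim]])
    have "line_integrable (- c) (\<lambda>z. - (g (- z) / (z - (- p))))"
      using int by (subst (asm) line_integrable_reflect) (simp only: eq)
    then show "line_integrable (- c) (\<lambda>z. g (- z) / (z - (- p)))"
      by (simp add: line_integrable_def)
  qed (use assms in auto)
  finally show ?thesis by simp
qed

lemma tendsto_div_sublinear:
  fixes g :: "complex \<Rightarrow> complex"
  assumes bound: "\<And>z. z \<in> S \<Longrightarrow> norm (g z) \<le> B * (1 + norm z) powr e" and "e < 1"
  shows "((\<lambda>z. g z / z) \<longlongrightarrow> 0) (inf at_infinity (principal S))"
proof (rule Lim_null_comparison)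
  show "((\<lambda>z::complex. 2 * \<bar>B\<bar> * (1 + norm z) powr (e - 1)) \<longlongrightarrow> 0) (inf at_infinity (principal S))"
  proof (rule tendsto_mono[OF inf.cobounded1])
    have "filterlim (\<lambda>z::complex. 1 + norm z) at_top at_infinity"
      by (intro filterlim_tendsto_add_at_top[OF tendsto_const] filterlim_at_infinity_imp_norm_at_top filterlim_ident)
    then have "((\<lambda>z::complex. (1 + norm z) powr (e - 1)) \<longlongrightarrow> 0) at_infinity"
      using \<open>e < 1\<close> by (intro tendsto_neg_powr) auto
    then show "((\<lambda>z::complex. 2 * \<bar>B\<bar> * (1 + norm z) powr (e - 1)) \<longlongrightarrow> 0) at_infinity"
      by (rule tendsto_mult_right_zero)
  qed
  show "\<forall>\<^sub>F z in inf at_infinity (principal S). norm (g z / z) \<le> 2 * \<bar>B\<bar> * (1 + norm z) powr (e - 1)"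
    unfolding eventually_inf_principal eventually_at_infinity
  proof (intro exI[of _ 1] allI impI)
    fix z :: complex assume z: "1 \<le> norm z" "z \<in> S"
    have "norm (g z / z) = norm (g z) / norm z" by (rule norm_divide)
    also have "\<dots> \<le> (\<bar>B\<bar> * (1 + norm z) powr e) / ((1 + norm z) / 2)"
    proof (rule frac_le)
      have "B * (1 + norm z) powr e \<le> \<bar>B\<bar> * (1 + norm z) powr e"
        by (rule mult_right_mono) auto
      then show "norm (g z) \<le> \<bar>B\<bar> * (1 + norm z) powr e" using bound[OF z(2)] by linarith
    qed (use z in auto)
    also have "\<dots> = 2 * \<bar>B\<bar> * (1 + norm z) powr (e - 1)"
      using z by (simp add: powr_diff)
    finally show "norm (g z / z) \<le> 2 * \<bar>B\<bar> * (1 + norm z) powr (e - 1)" .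
  qed
qed

lemma tendsto_div_bounded:
  fixes g :: "complex \<Rightarrow> complex"
  assumes "\<And>z. z \<in> S \<Longrightarrow> norm (g z) \<le> B"
  shows "((\<lambda>z. g z / z) \<longlongrightarrow> 0) (inf at_infinity (principal S))"
proof (rule tendsto_div_sublinear[of _ _ B 0])
  fix z assume "z \<in> S"
  moreover have "1 + norm z \<noteq> 0" using norm_ge_zero[of z] by linarith
  ultimately show "norm (g z) \<le> B * (1 + norm z) powr 0" using assms by simp
qed simp

text \<open>
  The distance to \<open>p\<close> is at least \<open>\<bar>c - Im p\<bar>\<close> and at least \<open>\<bar>t\<bar> - \<bar>Re p\<bar>\<close>; \<open>m\<close> interpolates
  between the two bounds.
\<close>

lemma line_distance_lower_bound:
  assumes "Im p \<noteq> c"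
  obtains m where "m > 0" "\<And>t. m * (1 + \<bar>t\<bar>) \<le> norm (Complex t c - p)"
proof
  define d where "d = \<bar>c - Im p\<bar>"
  have d: "d > 0" using assms by (auto simp: d_def)
  define C where "C = (1 + \<bar>Re p\<bar>) / d + 1"
  have "C > 0" using d by (simp add: C_def add_pos_pos divide_pos_pos add_nonneg_pos)
  then show "1 / C > 0" by simp
  fix t
  have 1: "d \<le> norm (Complex t c - p)"
    using abs_Im_le_cmod[of "Complex t c - p"] by (simp add: d_def)
  have 2: "\<bar>t\<bar> \<le> \<bar>Re p\<bar> + norm (Complex t c - p)"
    using abs_Re_le_cmod[of "Complex t c - p"] by simp
  have "1 + \<bar>Re p\<bar> = (1 + \<bar>Re p\<bar>) / d * d" using d by simp
  also have "\<dots> \<le> (1 + \<bar>Re p\<bar>) / d * norm (Complex t c - p)"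
    using 1 d by (intro mult_left_mono) auto
  finally have "1 + \<bar>t\<bar> \<le> C * norm (Complex t c - p)"
    using 2 by (simp add: C_def distrib_right)
  then show "1 / C * (1 + \<bar>t\<bar>) \<le> norm (Complex t c - p)"
    using \<open>C > 0\<close> by (simp add: field_simps)
qed

lemma set_integrable_half_line:
  fixes f :: "real \<Rightarrow> real"
  assumes "f integrable_on {a..}" "continuous_on {a..} f" "\<And>x. a \<le> x \<Longrightarrow> 0 \<le> f x"
  shows "set_integrable lborel {a..} f"
proof -
  have "f absolutely_integrable_on {a..}"
    using assms by (intro nonnegative_absolutely_integrable_1) auto
  then show ?thesis
    unfolding set_integrable_def
    by (subst (asm) integrable_completion)
      (use borel_measurable_continuous_on_indicator[OF _ assms(2)] in simp_all)
qed

lemma integrable_one_plus_abs_powr: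
  assumes "e < - 1"
  shows "integrable lborel (\<lambda>t::real. (1 + \<bar>t\<bar>) powr e)"
proof -
  have half: "set_integrable lborel {0..} (\<lambda>t::real. (1 + \<bar>t\<bar>) powr e)"
  proof -
    have "set_integrable lborel {1..} (\<lambda>x::real. x powr e)"
      using has_integral_powr_to_inf[OF assms, of 1]
      by (intro set_integrable_half_line continuous_intros) (auto simp: integrable_on_def)
    then have "integrable lborel (\<lambda>t::real. indicator {1..} (1 + 1 * t) *\<^sub>R (1 + 1 * t) powr e)"
      unfolding set_integrable_def by (rule lborel_integrable_real_affine) auto
    then show ?thesis
      unfolding set_integrable_def by (rule Bochner_Integration.integrable_cong[THEN iffD1, rotated -1]) (auto simp: indicator_def)
  qed
  have half': "integrable lborel (\<lambda>t::real. indicator {0..} (0 + (-1) * t) *\<^sub>R (1 + \<bar>0 + (-1) * t\<bar>) powr e)"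
    using half unfolding set_integrable_def by (rule lborel_integrable_real_affine) auto
  have "integrable lborel (\<lambda>t::real. indicator {0..} t *\<^sub>R (1 + \<bar>t\<bar>) powr e +
      indicator {0..} (0 + (-1) * t) *\<^sub>R (1 + \<bar>0 + (-1) * t\<bar>) powr e)"
    using half half' unfolding set_integrable_def by (rule Bochner_Integration.integrable_add)
  then show ?thesis
    by (rule Bochner_Integration.integrable_bound) (auto simp: indicator_def)
qed

lemma continuous_on_line:
  assumes "continuous_on {z. Im z = c} f"
  shows "continuous_on UNIV (\<lambda>t. f (Complex t c))"
  unfolding Complex_eq
  by (rule continuous_on_compose2[OF assms]) (auto intro!: continuous_intros)

lemma line_integrable_if_decay:
  fixes f :: "complex \<Rightarrow> complex"
  assumes cont: "continuous_on {z. Im z = c} f"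
    and "e < - 1" and bound: "\<And>t. norm (f (Complex t c)) \<le> B * (1 + \<bar>t\<bar>) powr e"
  shows "line_integrable c f"
  unfolding line_integrable_def
proof (rule Bochner_Integration.integrable_bound)
  show "integrable lborel (\<lambda>t. B * (1 + \<bar>t\<bar>) powr e)"
    using integrable_one_plus_abs_powr[OF \<open>e < - 1\<close>] by simp
  show "(\<lambda>t. f (Complex t c)) \<in> borel_measurable lborel"
    using borel_measurable_continuous_onI[OF continuous_on_line[OF cont]] by simp
  show "AE t in lborel. norm (f (Complex t c)) \<le> norm (B * (1 + \<bar>t\<bar>) powr e)"
    by (rule AE_I2) (use bound in \<open>auto intro: order_trans[OF _ abs_ge_self]\<close>)
qed

lemma line_integrable_two_poles:
  fixes g :: "complex \<Rightarrow> complex"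
  assumes cont: "continuous_on {z. Im z = c} g"
    and bound: "\<And>t. norm (g (Complex t c)) \<le> B * (1 + \<bar>t\<bar>) powr e" and "e < 1"
    and p: "Im p \<noteq> c" and q: "Im q \<noteq> c"
  shows "line_integrable c (\<lambda>z. g z / ((z - p) * (z - q)))"
proof -
  obtain m where m: "m > 0" "\<And>t. m * (1 + \<bar>t\<bar>) \<le> norm (Complex t c - p)"
    using line_distance_lower_bound[OF p] by blast
  obtain n where n: "n > 0" "\<And>t. n * (1 + \<bar>t\<bar>) \<le> norm (Complex t c - q)"
    using line_distance_lower_bound[OF q] by blast
  show ?thesis
  proof (rule line_integrable_if_decay[where e = "e - 2" and B = "B / (m * n)"])
    show "continuous_on {z. Im z = c} (\<lambda>z. g z / ((z - p) * (z - q)))"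
      using p q cont by (intro continuous_intros) auto
    fix t
    have "norm (g (Complex t c) / ((Complex t c - p) * (Complex t c - q))) \<le>
        (B * (1 + \<bar>t\<bar>) powr e) / ((m * (1 + \<bar>t\<bar>)) * (n * (1 + \<bar>t\<bar>)))"
      unfolding norm_divide norm_mult
    proof (rule frac_le[OF order_trans[OF norm_ge_zero bound] bound])
      show "0 < m * (1 + \<bar>t\<bar>) * (n * (1 + \<bar>t\<bar>))"
        using m(1) n(1) by (intro mult_pos_pos) auto
      show "m * (1 + \<bar>t\<bar>) * (n * (1 + \<bar>t\<bar>)) \<le> norm (Complex t c - p) * norm (Complex t c - q)"
        using m n(1) by (intro mult_mono m(2) n(2)) auto
    qed
    also have "\<dots> = B / (m * n) * (1 + \<bar>t\<bar>) powr (e - 2)"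
      using m n by (simp add: powr_diff powr_realpow power2_eq_square)
    finally show "norm (g (Complex t c) / ((Complex t c - p) * (Complex t c - q))) \<le>
        B / (m * n) * (1 + \<bar>t\<bar>) powr (e - 2)" .
  qed (use \<open>e < 1\<close> in auto)
qed

text \<open>
  The additive Wiener--Hopf projection: of a sum holomorphic above plus holomorphic below, the Cauchy
  integral with \<open>p\<close> below the line sees only the lower part.  Only the sum is assumed integrable
  against \<open>1 / (z - p)\<close>, since the parts are merely bounded.  The far pole makes both parts
  integrable, at the price of the extra term \<open>gm (q n)\<close>, which the vanishing assumption removes
  in the limit.
\<close>

lemma Cauchy_lower_part_of_sum:
  fixes gp gm :: "complex \<Rightarrow> complex"
  assumes holp: "gp holomorphic_on {z. a < Im z}" and "a < c"
    and boundp: "\<And>z. c \<le> Im z \<Longrightarrow> norm (gp z) \<le> Bp"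
    and holm: "gm holomorphic_on {z. Im z < b}" and "c < b"
    and boundm: "\<And>z. Im z \<le> c \<Longrightarrow> norm (gm z) \<le> Bm"
    and vanish: "(\<lambda>n. gm (- \<i> * of_real (real n))) \<longlonglongrightarrow> 0"
    and p: "Im p < c"
    and int: "line_integrable c (\<lambda>z. (gp z + gm z) / (z - p))"
  shows "line_integral c (\<lambda>z. (gp z + gm z) / (z - p)) = - 2 * of_real pi * \<i> * gm p"
proof -
  obtain M where M: "norm p + \<bar>c\<bar> + 1 \<le> real M" using real_arch_simple by blast
  define q where "q = (\<lambda>n. - \<i> * of_real (real M + real n))"
  note far' = line_integral_pole_to_infinity[OF M int]
  have far: "Im (q n) < c" "p \<noteq> q n" for n
    unfolding q_def by (rule far')+
  have far_lim: "(\<lambda>n. (p - q n) * line_integral c (\<lambda>z. (gp z + gm z) / ((z - p) * (z - q n))))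
      \<longlonglongrightarrow> line_integral c (\<lambda>z. (gp z + gm z) / (z - p))"
    unfolding q_def by (rule far')
  have "(p - q n) * line_integral c (\<lambda>z. (gp z + gm z) / ((z - p) * (z - q n))) =
      - 2 * of_real pi * \<i> * (gm p - gm (q n))" for n
  proof -
    have contp: "continuous_on {z. Im z = c} gp" and contm: "continuous_on {z. Im z = c} gm"
      using \<open>a < c\<close> \<open>c < b\<close>
      by (auto intro!: holomorphic_on_imp_continuous_on holomorphic_on_subset[OF holp]
          holomorphic_on_subset[OF holm])
    have p': "Im p \<noteq> c" by (rule less_imp_neq[OF p])
    have q': "Im (q n) \<noteq> c" by (rule less_imp_neq[OF far(1)])
    note q = p' q'
    have intp: "line_integrable c (\<lambda>z. gp z / ((z - p) * (z - q n)))"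
      by (rule line_integrable_two_poles[where e = 0 and B = Bp]) (use contp boundp q in auto)
    have intm: "line_integrable c (\<lambda>z. gm z / ((z - p) * (z - q n)))"
      by (rule line_integrable_two_poles[where e = 0 and B = Bm]) (use contm boundm q in auto)
    have "line_integral c (\<lambda>z. (gp z + gm z) / ((z - p) * (z - q n))) =
        line_integral c (\<lambda>z. gp z / ((z - p) * (z - q n))) + line_integral c (\<lambda>z. gm z / ((z - p) * (z - q n)))"
      unfolding line_integral_def add_divide_distrib
      by (rule Bochner_Integration.integral_add) (use intp intm in \<open>auto simp: line_integrable_def\<close>)
    also have "line_integral c (\<lambda>z. gp z / ((z - p) * (z - q n))) = 0"
      using p far(1)[of n] boundp
      by (subst Cauchy_two_poles_upper[OF holp \<open>a < c\<close> tendsto_div_bounded q far(2) intp]) auto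
    also have "line_integral c (\<lambda>z. gm z / ((z - p) * (z - q n))) =
        - 2 * of_real pi * \<i> * (gm p - gm (q n)) / (p - q n)"
      using p far(1)[of n] boundm
      by (subst Cauchy_two_poles_lower[OF holm \<open>c < b\<close> tendsto_div_bounded q far(2) intm]) auto
    finally show ?thesis using far(2)[of n] by simp
  qed
  with far_lim have "(\<lambda>n. - 2 * of_real pi * \<i> * (gm p - gm (q n)))
      \<longlonglongrightarrow> line_integral c (\<lambda>z. (gp z + gm z) / (z - p))"
    by simp
  moreover have "(\<lambda>n. gm (q n)) \<longlonglongrightarrow> 0"
    using LIMSEQ_ignore_initial_segment[OF vanish, of M] by (simp add: q_def add.commute)
  then have "(\<lambda>n. - 2 * of_real pi * \<i> * (gm p - gm (q n))) \<longlonglongrightarrow> - 2 * of_real pi * \<i> * (gm p - 0)"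
    by (intro tendsto_intros)
  ultimately show ?thesis
    using LIMSEQ_unique by fastforce
qed

section \<open>Fourier--Laplace transforms in the plane\<close>

lemma norm_exp_minus_1_le: "norm (exp w - 1) \<le> norm w * exp (norm w)" for w :: complex
proof -
  have "norm (exp w - exp 0) \<le> exp (norm w) * norm (w - 0)"
  proof (rule field_differentiable_bound[of "cball 0 (norm w)" exp exp])
    fix z :: complex assume "z \<in> cball 0 (norm w)"
    then show "norm (exp z) \<le> exp (norm w)"
      using norm_exp[of z] by (auto intro: order_trans)
    show "(exp has_field_derivative exp z) (at z within cball 0 (norm w))"
      by (rule DERIV_subset[OF DERIV_exp]) simp
  qed auto
  then show ?thesis by (simp add: mult.commute)
qed

lemma norm_exp_ii: "norm (exp (\<i> * z * of_real s)) = exp (- (Im z * s))"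
  by (simp add: norm_exp_eq_Re)

text \<open>
  Differentiation under the integral sign.  Near \<open>z\<close> the difference quotients are dominated by the
  integrands at the two points \<open>z \<plusminus> \<i> r\<close>: whichever sign \<open>s x\<close> has, one of them exceeds the integrand
  at \<open>z\<close> by the factor \<open>exp (r \<bar>s x\<bar>)\<close>, enough to absorb both the linear factor and the error of the
  exponential.
\<close>

lemma holomorphic_on_exp_integral:
  fixes \<psi> :: "'a \<Rightarrow> complex" and s :: "'a \<Rightarrow> real"
  assumes "open S" and meas [measurable]: "s \<in> borel_measurable M"
    and int: "\<And>z. z \<in> S \<Longrightarrow> integrable M (\<lambda>x. \<psi> x * exp (\<i> * z * of_real (s x)))"
  shows "(\<lambda>z. LINT x|M. \<psi> x * exp (\<i> * z * of_real (s x))) holomorphic_on S"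
  unfolding holomorphic_on_open[OF \<open>open S\<close>]
proof
  fix z assume "z \<in> S"
  then obtain r where r: "r > 0" "cball z r \<subseteq> S"
    using \<open>open S\<close> open_contains_cball by blast
  define d where "d = r / 2"
  have d: "d > 0" using r by (simp add: d_def)
  let ?F = "\<lambda>z. LINT x|M. \<psi> x * exp (\<i> * z * of_real (s x))"
  let ?f = "\<lambda>z x. \<psi> x * exp (\<i> * z * of_real (s x))"
  let ?f' = "\<lambda>x. ?f z x * (\<i> * of_real (s x))"
  let ?w = "\<lambda>x. (norm (?f (z + \<i> * of_real r) x) + norm (?f (z - \<i> * of_real r) x)) / d"
  have "z + \<i> * of_real r \<in> S" "z - \<i> * of_real r \<in> S"
    using r by (auto intro!: subsetD[OF r(2)] simp: dist_norm norm_mult)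
  then have intw: "integrable M ?w"
    by (intro integrable_divide Bochner_Integration.integrable_add integrable_norm int)
  have bound: "norm ((?f (z + h) x - ?f z x) / h) \<le> ?w x" if h: "h \<noteq> 0" "norm h \<le> d" for h x
  proof -
    let ?s = "\<bar>s x\<bar>"
    have e: "?f (z + h) x - ?f z x = ?f z x * (exp (\<i> * h * of_real (s x)) - 1)"
      by (simp add: exp_add distrib_right distrib_left algebra_simps)
    have "norm (?f (z + h) x - ?f z x) \<le> norm (?f z x) * ((norm h * ?s) * exp (norm h * ?s))"
      unfolding e norm_mult[of "?f z x"]
      using norm_exp_minus_1_le[of "\<i> * h * of_real (s x)"]
      by (intro mult_left_mono) (auto simp: norm_mult)
    also have "\<dots> \<le> norm (?f z x) * ((norm h * (exp (d * ?s) / d)) * exp (d * ?s))"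
    proof (intro mult_left_mono mult_mono)
      have "d * ?s \<le> exp (d * ?s)" using exp_ge_add_one_self[of "d * ?s"] by linarith
      then show "?s \<le> exp (d * ?s) / d" using d by (simp add: field_simps)
    qed (use h d in \<open>auto intro: mult_right_mono\<close>)
    also have "\<dots> = norm h * (norm (?f z x) * exp (r * ?s) / d)"
      by (simp add: d_def flip: exp_add)
    finally have 1: "norm (?f (z + h) x - ?f z x) \<le> norm h * (norm (?f z x) * exp (r * ?s) / d)" .
    have "norm (?f z x) * exp (r * ?s) \<le>
        norm (?f (z + \<i> * of_real r) x) + norm (?f (z - \<i> * of_real r) x)"
    proof -
      have "norm (?f z x) * exp (r * ?s) = norm (\<psi> x) * exp (- (Im z * s x) + r * ?s)"
        by (simp only: norm_mult norm_exp_ii exp_add mult.assoc[of _ "exp _" "exp _"])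
      moreover have "norm (\<psi> x) * exp (- (Im z * s x) + r * ?s) \<le>
          norm (\<psi> x) * exp (- ((Im z + r) * s x)) + norm (\<psi> x) * exp (- ((Im z - r) * s x))"
        by (cases "s x \<ge> 0") (auto simp: algebra_simps)
      moreover have "Im (z + \<i> * of_real r) = Im z + r" "Im (z - \<i> * of_real r) = Im z - r" by auto
      ultimately show ?thesis by (simp only: norm_mult norm_exp_ii)
    qed
    then have "norm h * (norm (?f z x) * exp (r * ?s) / d) \<le> norm h * ?w x"
      using d by (intro mult_left_mono divide_right_mono) auto
    with 1 have "norm (?f (z + h) x - ?f z x) \<le> ?w x * norm h"
      by (simp only: mult.commute[of "norm h"])
    moreover have "0 < norm h" using h by simp
    ultimately show ?thesis
      by (simp only: norm_divide pos_divide_le_eq)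
  qed
  have measf: "?f w \<in> borel_measurable M" if "w \<in> S" for w
    using int[OF that] by simp
  have "(\<lambda>x. (?f z x * exp (- (\<i> * z * of_real (s x)))) * exp (\<i> * w * of_real (s x))) \<in> borel_measurable M" for w
    using measf[OF \<open>z \<in> S\<close>] by measurable
  then have measf: "?f w \<in> borel_measurable M" for w
    by (simp add: exp_minus mult.assoc)
  have "(?F has_field_derivative (LINT x|M. ?f' x)) (at z)"
    unfolding DERIV_def tendsto_at_iff_sequentially
  proof (intro allI impI)
    fix X :: "nat \<Rightarrow> complex"
    assume X: "\<forall>i. X i \<in> UNIV - {0}" "X \<longlonglongrightarrow> 0"
    obtain N where N: "\<And>n. n \<ge> N \<Longrightarrow> norm (X n) < d"
      using LIMSEQ_D[OF X(2) d] by auto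
    have small: "X (n + N) \<noteq> 0" "norm (X (n + N)) \<le> d" for n
      using X(1) N[of "n + N"] by (auto intro: less_imp_le)
    have inS: "z + X (n + N) \<in> S" for n
      using small(2)[of n] r by (intro subsetD[OF r(2)]) (auto simp: dist_norm d_def)
    have "(\<lambda>n. LINT x|M. (?f (z + X (n + N)) x - ?f z x) / X (n + N)) \<longlonglongrightarrow> (LINT x|M. ?f' x)"
    proof (rule integral_dominated_convergence[OF _ _ intw])
      show "AE x in M. (\<lambda>n. (?f (z + X (n + N)) x - ?f z x) / X (n + N)) \<longlonglongrightarrow> ?f' x"
      proof (rule AE_I2)
        fix x
        have "((\<lambda>w. ?f w x) has_field_derivative ?f' x) (at z)"
          by (auto intro!: derivative_eq_intros)
        then have "((\<lambda>h. (?f (z + h) x - ?f z x) / h) \<longlongrightarrow> ?f' x) (at 0)"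
          by (simp only: DERIV_def)
        then have "((\<lambda>h. (?f (z + h) x - ?f z x) / h) \<circ> X) \<longlonglongrightarrow> ?f' x"
          using X unfolding tendsto_at_iff_sequentially by blast
        then show "(\<lambda>n. (?f (z + X (n + N)) x - ?f z x) / X (n + N)) \<longlonglongrightarrow> ?f' x"
          unfolding o_def by (rule LIMSEQ_ignore_initial_segment)
      qed
      show "AE x in M. norm ((?f (z + X (n + N)) x - ?f z x) / X (n + N)) \<le> ?w x" for n
        by (rule AE_I2) (rule bound[OF small])
      show "(\<lambda>x. (?f (z + X (n + N)) x - ?f z x) / X (n + N)) \<in> borel_measurable M" for n
        by (intro borel_measurable_divide borel_measurable_diff measf borel_measurable_const)
      show "?f' \<in> borel_measurable M"
        by (intro borel_measurable_times measf borel_measurable_const) measurable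
    qed
    moreover have "(LINT x|M. (?f (z + X (n + N)) x - ?f z x) / X (n + N)) =
        (?F (z + X (n + N)) - ?F z) / X (n + N)" for n
      using int[OF inS[of n]] int[OF \<open>z \<in> S\<close>] by simp
    ultimately have "(\<lambda>n. (?F (z + X (n + N)) - ?F z) / X (n + N)) \<longlonglongrightarrow> (LINT x|M. ?f' x)"
      by (simp only:)
    then have "(\<lambda>n. (?F (z + X n) - ?F z) / X n) \<longlonglongrightarrow> (LINT x|M. ?f' x)"
      by (rule LIMSEQ_offset)
    then show "((\<lambda>h. (?F (z + h) - ?F z) / h) \<circ> X) \<longlonglongrightarrow> (LINT x|M. ?f' x)"
      by (simp only: o_def)
  qed
  then show "\<exists>f'. (?F has_field_derivative f') (at z)" by blast
qed

lemma borel_measurable_fst_lborel [measurable]: "fst \<in> borel_measurable (lborel :: (real \<times> real) measure)"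
  and borel_measurable_snd_lborel [measurable]: "snd \<in> borel_measurable (lborel :: (real \<times> real) measure)"
  by (simp_all add: borel_prod[symmetric])

lemma fourier_integrand_split:
  "fourier_integrand \<phi> \<xi>1 \<xi>2 x = (\<phi> x * exp (\<i> * \<xi>2 * of_real (snd x))) * exp (\<i> * \<xi>1 * of_real (fst x))"
  "fourier_integrand \<phi> \<xi>1 \<xi>2 x = (\<phi> x * exp (\<i> * \<xi>1 * of_real (fst x))) * exp (\<i> * \<xi>2 * of_real (snd x))"
  by (simp_all add: fourier_integrand_def case_prod_beta exp_add distrib_left algebra_simps)

lemma fourier2_holomorphic_fst:
  assumes "open S" "\<And>z. z \<in> S \<Longrightarrow> integrable lborel (fourier_integrand \<phi> z \<xi>2)"
  shows "(\<lambda>z. fourier2 \<phi> z \<xi>2) holomorphic_on S"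
  using assms unfolding fourier2_def fourier_integrand_split(1)[abs_def]
  by (intro holomorphic_on_exp_integral) auto

lemma fourier2_holomorphic_snd:
  assumes "open S" "\<And>z. z \<in> S \<Longrightarrow> integrable lborel (fourier_integrand \<phi> \<xi>1 z)"
  shows "(\<lambda>z. fourier2 \<phi> \<xi>1 z) holomorphic_on S"
  using assms unfolding fourier2_def fourier_integrand_split(2)[abs_def]
  by (intro holomorphic_on_exp_integral) auto

lemma norm_fourier_integrand:
  "norm (fourier_integrand \<phi> \<xi>1 \<xi>2 x) = norm (\<phi> x) * exp (- (Im \<xi>1 * fst x + Im \<xi>2 * snd x))"
  by (simp add: fourier_integrand_def case_prod_beta norm_mult norm_exp_eq_Re)

lemma fourier_integrand_shift:
  "fourier_integrand \<phi> \<xi>1 \<xi>2 = (\<lambda>x. fourier_integrand \<phi> \<eta>1 \<eta>2 x *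
     exp (\<i> * ((\<xi>1 - \<eta>1) * of_real (fst x) + (\<xi>2 - \<eta>2) * of_real (snd x))))"
  by (rule ext, simp add: fourier_integrand_def case_prod_beta algebra_simps flip: exp_add)

lemma fourier_integrand_measurable:
  assumes "fourier_integrand \<phi> \<eta>1 \<eta>2 \<in> borel_measurable lborel"
  shows "fourier_integrand \<phi> \<xi>1 \<xi>2 \<in> borel_measurable lborel"
proof -
  have "(\<lambda>x :: real \<times> real. exp (\<i> * ((\<xi>1 - \<eta>1) * of_real (fst x) + (\<xi>2 - \<eta>2) * of_real (snd x))))
      \<in> borel_measurable borel"
    by (intro borel_measurable_continuous_onI continuous_intros)
  then show ?thesis
    using assms by (subst fourier_integrand_shift[of _ _ _ \<eta>1 \<eta>2]) (simp add: borel_measurable_times)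
qed

text \<open>
  If moving from \<open>\<eta>\<close> to \<open>\<xi>\<close> only damps the exponential on the support of \<open>\<phi>\<close>, the integrand at \<open>\<eta>\<close>
  dominates.  This gives all half-plane bounds used below.
\<close>

lemma fourier_bound_by_support:
  assumes int: "integrable lborel (fourier_integrand \<phi> \<eta>1 \<eta>2)"
    and supp: "\<And>x. \<phi> x \<noteq> 0 \<Longrightarrow> Im \<eta>1 * fst x + Im \<eta>2 * snd x \<le> Im \<xi>1 * fst x + Im \<xi>2 * snd x"
  shows "integrable lborel (fourier_integrand \<phi> \<xi>1 \<xi>2)"
    and "norm (fourier2 \<phi> \<xi>1 \<xi>2) \<le> (LINT x|lborel. norm (fourier_integrand \<phi> \<eta>1 \<eta>2 x))"
proof -
  have bound: "norm (fourier_integrand \<phi> \<xi>1 \<xi>2 x) \<le> norm (fourier_integrand \<phi> \<eta>1 \<eta>2 x)" for x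
    unfolding norm_fourier_integrand using supp[of x] by (cases "\<phi> x = 0") (auto intro!: mult_left_mono)
  show *: "integrable lborel (fourier_integrand \<phi> \<xi>1 \<xi>2)"
    by (rule Bochner_Integration.integrable_bound[OF int
        fourier_integrand_measurable[OF borel_measurable_integrable[OF int]]]) (use bound in auto)
  show "norm (fourier2 \<phi> \<xi>1 \<xi>2) \<le> (LINT x|lborel. norm (fourier_integrand \<phi> \<eta>1 \<eta>2 x))"
    unfolding fourier2_def
    by (rule order_trans[OF integral_norm_bound integral_mono])
      (use * int bound in auto)
qed

text \<open>
  Dominated convergence: on \<open>x1 < 0\<close> the factor \<open>exp (n x1)\<close> tends to 0.  The strict inequality
  matters pointwise.
\<close>

lemma fourier2_vanishes_down:
  assumes int: "integrable lborel (fourier_integrand \<phi> 0 \<xi>2)"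
    and supp: "\<And>x. \<phi> x \<noteq> 0 \<Longrightarrow> fst x < 0"
  shows "(\<lambda>n. fourier2 \<phi> (- \<i> * of_real (real n)) \<xi>2) \<longlonglongrightarrow> 0"
proof -
  have "(\<lambda>n. fourier2 \<phi> (- \<i> * of_real (real n)) \<xi>2) \<longlonglongrightarrow> (LINT x|(lborel :: (real \<times> real) measure). 0)"
    unfolding fourier2_def
  proof (rule integral_dominated_convergence)
    show "integrable lborel (\<lambda>x. norm (fourier_integrand \<phi> 0 \<xi>2 x))" using int by simp
    show "fourier_integrand \<phi> (- \<i> * of_real (real n)) \<xi>2 \<in> borel_measurable lborel" for n
      by (rule fourier_integrand_measurable[OF borel_measurable_integrable[OF int]])
    show "AE x in lborel. (\<lambda>n. fourier_integrand \<phi> (- \<i> * of_real (real n)) \<xi>2 x) \<longlonglongrightarrow> 0"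
    proof (rule AE_I2)
      fix x
      show "(\<lambda>n. fourier_integrand \<phi> (- \<i> * of_real (real n)) \<xi>2 x) \<longlonglongrightarrow> 0"
      proof (cases "\<phi> x = 0")
        case True
        then show ?thesis by (simp add: fourier_integrand_split)
      next
        case False
        then have x: "fst x < 0" by (rule supp)
        have "filterlim (\<lambda>n. fst x * real n) at_bot sequentially"
          by (rule filterlim_tendsto_neg_mult_at_bot[OF tendsto_const x filterlim_real_sequentially])
        then have "(\<lambda>n. exp (fst x * real n)) \<longlonglongrightarrow> 0"
          by (rule filterlim_compose[OF exp_at_bot])
        then have "(\<lambda>n. norm (fourier_integrand \<phi> 0 \<xi>2 x) * exp (fst x * real n)) \<longlonglongrightarrow> 0"
          by (rule tendsto_mult_right_zero)
        moreover have "norm (fourier_integrand \<phi> (- \<i> * of_real (real n)) \<xi>2 x) =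
            norm (fourier_integrand \<phi> 0 \<xi>2 x) * exp (fst x * real n)" for n
          by (simp add: norm_fourier_integrand exp_add[symmetric] algebra_simps)
        ultimately have "(\<lambda>n. norm (fourier_integrand \<phi> (- \<i> * of_real (real n)) \<xi>2 x)) \<longlonglongrightarrow> 0"
          by (simp only:)
        then show ?thesis by (rule tendsto_norm_zero_cancel)
      qed
    qed
    show "AE x in lborel. norm (fourier_integrand \<phi> (- \<i> * of_real (real n)) \<xi>2 x) \<le>
        norm (fourier_integrand \<phi> 0 \<xi>2 x)" for n
    proof (rule AE_I2)
      fix x
      show "norm (fourier_integrand \<phi> (- \<i> * of_real (real n)) \<xi>2 x) \<le> norm (fourier_integrand \<phi> 0 \<xi>2 x)"
        unfolding norm_fourier_integrand using supp[of x]
        by (cases "\<phi> x = 0") (auto intro!: mult_left_mono mult_nonneg_nonpos)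
    qed
  qed simp
  then show ?thesis by simp
qed

lemma integrable_swap_real2:
  fixes f :: "real \<times> real \<Rightarrow> 'b :: {banach, second_countable_topology}"
  shows "integrable lborel (f \<circ> prod.swap) \<longleftrightarrow> integrable lborel f"
  unfolding lborel_prod[symmetric]
  using lborel_pair.integrable_product_swap_iff[of f]
  by (simp add: o_def case_prod_unfold prod.swap_def)

lemma integral_swap_real2:
  fixes f :: "real \<times> real \<Rightarrow> 'b :: {banach, second_countable_topology}"
  assumes "f \<in> borel_measurable lborel"
  shows "integral\<^sup>L lborel (f \<circ> prod.swap) = integral\<^sup>L lborel f"
  using lborel_pair.integral_product_swap[of f] assms
  unfolding lborel_prod[symmetric]
  by (simp add: o_def case_prod_unfold prod.swap_def)

lemma fourier_integrand_swap:
  "fourier_integrand (\<phi> \<circ> prod.swap) \<xi>1 \<xi>2 = fourier_integrand \<phi> \<xi>2 \<xi>1 \<circ> prod.swap"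
  by (auto simp: fourier_integrand_def fun_eq_iff algebra_simps)

lemma fourier2_swap:
  assumes "\<phi> \<in> borel_measurable lborel"
  shows "fourier2 (\<phi> \<circ> prod.swap) \<xi>1 \<xi>2 = fourier2 \<phi> \<xi>2 \<xi>1"
proof -
  have "fourier_integrand \<phi> 0 0 = \<phi>" by (auto simp: fourier_integrand_def)
  then show ?thesis
    unfolding fourier2_def fourier_integrand_swap using assms
    by (intro integral_swap_real2) (rule fourier_integrand_measurable[of \<phi> 0 0], simp)
qed

section \<open>The square roots\<close>

lemma sqrt_up_unique:
  assumes "w\<^sup>2 = z" "0 < Im w"
  shows "sqrt_up z = w"
proof -
  have "(csqrt z)\<^sup>2 = w\<^sup>2" using assms by simp
  then have "csqrt z = w \<or> csqrt z = - w" by (simp only: power2_eq_iff)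
  then show ?thesis using assms by (auto simp: sqrt_up_def simp del: csqrt.simps)
qed

lemma Re_csqrt_pos:
  assumes "z \<notin> \<real>\<^sub>\<le>\<^sub>0"
  shows "0 < Re (csqrt z)"
proof (rule ccontr)
  assume "\<not> 0 < Re (csqrt z)"
  then have "Re (csqrt z) = 0" using Re_csqrt[of z] by linarith
  then have "csqrt z = \<i> * of_real (Im (csqrt z))" by (simp add: complex_eq_iff)
  then have "(csqrt z)\<^sup>2 = (\<i> * of_real (Im (csqrt z)))\<^sup>2" by (rule arg_cong)
  then have "z = of_real (- (Im (csqrt z))\<^sup>2)" by (simp add: power_mult_distrib)
  then show False using assms by (metis nonpos_Reals_of_real_iff neg_le_0_iff_le zero_le_power2)
qed

text \<open>
  This form puts the cut of the root along the nonnegative real axis, off which it is holomorphic.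
\<close>

lemma sqrt_up_eq_csqrt:
  assumes "- z \<notin> \<real>\<^sub>\<le>\<^sub>0"
  shows "sqrt_up z = \<i> * csqrt (- z)"
  using Re_csqrt_pos[OF assms] by (intro sqrt_up_unique) (auto simp: power_mult_distrib)

lemma Im_sqrt_up_pos:
  assumes "- z \<notin> \<real>\<^sub>\<le>\<^sub>0"
  shows "0 < Im (sqrt_up z)"
  using Re_csqrt_pos[OF assms] by (simp add: sqrt_up_eq_csqrt[OF assms])

lemma sqrt_up_square: "(sqrt_up z)\<^sup>2 = z"
  by (simp add: sqrt_up_def)

lemma holomorphic_on_sqrt_up:
  assumes "f holomorphic_on S" "\<And>z. z \<in> S \<Longrightarrow> - f z \<notin> \<real>\<^sub>\<le>\<^sub>0"
  shows "(\<lambda>z. sqrt_up (f z)) holomorphic_on S"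
proof -
  have "(\<lambda>z. \<i> * csqrt (- f z)) holomorphic_on S"
    using assms by (intro holomorphic_intros) auto
  then show ?thesis
    by (rule holomorphic_transform) (use assms(2) sqrt_up_eq_csqrt in auto)
qed

lemma norm_sqrt_up: "norm (sqrt_up z) = sqrt (norm z)"
  by (simp add: sqrt_up_def norm_csqrt)

text \<open>
  Let \<open>T\<close> be the sum of the squares of the real parts.  If \<open>T \<le> 3/2\<close>, Cauchy--Schwarz shows that the
  imaginary parts of the arguments cannot cancel the imaginary part \<open>eps\<close> of \<open>k\<^sup>2\<close>; if \<open>T > 3/2\<close>, the
  real part of the difference is negative and of order \<open>T\<close>.
\<close>

lemma wavenumber_avoids_cut:
  fixes eps :: real and k \<xi>1 \<xi>2 :: complex
  assumes eps: "0 < eps" "eps < 1" and k: "k\<^sup>2 = 1 + \<i> * of_real eps"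
    and im: "\<bar>Im \<xi>1\<bar> \<le> eps / 4" "\<bar>Im \<xi>2\<bar> \<le> eps / 4"
  shows "- (k\<^sup>2 - \<xi>1\<^sup>2 - \<xi>2\<^sup>2) \<notin> \<real>\<^sub>\<le>\<^sub>0"
    and "eps / 20 * (1 + (Re \<xi>1)\<^sup>2 + (Re \<xi>2)\<^sup>2) \<le> norm (k\<^sup>2 - \<xi>1\<^sup>2 - \<xi>2\<^sup>2)"
proof -
  define v where "v = k\<^sup>2 - \<xi>1\<^sup>2 - \<xi>2\<^sup>2"
  define t1 s1 t2 s2 where ts: "t1 = Re \<xi>1" "s1 = Im \<xi>1" "t2 = Re \<xi>2" "s2 = Im \<xi>2"
  define T where "T = t1\<^sup>2 + t2\<^sup>2"
  have Re: "Re v = 1 - T + (s1\<^sup>2 + s2\<^sup>2)" and Im: "Im v = eps - 2 * (t1 * s1 + t2 * s2)"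
    unfolding v_def k by (simp_all add: ts T_def power2_eq_square)
  have s: "s1\<^sup>2 \<le> (eps / 4)\<^sup>2" "s2\<^sup>2 \<le> (eps / 4)\<^sup>2"
    using im by (auto simp: ts intro!: power2_le_iff_abs_le[THEN iffD2])
  have e2: "eps\<^sup>2 \<le> 1" using eps by (simp add: power_le_one)
  have ss: "s1\<^sup>2 + s2\<^sup>2 \<le> eps\<^sup>2 / 8"
    using s by (simp add: power_divide)
  have T0: "0 \<le> T" by (simp add: T_def)
  have key: "(0 < Im v \<or> Re v < 0) \<and> eps / 20 * (1 + T) \<le> norm v"
  proof (cases "T \<le> 3 / 2")
    case True
    have "(t1 * s1 + t2 * s2)\<^sup>2 \<le> T * (s1\<^sup>2 + s2\<^sup>2)"
    proof -
      have "T * (s1\<^sup>2 + s2\<^sup>2) - (t1 * s1 + t2 * s2)\<^sup>2 = (t1 * s2 - t2 * s1)\<^sup>2"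
        by (simp add: T_def power2_eq_square algebra_simps)
      then show ?thesis by (metis diff_ge_0_iff_ge zero_le_power2)
    qed
    also have "\<dots> \<le> (3 / 2) * (eps\<^sup>2 / 8)"
      using True ss T0 by (intro mult_mono) auto
    \<comment> \<open>\<open>435/1000\<close> is a rational just above \<open>sqrt (3/16)\<close>; twice it leaves more than \<open>1/8\<close> of \<open>eps\<close>\<close>
    also have "\<dots> \<le> ((435 / 1000) * eps)\<^sup>2"
      by (simp add: power_mult_distrib power2_eq_square)
    finally have "\<bar>t1 * s1 + t2 * s2\<bar> \<le> (435 / 1000) * eps"
      using eps by (simp add: power2_le_iff_abs_le)
    then have "t1 * s1 + t2 * s2 \<le> (435 / 1000) * eps" by (rule order_trans[OF abs_ge_self])
    then have "Im v \<ge> (13 / 100) * eps" unfolding Im by simp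
    moreover have "eps / 20 * (1 + T) \<le> eps / 20 * (5 / 2)"
      using True eps by (intro mult_left_mono) auto
    ultimately have "eps / 20 * (1 + T) \<le> Im v" using eps by linarith
    moreover have "0 < Im v" using \<open>(13 / 100) * eps \<le> Im v\<close> eps by linarith
    ultimately show ?thesis using abs_Im_le_cmod[of v] by linarith
  next
    case False
    then have "Re v \<le> 9 / 8 - T" using ss e2 unfolding Re by linarith
    moreover have "eps / 20 * (1 + T) \<le> 1 / 20 * (1 + T)"
      using eps T0 by (intro mult_right_mono) auto
    ultimately show ?thesis using False abs_Re_le_cmod[of v] by (simp add: field_simps)
  qed
  then show "- (k\<^sup>2 - \<xi>1\<^sup>2 - \<xi>2\<^sup>2) \<notin> \<real>\<^sub>\<le>\<^sub>0"
    unfolding v_def[symmetric] by (auto simp: complex_nonpos_Reals_iff)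
  show "eps / 20 * (1 + (Re \<xi>1)\<^sup>2 + (Re \<xi>2)\<^sup>2) \<le> norm (k\<^sup>2 - \<xi>1\<^sup>2 - \<xi>2\<^sup>2)"
    using key by (simp add: v_def T_def ts add.assoc)
qed

text \<open>
  Otherwise both \<open>s\<close> and \<open>\<xi>\<close>, with \<open>s\<^sup>2 + \<xi>\<^sup>2 = k\<^sup>2\<close>, have small imaginary parts; then the imaginary part
  of \<open>s\<^sup>2 + \<xi>\<^sup>2\<close> can only reach \<open>eps\<close> if the real parts are too large for its real part to be 1.
\<close>

lemma Im_inner_root_gt:
  fixes eps :: real and k \<xi> :: complex
  assumes eps: "0 < eps" "eps < 1" and k: "k\<^sup>2 = 1 + \<i> * of_real eps"
    and im: "\<bar>Im \<xi>\<bar> \<le> eps / 4"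
  shows "eps / 4 < Im (sqrt_up (k\<^sup>2 - \<xi>\<^sup>2))"
proof (rule ccontr)
  define s where "s = sqrt_up (k\<^sup>2 - \<xi>\<^sup>2)"
  assume "\<not> eps / 4 < Im (sqrt_up (k\<^sup>2 - \<xi>\<^sup>2))"
  moreover have "0 < Im s"
    unfolding s_def using wavenumber_avoids_cut(1)[OF eps k im, of 0] eps by (intro Im_sqrt_up_pos) auto
  ultimately have b: "\<bar>Im s\<bar> \<le> eps / 4" by (simp add: s_def)
  have "s\<^sup>2 = k\<^sup>2 - \<xi>\<^sup>2" by (simp add: s_def sqrt_up_square)
  then have "Re (s\<^sup>2) = Re (k\<^sup>2 - \<xi>\<^sup>2)" "Im (s\<^sup>2) = Im (k\<^sup>2 - \<xi>\<^sup>2)" by auto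
  then have re: "(Re s)\<^sup>2 + (Re \<xi>)\<^sup>2 = 1 + (Im \<xi>)\<^sup>2 + (Im s)\<^sup>2"
    and imag: "eps = 2 * (Re s * Im s) + 2 * (Re \<xi> * Im \<xi>)"
    unfolding k by (simp_all add: power2_eq_square algebra_simps)
  have "\<bar>Re s * Im s\<bar> \<le> \<bar>Re s\<bar> * (eps / 4)" "\<bar>Re \<xi> * Im \<xi>\<bar> \<le> \<bar>Re \<xi>\<bar> * (eps / 4)"
    unfolding abs_mult by (rule mult_left_mono[OF b abs_ge_zero], rule mult_left_mono[OF im abs_ge_zero])
  then have "eps \<le> (\<bar>Re s\<bar> + \<bar>Re \<xi>\<bar>) * (eps / 2)"
    using imag by (simp add: distrib_right)
  then have "2 * (eps / 2) \<le> (\<bar>Re s\<bar> + \<bar>Re \<xi>\<bar>) * (eps / 2)" by simp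
  then have "2 \<le> \<bar>Re s\<bar> + \<bar>Re \<xi>\<bar>"
    by (rule mult_right_le_imp_le) (use eps in simp)
  then have "2\<^sup>2 \<le> (\<bar>Re s\<bar> + \<bar>Re \<xi>\<bar>)\<^sup>2" by (rule power_mono) simp
  also have "\<dots> \<le> 2 * ((Re s)\<^sup>2 + (Re \<xi>)\<^sup>2)"
    using zero_le_power2[of "\<bar>Re s\<bar> - \<bar>Re \<xi>\<bar>"] by (simp add: power2_diff power2_sum)
  also have "\<dots> \<le> 2 * (1 + (1 / 4)\<^sup>2 + (1 / 4)\<^sup>2)"
    unfolding re using b im eps
    by (intro mult_left_mono add_mono) (auto intro!: power2_le_iff_abs_le[THEN iffD2])
  finally show False by (simp add: power2_eq_square)
qed

lemma csqrt_Im_pos: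
  assumes "0 < Im z"
  shows "0 < Re (csqrt z)" "0 < Im (csqrt z)"
proof -
  show *: "0 < Re (csqrt z)"
    using assms by (intro Re_csqrt_pos) (auto simp: complex_nonpos_Reals_iff)
  have "Im ((csqrt z)\<^sup>2) = 2 * Re (csqrt z) * Im (csqrt z)" by (simp only: Im_power2)
  then show "0 < Im (csqrt z)" using assms * by (simp add: zero_less_mult_iff)
qed

text \<open>
  Both factors are roots of points in the upper half-plane, hence lie in the open first quadrant; their
  product lies in the upper half-plane and so is the root selected by \<open>sqrt_up\<close>.
\<close>

lemma gamma_mult_gamma:
  assumes "\<bar>Im \<xi>2\<bar> < Im (sqrt_up (k\<^sup>2 - \<xi>1\<^sup>2))"
  shows "gamma k \<xi>1 \<xi>2 * gamma k \<xi>1 (- \<xi>2) = sqrt_up (k\<^sup>2 - \<xi>1\<^sup>2 - \<xi>2\<^sup>2)"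
proof (rule sqrt_up_unique[symmetric])
  let ?s = "sqrt_up (k\<^sup>2 - \<xi>1\<^sup>2)"
  have "(gamma k \<xi>1 \<xi>2 * gamma k \<xi>1 (- \<xi>2))\<^sup>2 = (?s + \<xi>2) * (?s + - \<xi>2)"
    by (simp add: gamma_def power_mult_distrib)
  also have "\<dots> = ?s\<^sup>2 - \<xi>2\<^sup>2" by (simp add: power2_eq_square algebra_simps)
  finally show "(gamma k \<xi>1 \<xi>2 * gamma k \<xi>1 (- \<xi>2))\<^sup>2 = k\<^sup>2 - \<xi>1\<^sup>2 - \<xi>2\<^sup>2"
    by (simp add: sqrt_up_square)
  have "0 < Im (?s + \<xi>2)" "0 < Im (?s + - \<xi>2)" using assms by auto
  then show "0 < Im (gamma k \<xi>1 \<xi>2 * gamma k \<xi>1 (- \<xi>2))"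
    unfolding gamma_def by (simp del: csqrt.simps plus_complex.simps add: csqrt_Im_pos add_pos_pos)
qed

lemma gamma_holomorphic:
  "(\<lambda>\<xi>2. gamma k \<xi>1 \<xi>2) holomorphic_on {z. - Im (sqrt_up (k\<^sup>2 - \<xi>1\<^sup>2)) < Im z}"
  unfolding gamma_def by (intro holomorphic_intros) (auto simp: complex_nonpos_Reals_iff)

lemma gamma_reflected_holomorphic:
  "(\<lambda>\<xi>2. gamma k \<xi>1 (- \<xi>2)) holomorphic_on {z. Im z < Im (sqrt_up (k\<^sup>2 - \<xi>1\<^sup>2))}"
  unfolding gamma_def by (intro holomorphic_intros) (auto simp: complex_nonpos_Reals_iff)

lemma norm_gamma: "norm (gamma k \<xi>1 \<xi>2) = sqrt (norm (sqrt_up (k\<^sup>2 - \<xi>1\<^sup>2) + \<xi>2))"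
  by (simp add: gamma_def norm_csqrt)

lemma gamma_nonzero: "0 < Im (sqrt_up (k\<^sup>2 - \<xi>1\<^sup>2) + \<xi>2) \<Longrightarrow> gamma k \<xi>1 \<xi>2 \<noteq> 0"
  by (auto simp: gamma_def simp del: plus_complex.simps)

lemma norm_gamma_upper:
  "norm (gamma k \<xi>1 \<xi>2) \<le> sqrt (1 + norm (sqrt_up (k\<^sup>2 - \<xi>1\<^sup>2))) * (1 + norm \<xi>2) powr (1/2)"
proof -
  let ?s = "sqrt_up (k\<^sup>2 - \<xi>1\<^sup>2)"
  have "norm (?s + \<xi>2) \<le> norm ?s + norm \<xi>2" by (rule norm_triangle_ineq)
  also have "\<dots> \<le> (1 + norm ?s) * (1 + norm \<xi>2)" by (simp add: distrib_left distrib_right)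
  finally show ?thesis
    unfolding norm_gamma by (simp add: powr_half_sqrt add_nonneg_nonneg flip: real_sqrt_mult)
qed

text \<open>
  The inverse of the larger of \<open>1 + \<bar>Re \<xi>1\<bar>\<close> and \<open>1 + \<bar>Re \<xi>2\<bar>\<close> is at most a weighted geometric mean of both inverses.  The exponent \<open>3/4\<close>
  exceeds the exponent \<open>1/2\<close> of the growth of \<open>gamma\<close>, and the remaining \<open>1/4\<close> still makes the inner
  integral converge.
\<close>

lemma norm_K_spec_le:
  fixes eps :: real and k \<xi>1 \<xi>2 :: complex
  assumes eps: "0 < eps" "eps < 1" and k: "k\<^sup>2 = 1 + \<i> * of_real eps"
    and im: "\<bar>Im \<xi>1\<bar> \<le> eps / 4" "\<bar>Im \<xi>2\<bar> \<le> eps / 4"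
  shows "norm (K_spec k \<xi>1 \<xi>2) \<le>
    sqrt (80 / eps) * ((1 + \<bar>Re \<xi>1\<bar>) powr (- 1/4) * (1 + \<bar>Re \<xi>2\<bar>) powr (- 3/4))"
proof -
  define a b where "a = 1 + \<bar>Re \<xi>1\<bar>" and "b = 1 + \<bar>Re \<xi>2\<bar>"
  have ab: "a \<ge> 1" "b \<ge> 1" by (auto simp: a_def b_def)
  have "a powr (1/4) * b powr (3/4) \<le> max a b powr (1/4) * max a b powr (3/4)"
    using ab by (intro mult_mono powr_mono2) auto
  also have "\<dots> = max a b" using ab by (simp flip: powr_add)
  finally have "(a powr (1/4) * b powr (3/4))\<^sup>2 \<le> (max a b)\<^sup>2" by (rule power_mono) simp
  also have "\<dots> \<le> a\<^sup>2 + b\<^sup>2" by (simp add: max_def)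
  also have "\<dots> \<le> 4 * (1 + (Re \<xi>1)\<^sup>2 + (Re \<xi>2)\<^sup>2)"
    using zero_le_power2[of "1 - \<bar>Re \<xi>1\<bar>"] zero_le_power2[of "1 - \<bar>Re \<xi>2\<bar>"]
    by (simp add: a_def b_def power2_sum power2_diff) (use zero_le_power2[of "Re \<xi>1"] zero_le_power2[of "Re \<xi>2"] in linarith)
  finally have "eps / 80 * (a powr (1/4) * b powr (3/4))\<^sup>2 \<le> eps / 80 * (4 * (1 + (Re \<xi>1)\<^sup>2 + (Re \<xi>2)\<^sup>2))"
    using eps by (intro mult_left_mono) auto
  also have "\<dots> \<le> norm (k\<^sup>2 - \<xi>1\<^sup>2 - \<xi>2\<^sup>2)"
    using wavenumber_avoids_cut(2)[OF eps k im] by (simp add: algebra_simps)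
  finally have "sqrt (eps / 80) * (a powr (1/4) * b powr (3/4)) \<le> sqrt (norm (k\<^sup>2 - \<xi>1\<^sup>2 - \<xi>2\<^sup>2))"
    using ab by (intro real_le_rsqrt) (simp add: power_mult_distrib eps less_imp_le)
  moreover have "0 < sqrt (eps / 80) * (a powr (1/4) * b powr (3/4))" using eps ab by simp
  ultimately have "1 / sqrt (norm (k\<^sup>2 - \<xi>1\<^sup>2 - \<xi>2\<^sup>2)) \<le> 1 / (sqrt (eps / 80) * (a powr (1/4) * b powr (3/4)))"
    by (intro frac_le) auto
  also have "\<dots> = sqrt (80 / eps) * (a powr (- 1/4) * b powr (- 3/4))"
    by (simp add: real_sqrt_divide powr_minus_divide)
  finally show ?thesis
    by (simp add: K_spec_def norm_divide norm_sqrt_up a_def b_def)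
qed

section \<open>The transform of the trace on the quarter-plane and its strip of convergence\<close>

lemma exp_half_line:
  fixes a :: complex
  assumes a: "0 < Im a"
  shows "integrable lborel (\<lambda>t. indicator {0..} t *\<^sub>R exp (\<i> * a * of_real t))"
    and "(LINT t|lborel. indicator {0..} t *\<^sub>R exp (\<i> * a * of_real t)) = \<i> / a"
proof -
  let ?f = "\<lambda>t::real. exp (\<i> * a * of_real t)"
  have meas: "?f \<in> borel_measurable borel"
    by (intro borel_measurable_continuous_onI continuous_intros)
  have intr: "integrable lborel (\<lambda>t::real. indicator {0..} t *\<^sub>R exp (- Im a * t))"
    unfolding set_integrable_def[symmetric]
    by (intro set_integrable_half_line integrable_on_exp_minus_to_infinity a continuous_intros) simp
  show int: "integrable lborel (\<lambda>t. indicator {0..} t *\<^sub>R ?f t)"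
    by (rule Bochner_Integration.integrable_bound[OF intr])
      (use meas in \<open>auto simp: norm_exp_ii indicator_def\<close>)
  have lim: "(\<lambda>n. LINT t|lborel. indicator {0..real n} t *\<^sub>R ?f t) \<longlonglongrightarrow>
      (LINT t|lborel. indicator {0..} t *\<^sub>R ?f t)"
  proof (rule integral_dominated_convergence[OF _ _ intr])
    show "AE t in lborel. (\<lambda>n. indicator {0..real n} t *\<^sub>R ?f t) \<longlonglongrightarrow> indicator {0..} t *\<^sub>R ?f t"
    proof (rule AE_I2)
      fix t :: real
      have "eventually (\<lambda>n. indicator {0..real n} t *\<^sub>R ?f t = indicator {0..} t *\<^sub>R ?f t) sequentially"
        using eventually_ge_at_top[of "nat \<lceil>\<bar>t\<bar>\<rceil>"]
        by eventually_elim (auto simp: indicator_def abs_le_iff nat_le_iff ceiling_le_iff)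
      then show "(\<lambda>n. indicator {0..real n} t *\<^sub>R ?f t) \<longlonglongrightarrow> indicator {0..} t *\<^sub>R ?f t"
        by (rule tendsto_eventually)
    qed
  qed (use meas in \<open>auto simp: norm_exp_ii indicator_def\<close>)
  have value_n: "(LINT t|lborel. indicator {0..real n} t *\<^sub>R ?f t) = ?f (real n) / (\<i> * a) - 1 / (\<i> * a)" for n
  proof -
    have "(?f has_integral (?f (real n) / (\<i> * a) - ?f 0 / (\<i> * a))) {0..real n}"
    proof (rule fundamental_theorem_of_calculus)
      fix t :: real
      have "((\<lambda>z. exp (\<i> * a * z) / (\<i> * a)) has_field_derivative ?f t) (at (of_real t))"
        using a by (auto intro!: derivative_eq_intros)
      then show "((\<lambda>t. ?f t / (\<i> * a)) has_vector_derivative ?f t) (at t within {0..real n})"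
        by (rule has_vector_derivative_real_field)
    qed auto
    moreover have "set_integrable lborel {0..real n} ?f"
      by (rule borel_integrable_atLeastAtMost') (intro continuous_intros)
    ultimately show ?thesis
      using set_borel_integral_eq_integral(2)[of "{0..real n}" ?f]
      by (auto simp: set_lebesgue_integral_def dest!: integral_unique)
  qed
  have "(\<lambda>n. ?f (real n) / (\<i> * a) - 1 / (\<i> * a)) \<longlonglongrightarrow> 0 / (\<i> * a) - 1 / (\<i> * a)"
  proof (intro tendsto_diff tendsto_divide tendsto_const)
    have "filterlim (\<lambda>n. - Im a * real n) at_bot sequentially"
      using a by (intro filterlim_tendsto_neg_mult_at_bot[OF tendsto_const _ filterlim_real_sequentially]) auto
    then have "(\<lambda>n. exp (- Im a * real n)) \<longlonglongrightarrow> 0"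
      by (rule filterlim_compose[OF exp_at_bot])
    then have "(\<lambda>n. norm (?f (real n))) \<longlonglongrightarrow> 0"
      by (simp add: norm_exp_ii)
    then show "(\<lambda>n. ?f (real n)) \<longlonglongrightarrow> 0"
      by (rule tendsto_norm_zero_cancel)
  qed (use a in auto)
  then have "(LINT t|lborel. indicator {0..} t *\<^sub>R ?f t) = 0 / (\<i> * a) - 1 / (\<i> * a)"
    by (rule LIMSEQ_unique[OF lim[unfolded value_n]])
  also have "\<dots> = \<i> / a"
  proof -
    have "a \<noteq> 0" using a by auto
    then show ?thesis by (simp add: divide_simps)
  qed
  finally show "(LINT t|lborel. indicator {0..} t *\<^sub>R ?f t) = \<i> / a" .
qed

lemma integral_real2_product:
  fixes f g :: "real \<Rightarrow> complex"
  assumes f: "integrable lborel f" and g: "integrable lborel g"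
  shows "integrable lborel (\<lambda>x. f (fst x) * g (snd x))"
    and "(LINT x|lborel. f (fst x) * g (snd x)) = (LINT t|lborel. f t) * (LINT t|lborel. g t)"
proof -
  have [measurable]: "f \<in> borel_measurable lborel" "g \<in> borel_measurable lborel"
    using f g by auto
  have *: "integrable (lborel \<Otimes>\<^sub>M lborel) (\<lambda>x. f (fst x) * g (snd x))"
  proof (rule lborel_pair.Fubini_integrable)
    show "(\<lambda>x. f (fst x) * g (snd x)) \<in> borel_measurable (lborel \<Otimes>\<^sub>M lborel)" by measurable
    show "integrable lborel (\<lambda>x. LINT y|lborel. norm (f (fst (x, y)) * g (snd (x, y))))"
      using f by (simp add: norm_mult)
    show "AE x in lborel. integrable lborel (\<lambda>y. f (fst (x, y)) * g (snd (x, y)))"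
      using g by simp
  qed
  then show "integrable lborel (\<lambda>x. f (fst x) * g (snd x))" by (simp add: lborel_prod)
  show "(LINT x|lborel. f (fst x) * g (snd x)) = (LINT t|lborel. f t) * (LINT t|lborel. g t)"
    using lborel_pair.integral_fst'[OF *] by (simp add: lborel_prod)
qed

lemma AE_real2_off_axes: "AE x in (lborel :: (real \<times> real) measure). fst x \<noteq> 0 \<and> snd x \<noteq> 0"
proof (rule AE_I')
  show "{0} \<times> UNIV \<union> UNIV \<times> {0} \<in> null_sets (lborel :: (real \<times> real) measure)"
    unfolding lborel_prod[symmetric]
    by (intro null_sets.Un lborel.times_in_null_sets1 lborel.times_in_null_sets2) auto
qed auto

text \<open>
  The integrand is a product of two exponentials outside the null set formed by the axes, where \<open>\<phi>\<close>
  is unspecified.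
\<close>

lemma fourier2_quarter_plane_wave:
  assumes k: "0 < Im (\<xi>1 + k1)" "0 < Im (\<xi>2 + k2)"
    and \<phi>: "\<And>x1 x2. 0 < x1 \<Longrightarrow> 0 < x2 \<Longrightarrow> \<phi> (x1, x2) = - exp (\<i> * (k1 * of_real x1 + k2 * of_real x2))"
    and meas: "\<phi> \<in> borel_measurable lborel"
  shows "fourier2 (\<lambda>x. indicator {x. 0 \<le> fst x \<and> 0 \<le> snd x} x *\<^sub>R \<phi> x) \<xi>1 \<xi>2 = 1 / ((\<xi>1 + k1) * (\<xi>2 + k2))"
proof -
  let ?f = "\<lambda>a t. indicator {0..} t *\<^sub>R exp (\<i> * a * complex_of_real t)"
  let ?\<psi> = "\<lambda>x. indicator {x. 0 \<le> fst x \<and> 0 \<le> snd x} x *\<^sub>R \<phi> x"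
  have prod: "integrable lborel (\<lambda>x. ?f (\<xi>1 + k1) (fst x) * ?f (\<xi>2 + k2) (snd x))"
    "(LINT x|lborel. ?f (\<xi>1 + k1) (fst x) * ?f (\<xi>2 + k2) (snd x)) = (\<i> / (\<xi>1 + k1)) * (\<i> / (\<xi>2 + k2))"
    using integral_real2_product[OF exp_half_line(1)[OF k(1)] exp_half_line(1)[OF k(2)]]
    by (simp_all only: exp_half_line(2)[OF k(1)] exp_half_line(2)[OF k(2)])
  have "fourier2 ?\<psi> \<xi>1 \<xi>2 = (LINT x|lborel. - (?f (\<xi>1 + k1) (fst x) * ?f (\<xi>2 + k2) (snd x)))"
    unfolding fourier2_def
  proof (rule integral_cong_AE)
    have "fourier_integrand ?\<psi> 0 0 = ?\<psi>" by (auto simp: fourier_integrand_def)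
    moreover have "?\<psi> \<in> borel_measurable lborel"
    proof (intro borel_measurable_scaleR borel_measurable_indicator meas)
      have "{x :: real \<times> real. 0 \<le> fst x \<and> 0 \<le> snd x} = {0..} \<times> {0..}" by auto
      moreover have "closed ({0::real..} \<times> {0::real..})" by (intro closed_Times closed_atLeast)
      ultimately show "{x :: real \<times> real. 0 \<le> fst x \<and> 0 \<le> snd x} \<in> sets lborel" by simp
    qed
    ultimately have "fourier_integrand ?\<psi> 0 0 \<in> borel_measurable lborel"
      by (simp only:)
    then show "fourier_integrand ?\<psi> \<xi>1 \<xi>2 \<in> borel_measurable lborel"
      by (rule fourier_integrand_measurable)
    show "(\<lambda>x. - (?f (\<xi>1 + k1) (fst x) * ?f (\<xi>2 + k2) (snd x))) \<in> borel_measurable lborel"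
      using borel_measurable_integrable[OF prod(1)] by (rule borel_measurable_uminus)
    show "AE x in lborel. fourier_integrand ?\<psi> \<xi>1 \<xi>2 x =
        - (?f (\<xi>1 + k1) (fst x) * ?f (\<xi>2 + k2) (snd x))"
      using AE_real2_off_axes
    proof eventually_elim
      case (elim x)
      obtain x1 x2 where x: "x = (x1, x2)" by (cases x)
      show ?case
      proof (cases "0 < x1 \<and> 0 < x2")
        case True
        then show ?thesis
          using \<phi>[of x1 x2] by (simp add: x fourier_integrand_def flip: exp_add) (simp add: algebra_simps)
      next
        case False
        then show ?thesis using elim by (auto simp: x fourier_integrand_def indicator_def)
      qed
    qed
  qed
  also have "\<dots> = - ((\<i> / (\<xi>1 + k1)) * (\<i> / (\<xi>2 + k2)))"
    using prod(2) by simp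
  also have "\<dots> = 1 / ((\<xi>1 + k1) * (\<xi>2 + k2))" by simp
  finally show ?thesis .
qed

text \<open>
  By Cauchy--Schwarz the exponential grows at most like \<open>exp (e * norm x)\<close> with \<open>e < d\<close>.  Outside a
  large ball the decay of \<open>\<phi>\<close> wins, with a product of one-dimensional exponentials as majorant; inside
  the ball the exponential is bounded.
\<close>

lemma fourier_integrable_if_exp_decay:
  fixes \<phi> :: "real \<times> real \<Rightarrow> complex"
  assumes int: "integrable lborel \<phi>"
    and decay: "\<forall>\<^sub>F x in at_infinity. norm (\<phi> x) \<le> C * exp (- d * norm x)"
    and im: "(Im \<xi>1)\<^sup>2 + (Im \<xi>2)\<^sup>2 < d\<^sup>2" and "0 < d"
  shows "integrable lborel (fourier_integrand \<phi> \<xi>1 \<xi>2)"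
proof -
  define e where "e = sqrt ((Im \<xi>1)\<^sup>2 + (Im \<xi>2)\<^sup>2)"
  have e0: "0 \<le> e" unfolding e_def by (rule real_sqrt_ge_zero) simp
  have "e\<^sup>2 < d\<^sup>2" using im by (simp add: e_def)
  then have "e < d" by (rule power2_less_imp_less) (use \<open>0 < d\<close> in simp)
  note e = e0 this
  have CS: "- (Im \<xi>1 * fst x + Im \<xi>2 * snd x) \<le> e * norm x" for x :: "real \<times> real"
    using norm_cauchy_schwarz[of "(- Im \<xi>1, - Im \<xi>2)" x]
    by (cases x) (simp add: e_def norm_Pair)
  obtain R where R: "\<And>x. norm x \<ge> R \<Longrightarrow> norm (\<phi> x) \<le> C * exp (- d * norm x)"
    using decay by (auto simp: eventually_at_infinity)
  \<comment> \<open>half the surplus decay, because \<open>\<bar>x1\<bar> + \<bar>x2\<bar> \<le> 2 * norm x\<close>\<close>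
  define c where "c = (d - e) / 2"
  have c: "0 < c" using e by (simp add: c_def)
  define h where "h = (\<lambda>t::real. complex_of_real (exp (- c * \<bar>t\<bar>)))"
  have inth: "integrable lborel h"
  proof -
    have half: "integrable lborel (\<lambda>t::real. indicator {0..} t *\<^sub>R exp (\<i> * (\<i> * c) * of_real t))"
      using c by (intro exp_half_line) simp
    have half': "integrable lborel (\<lambda>t::real. indicator {0..} (0 + (-1) * t) *\<^sub>R exp (\<i> * (\<i> * c) * of_real (0 + (-1) * t)))"
      using half by (rule lborel_integrable_real_affine) simp
    have meas: "h \<in> borel_measurable borel"
      unfolding h_def by (intro borel_measurable_continuous_onI continuous_intros)
    show ?thesis
      by (rule Bochner_Integration.integrable_bound[OF Bochner_Integration.integrable_add[OF
              integrable_norm[OF half] integrable_norm[OF half']]])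
        (use meas in \<open>auto simp: h_def indicator_def norm_exp_ii norm_exp_eq_Re\<close>)
  qed
  let ?w = "\<lambda>x. exp (e * \<bar>R\<bar>) * norm (\<phi> x) + \<bar>C\<bar> * norm (h (fst x) * h (snd x))"
  have "fourier_integrand \<phi> 0 0 = \<phi>" by (auto simp: fourier_integrand_def)
  then have "fourier_integrand \<phi> 0 0 \<in> borel_measurable lborel"
    using borel_measurable_integrable[OF int] by (simp only:)
  then have meas: "fourier_integrand \<phi> \<xi>1 \<xi>2 \<in> borel_measurable lborel"
    by (rule fourier_integrand_measurable)
  have "integrable lborel ?w"
    by (intro Bochner_Integration.integrable_add integrable_mult_right integrable_norm int
        integral_real2_product inth)
  then show ?thesis
  proof (rule Bochner_Integration.integrable_bound[OF _ meas], intro AE_I2)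
    fix x :: "real \<times> real"
    have "norm (fourier_integrand \<phi> \<xi>1 \<xi>2 x) \<le> norm (\<phi> x) * exp (e * norm x)"
      unfolding norm_fourier_integrand using CS[of x] by (intro mult_left_mono) auto
    also have "\<dots> \<le> ?w x"
    proof (cases "norm x \<ge> R")
      case True
      have "norm (\<phi> x) * exp (e * norm x) \<le> (C * exp (- d * norm x)) * exp (e * norm x)"
        using R[OF True] by (intro mult_right_mono) auto
      also have "\<dots> \<le> \<bar>C\<bar> * exp (- d * norm x) * exp (e * norm x)"
        by (intro mult_right_mono) auto
      also have "\<dots> = \<bar>C\<bar> * exp (- (d - e) * norm x)"
        by (simp add: mult.assoc left_diff_distrib flip: exp_add)
      also have "\<dots> \<le> \<bar>C\<bar> * (exp (- c * \<bar>fst x\<bar>) * exp (- c * \<bar>snd x\<bar>))"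
      proof (rule mult_left_mono)
        have "\<bar>fst x\<bar> + \<bar>snd x\<bar> \<le> 2 * norm x"
          using norm_fst_le[of "fst x" "snd x"] norm_snd_le[of "snd x" "fst x"] by simp
        then have "c * (\<bar>fst x\<bar> + \<bar>snd x\<bar>) \<le> c * (2 * norm x)"
          using c by (intro mult_left_mono) auto
        moreover have "d - e = 2 * c" by (simp add: c_def)
        ultimately have "- (d - e) * norm x \<le> - c * \<bar>fst x\<bar> + - c * \<bar>snd x\<bar>"
          by (simp add: algebra_simps)
        then show "exp (- (d - e) * norm x) \<le> exp (- c * \<bar>fst x\<bar>) * exp (- c * \<bar>snd x\<bar>)"
          by (simp only: exp_add[symmetric] exp_le_cancel_iff)
      qed simp
      also have "\<dots> \<le> ?w x"
        by (simp add: h_def norm_mult norm_of_real)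
      finally show ?thesis .
    next
      case False
      then have "e * norm x \<le> e * \<bar>R\<bar>" using e by (intro mult_left_mono) auto
      then have "norm (\<phi> x) * exp (e * norm x) \<le> exp (e * \<bar>R\<bar>) * norm (\<phi> x)"
        by (subst mult.commute) (intro mult_right_mono, auto)
      also have "\<dots> \<le> ?w x" by simp
      finally show ?thesis .
    qed
    finally show "norm (fourier_integrand \<phi> \<xi>1 \<xi>2 x) \<le> norm (?w x)"
      by (rule order_trans) simp
  qed
qed

section \<open>The two Wiener--Hopf steps\<close>

lemma holomorphic_zero_on_strip:
  assumes hol: "f holomorphic_on {z. \<bar>Im z\<bar> < c}" and zero: "\<And>z. z \<in> \<real> \<Longrightarrow> f z = 0"
    and z: "\<bar>Im z\<bar> < c"
  shows "f z = 0"
proof (rule analytic_continuation[OF hol, of \<real> 0])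
  have strip: "{z. \<bar>Im z\<bar> < c} = {z. - c < Im z} \<inter> {z. Im z < c}" by auto
  show "open {z. \<bar>Im z\<bar> < c}"
    unfolding strip by (intro open_Int open_halfspace_Im_gt open_halfspace_Im_lt)
  show "connected {z. \<bar>Im z\<bar> < c}"
    unfolding strip
    by (intro convex_connected convex_Int convex_halfspace_Im_gt convex_halfspace_Im_lt)
  have c: "0 < c" using z by linarith
  then show "\<real> \<subseteq> {z. \<bar>Im z\<bar> < c}" "0 \<in> {z. \<bar>Im z\<bar> < c}" by (auto simp: complex_is_Real_iff)
  show "(0::complex) islimpt \<real>"
    unfolding islimpt_approachable
  proof (intro allI impI)
    fix e :: real assume "0 < e"
    then show "\<exists>x'\<in>\<real>. x' \<noteq> 0 \<and> dist x' (0::complex) < e"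
      by (intro bexI[of _ "of_real (e / 2)"]) auto
  qed
qed (use zero z in auto)

lemma ii_cancel:
  "\<i> * (- 2 * of_real pi * \<i> * x) = 2 * of_real pi * (x::complex)"
  "- \<i> * (2 * of_real pi * \<i> * x) = 2 * of_real pi * (x::complex)"
  by simp_all

definition restrict_field :: "(real \<times> real) set \<Rightarrow> (real \<times> real \<Rightarrow> complex) \<Rightarrow> real \<times> real \<Rightarrow> complex" where
  "restrict_field A \<phi> = (\<lambda>x. indicator A x *\<^sub>R \<phi> x)"

lemma restrict_field_eq_0: "x \<notin> A \<Longrightarrow> restrict_field A \<phi> x = 0"
  by (simp add: restrict_field_def)

lemma integrable_fourier_restrict:
  assumes "integrable lborel (fourier_integrand \<phi> \<xi>1 \<xi>2)" "A \<in> sets borel"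
  shows "integrable lborel (fourier_integrand (restrict_field A \<phi>) \<xi>1 \<xi>2)"
proof -
  have "fourier_integrand (restrict_field A \<phi>) \<xi>1 \<xi>2 = (\<lambda>x. indicator A x *\<^sub>R fourier_integrand \<phi> \<xi>1 \<xi>2 x)"
    by (auto simp: fourier_integrand_def restrict_field_def)
  then show ?thesis
    using integrable_mult_indicator[of A lborel "fourier_integrand \<phi> \<xi>1 \<xi>2"] assms by simp
qed

lemma fourier2_restrict_split:
  assumes "integrable lborel (fourier_integrand \<phi> \<xi>1 \<xi>2)" "A \<in> sets borel" "B \<in> sets borel" "A \<inter> B = {}"
  shows "fourier2 (restrict_field (A \<union> B) \<phi>) \<xi>1 \<xi>2 =
    fourier2 (restrict_field A \<phi>) \<xi>1 \<xi>2 + fourier2 (restrict_field B \<phi>) \<xi>1 \<xi>2"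
proof -
  have "fourier_integrand (restrict_field (A \<union> B) \<phi>) \<xi>1 \<xi>2 =
      (\<lambda>x. fourier_integrand (restrict_field A \<phi>) \<xi>1 \<xi>2 x + fourier_integrand (restrict_field B \<phi>) \<xi>1 \<xi>2 x)"
    using \<open>A \<inter> B = {}\<close> by (auto simp: fourier_integrand_def restrict_field_def indicator_def fun_eq_iff)
  then show ?thesis
    unfolding fourier2_def
    by (simp add: Bochner_Integration.integral_add[OF integrable_fourier_restrict integrable_fourier_restrict] assms)
qed

text \<open>
  The spectral content of the problem: \<open>\<phi>\<close> and \<open>w\<close> stand for the traces of the field and of its normal
  derivative.  The hypotheses are invariant under exchanging the two coordinates together with \<open>k1\<close> and
  \<open>k2\<close>, so that one relation yields the other.  The bound \<open>\<kappa> \<le> eps / 8\<close> keeps the arguments of the roots off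
  their cuts throughout the strips of half-width \<open>2 * \<kappa>\<close>, which contain the lines of integration at
  height \<open>\<plusminus> \<kappa>\<close> in their interior; the bounds on \<open>k1\<close> and \<open>k2\<close> place the poles \<open>- k1\<close> and \<open>- k2\<close>
  below these lines.
\<close>

locale quarter_plane_spectrum =
  fixes eps \<kappa> :: real and k k1 k2 :: complex and \<phi> w :: "real \<times> real \<Rightarrow> complex"
  assumes eps: "0 < eps" "eps < 1" and k: "k\<^sup>2 = 1 + \<i> * of_real eps"
    and \<kappa>: "0 < \<kappa>" "\<kappa> \<le> eps / 8" "\<kappa> < Im k1" "\<kappa> < Im k2"
    and \<phi>_integrable: "\<And>\<xi>1 \<xi>2. \<bar>Im \<xi>1\<bar> < 2 * \<kappa> \<Longrightarrow> \<bar>Im \<xi>2\<bar> < 2 * \<kappa> \<Longrightarrow>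
      integrable lborel (fourier_integrand \<phi> \<xi>1 \<xi>2)"
    and \<phi>_quarter: "\<And>x1 x2. 0 < x1 \<Longrightarrow> 0 < x2 \<Longrightarrow> \<phi> (x1, x2) = - exp (\<i> * (k1 * of_real x1 + k2 * of_real x2))"
    and w_integrable: "\<And>\<xi>1 \<xi>2. - 2 * \<kappa> < Im \<xi>1 \<Longrightarrow> - 2 * \<kappa> < Im \<xi>2 \<Longrightarrow>
      integrable lborel (fourier_integrand w \<xi>1 \<xi>2)"
    and w_support: "\<And>x1 x2. x1 < 0 \<or> x2 < 0 \<Longrightarrow> w (x1, x2) = 0"
    and functional_real: "\<And>\<xi>1 \<xi>2. \<xi>1 \<in> \<real> \<Longrightarrow> \<xi>2 \<in> \<real> \<Longrightarrow>
      K_spec k \<xi>1 \<xi>2 * fourier2 w \<xi>1 \<xi>2 = \<i> * fourier2 \<phi> \<xi>1 \<xi>2"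
begin

abbreviation "U \<equiv> fourier2 \<phi>"
abbreviation "W \<equiv> fourier2 w"
abbreviation "K \<equiv> K_spec k"
abbreviation "\<gamma> \<equiv> gamma k"
abbreviation "inner_root \<xi> \<equiv> sqrt_up (k\<^sup>2 - \<xi>\<^sup>2)"

text \<open>
  The axis \<open>x1 = 0\<close> is assigned to the right half, so that \<open>U_left\<close> vanishes as \<open>Im \<xi>1 \<rightarrow> - \<infinity>\<close> by pointwise
  decay of its integrand.
\<close>

abbreviation "left_half \<equiv> {x :: real \<times> real. fst x < 0}"
abbreviation "right_half \<equiv> {x :: real \<times> real. 0 \<le> fst x}"
abbreviation "lower_right \<equiv> {x :: real \<times> real. 0 \<le> fst x \<and> snd x < 0}"
abbreviation "upper_right \<equiv> {x :: real \<times> real. 0 \<le> fst x \<and> 0 \<le> snd x}"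

abbreviation "U_left \<equiv> fourier2 (restrict_field left_half \<phi>)"
abbreviation "U_right \<equiv> fourier2 (restrict_field right_half \<phi>)"
abbreviation "U_lower_right \<equiv> fourier2 (restrict_field lower_right \<phi>)"
abbreviation "U_upper_right \<equiv> fourier2 (restrict_field upper_right \<phi>)"

lemma region_measurable:
  "left_half \<in> sets borel" "right_half \<in> sets borel" "lower_right \<in> sets borel" "upper_right \<in> sets borel"
proof -
  have "open left_half" "closed right_half" "open {x :: real \<times> real. snd x < 0}"
      "closed {x :: real \<times> real. 0 \<le> snd x}"
    by (auto intro!: open_Collect_less closed_Collect_le continuous_intros)
  then show "left_half \<in> sets borel" "right_half \<in> sets borel" "lower_right \<in> sets borel" "upper_right \<in> sets borel"
    by (simp_all add: Collect_conj_eq)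
qed

lemma U_split:
  assumes "\<bar>Im \<xi>1\<bar> < 2 * \<kappa>" "\<bar>Im \<xi>2\<bar> < 2 * \<kappa>"
  shows "U \<xi>1 \<xi>2 = U_right \<xi>1 \<xi>2 + U_left \<xi>1 \<xi>2"
    and "U_right \<xi>1 \<xi>2 = U_upper_right \<xi>1 \<xi>2 + U_lower_right \<xi>1 \<xi>2"
proof -
  note split = fourier2_restrict_split[OF \<phi>_integrable[OF assms]]
  have "right_half \<union> left_half = UNIV" "right_half \<inter> left_half = {}" by auto
  moreover have "restrict_field UNIV \<phi> = \<phi>" by (simp add: restrict_field_def)
  ultimately show "U \<xi>1 \<xi>2 = U_right \<xi>1 \<xi>2 + U_left \<xi>1 \<xi>2"
    using split[of right_half left_half] region_measurable by simp
  have "upper_right \<union> lower_right = right_half" "upper_right \<inter> lower_right = {}" by auto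
  then show "U_right \<xi>1 \<xi>2 = U_upper_right \<xi>1 \<xi>2 + U_lower_right \<xi>1 \<xi>2"
    using split[of upper_right lower_right] region_measurable by simp
qed

lemma strip_le: "\<bar>y\<bar> < 2 * \<kappa> \<Longrightarrow> \<bar>y\<bar> \<le> eps / 4"
  using \<kappa> by linarith

lemma Im_inner_root: "\<bar>Im \<xi>\<bar> < 2 * \<kappa> \<Longrightarrow> 2 * \<kappa> < Im (inner_root \<xi>)"
  using Im_inner_root_gt[OF eps k strip_le] \<kappa> by fastforce

lemma K_commute: "K \<xi>1 \<xi>2 = K \<xi>2 \<xi>1"
  by (simp add: K_spec_def algebra_simps)

lemma K_nonzero:
  assumes "\<bar>Im \<xi>1\<bar> < 2 * \<kappa>" "\<bar>Im \<xi>2\<bar> < 2 * \<kappa>"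
  shows "sqrt_up (k\<^sup>2 - \<xi>1\<^sup>2 - \<xi>2\<^sup>2) \<noteq> 0"
  using Im_sqrt_up_pos[OF wavenumber_avoids_cut(1)[OF eps k strip_le strip_le]] assms by fastforce

lemma K_holomorphic:
  assumes "\<bar>Im \<xi>1\<bar> < 2 * \<kappa>"
  shows "(\<lambda>\<xi>2. K \<xi>1 \<xi>2) holomorphic_on {z. \<bar>Im z\<bar> < 2 * \<kappa>}"
  unfolding K_spec_def
  by (intro holomorphic_intros holomorphic_on_sqrt_up)
    (use assms K_nonzero wavenumber_avoids_cut(1)[OF eps k strip_le strip_le] in auto)

lemma strip_open: "open {z. \<bar>Im z\<bar> < 2 * \<kappa>}"
  by (intro open_Collect_less continuous_intros)

lemma W_holomorphic:
  "- 2 * \<kappa> < Im \<xi>2 \<Longrightarrow> (\<lambda>\<xi>1. W \<xi>1 \<xi>2) holomorphic_on {z. - 2 * \<kappa> < Im z}"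
  "- 2 * \<kappa> < Im \<xi>1 \<Longrightarrow> (\<lambda>\<xi>2. W \<xi>1 \<xi>2) holomorphic_on {z. - 2 * \<kappa> < Im z}"
  by (intro fourier2_holomorphic_fst open_halfspace_Im_gt w_integrable, simp_all)
    (intro fourier2_holomorphic_snd open_halfspace_Im_gt w_integrable, simp_all)

lemma U_holomorphic:
  "\<bar>Im \<xi>2\<bar> < 2 * \<kappa> \<Longrightarrow> (\<lambda>\<xi>1. U \<xi>1 \<xi>2) holomorphic_on {z. \<bar>Im z\<bar> < 2 * \<kappa>}"
  "\<bar>Im \<xi>1\<bar> < 2 * \<kappa> \<Longrightarrow> (\<lambda>\<xi>2. U \<xi>1 \<xi>2) holomorphic_on {z. \<bar>Im z\<bar> < 2 * \<kappa>}"
  by (intro fourier2_holomorphic_fst strip_open \<phi>_integrable, simp_all)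
    (intro fourier2_holomorphic_snd strip_open \<phi>_integrable, simp_all)

text \<open>
  The identity theorem, first in \<open>\<xi>2\<close> for real \<open>\<xi>1\<close>, then in \<open>\<xi>1\<close>.
\<close>

lemma functional_strip:
  assumes "\<bar>Im \<xi>1\<bar> < 2 * \<kappa>" "\<bar>Im \<xi>2\<bar> < 2 * \<kappa>"
  shows "K \<xi>1 \<xi>2 * W \<xi>1 \<xi>2 = \<i> * U \<xi>1 \<xi>2"
proof -
  have sub: "{z. \<bar>Im z\<bar> < 2 * \<kappa>} \<subseteq> {z. - 2 * \<kappa> < Im z}" by auto
  have real: "K x z * W x z - \<i> * U x z = 0" if "x \<in> \<real>" "\<bar>Im z\<bar> < 2 * \<kappa>" for x z
  proof (rule holomorphic_zero_on_strip[OF _ _ that(2)])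
    have "\<bar>Im x\<bar> < 2 * \<kappa>" "- 2 * \<kappa> < Im x" using that(1) \<kappa> by (auto simp: complex_is_Real_iff)
    then show "(\<lambda>z. K x z * W x z - \<i> * U x z) holomorphic_on {z. \<bar>Im z\<bar> < 2 * \<kappa>}"
      by (intro holomorphic_intros K_holomorphic U_holomorphic(2) holomorphic_on_subset[OF W_holomorphic(2) sub])
  qed (use that(1) functional_real in simp)
  have "K \<xi>1 \<xi>2 * W \<xi>1 \<xi>2 - \<i> * U \<xi>1 \<xi>2 = 0"
  proof (rule holomorphic_zero_on_strip[OF _ _ assms(1)])
    have "- 2 * \<kappa> < Im \<xi>2" using assms(2) by linarith
    then show "(\<lambda>z. K z \<xi>2 * W z \<xi>2 - \<i> * U z \<xi>2) holomorphic_on {z. \<bar>Im z\<bar> < 2 * \<kappa>}"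
      unfolding K_commute[of _ \<xi>2] using assms(2)
      by (intro holomorphic_intros K_holomorphic U_holomorphic(1) holomorphic_on_subset[OF W_holomorphic(1) sub])
  qed (use real assms(2) in simp)
  then show ?thesis by simp
qed

text \<open>
  Since \<open>w\<close> lives on the quarter-plane, its transform is dominated by the value of the absolute
  integral at the corner of the region.
\<close>

lemma W_bounded:
  obtains M where "0 \<le> M" "\<And>\<xi>1 \<xi>2. - \<kappa> \<le> Im \<xi>1 \<Longrightarrow> - \<kappa> \<le> Im \<xi>2 \<Longrightarrow> norm (W \<xi>1 \<xi>2) \<le> M"
proof
  let ?\<eta> = "- \<i> * complex_of_real \<kappa>"
  show "0 \<le> (LINT x|lborel. norm (fourier_integrand w ?\<eta> ?\<eta> x))" by (rule Bochner_Integration.integral_nonneg) simp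
  fix \<xi>1 \<xi>2 :: complex assume im: "- \<kappa> \<le> Im \<xi>1" "- \<kappa> \<le> Im \<xi>2"
  show "norm (W \<xi>1 \<xi>2) \<le> (LINT x|lborel. norm (fourier_integrand w ?\<eta> ?\<eta> x))"
  proof (rule fourier_bound_by_support(2))
    show "integrable lborel (fourier_integrand w ?\<eta> ?\<eta>)"
      using \<kappa> by (intro w_integrable) auto
    fix x assume "w x \<noteq> 0"
    then have x: "0 \<le> fst x" "0 \<le> snd x" using w_support[of "fst x" "snd x"]
      by (metis linorder_not_less prod.collapse)+
    have "- \<kappa> * fst x \<le> Im \<xi>1 * fst x" "- \<kappa> * snd x \<le> Im \<xi>2 * snd x"
      by (rule mult_right_mono[OF im(1) x(1)], rule mult_right_mono[OF im(2) x(2)])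
    then show "Im ?\<eta> * fst x + Im ?\<eta> * snd x \<le> Im \<xi>1 * fst x + Im \<xi>2 * snd x"
      by simp
  qed
qed

lemma U_left_bound:
  assumes \<xi>2: "\<bar>Im \<xi>2\<bar> < 2 * \<kappa>" and y: "0 \<le> y" "y < 2 * \<kappa>" and "Im \<xi>1 \<le> y"
  shows "integrable lborel (fourier_integrand (restrict_field left_half \<phi>) \<xi>1 \<xi>2)"
    and "norm (U_left \<xi>1 \<xi>2) \<le>
      (LINT x|lborel. norm (fourier_integrand (restrict_field left_half \<phi>) (\<i> * of_real y) \<xi>2 x))"
proof -
  let ?\<psi> = "restrict_field left_half \<phi>"
  have intg: "integrable lborel (fourier_integrand ?\<psi> (\<i> * of_real y) \<xi>2)"
    using assms by (intro integrable_fourier_restrict \<phi>_integrable region_measurable) auto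
  have le: "Im (\<i> * of_real y) * fst x + Im \<xi>2 * snd x \<le> Im \<xi>1 * fst x + Im \<xi>2 * snd x"
    if "?\<psi> x \<noteq> 0" for x
  proof -
    have "fst x < 0" using that restrict_field_eq_0[of x left_half \<phi>] by blast
    then show ?thesis using \<open>Im \<xi>1 \<le> y\<close> by (auto intro!: mult_right_mono_neg)
  qed
  show "integrable lborel (fourier_integrand ?\<psi> \<xi>1 \<xi>2)"
    by (rule fourier_bound_by_support(1)[OF intg le])
  show "norm (U_left \<xi>1 \<xi>2) \<le> (LINT x|lborel. norm (fourier_integrand ?\<psi> (\<i> * of_real y) \<xi>2 x))"
    by (rule fourier_bound_by_support(2)[OF intg le])
qed

lemma U_left_holomorphic:
  assumes "\<bar>Im \<xi>2\<bar> < 2 * \<kappa>"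
  shows "(\<lambda>\<xi>1. U_left \<xi>1 \<xi>2) holomorphic_on {z. Im z < 2 * \<kappa>}"
proof (rule fourier2_holomorphic_fst)
  fix z assume "z \<in> {z. Im z < 2 * \<kappa>}"
  then show "integrable lborel (fourier_integrand (restrict_field left_half \<phi>) z \<xi>2)"
    using assms \<kappa> by (intro U_left_bound(1)[of _ "max 0 (Im z)"]) auto
qed (rule open_halfspace_Im_lt)

lemma U_left_holomorphic_snd:
  assumes "Im \<xi>1 < 2 * \<kappa>"
  shows "(\<lambda>\<xi>2. U_left \<xi>1 \<xi>2) holomorphic_on {z. \<bar>Im z\<bar> < 2 * \<kappa>}"
proof (rule fourier2_holomorphic_snd[OF strip_open])
  fix z assume "z \<in> {z. \<bar>Im z\<bar> < 2 * \<kappa>}"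
  then show "integrable lborel (fourier_integrand (restrict_field left_half \<phi>) \<xi>1 z)"
    using assms \<kappa> by (intro U_left_bound(1)[of _ "max 0 (Im \<xi>1)"]) auto
qed

lemma U_right_bound:
  assumes \<xi>2: "\<bar>Im \<xi>2\<bar> < 2 * \<kappa>" and y: "- 2 * \<kappa> < y" "y \<le> 0" and "y \<le> Im \<xi>1"
  shows "integrable lborel (fourier_integrand (restrict_field right_half \<phi>) \<xi>1 \<xi>2)"
    and "norm (U_right \<xi>1 \<xi>2) \<le>
      (LINT x|lborel. norm (fourier_integrand (restrict_field right_half \<phi>) (\<i> * of_real y) \<xi>2 x))"
proof -
  let ?\<psi> = "restrict_field right_half \<phi>"
  have intg: "integrable lborel (fourier_integrand ?\<psi> (\<i> * of_real y) \<xi>2)"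
    using assms by (intro integrable_fourier_restrict \<phi>_integrable region_measurable) auto
  have le: "Im (\<i> * of_real y) * fst x + Im \<xi>2 * snd x \<le> Im \<xi>1 * fst x + Im \<xi>2 * snd x"
    if "?\<psi> x \<noteq> 0" for x
  proof -
    have "0 \<le> fst x" using that restrict_field_eq_0[of x right_half \<phi>] by blast
    then show ?thesis using \<open>y \<le> Im \<xi>1\<close> by (auto intro!: mult_right_mono)
  qed
  show "integrable lborel (fourier_integrand ?\<psi> \<xi>1 \<xi>2)"
    by (rule fourier_bound_by_support(1)[OF intg le])
  show "norm (U_right \<xi>1 \<xi>2) \<le> (LINT x|lborel. norm (fourier_integrand ?\<psi> (\<i> * of_real y) \<xi>2 x))"
    by (rule fourier_bound_by_support(2)[OF intg le])
qed

lemma U_right_holomorphic: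
  assumes "\<bar>Im \<xi>2\<bar> < 2 * \<kappa>"
  shows "(\<lambda>\<xi>1. U_right \<xi>1 \<xi>2) holomorphic_on {z. - 2 * \<kappa> < Im z}"
proof (rule fourier2_holomorphic_fst)
  fix z assume "z \<in> {z. - 2 * \<kappa> < Im z}"
  then show "integrable lborel (fourier_integrand (restrict_field right_half \<phi>) z \<xi>2)"
    using assms \<kappa> by (intro U_right_bound(1)[of _ "min 0 (Im z)"]) auto
qed (rule open_halfspace_Im_gt)

lemma U_lower_right_bound:
  assumes \<xi>1: "\<bar>Im \<xi>1\<bar> < 2 * \<kappa>" and y: "0 \<le> y" "y < 2 * \<kappa>" and "Im \<xi>2 \<le> y"
  shows "integrable lborel (fourier_integrand (restrict_field lower_right \<phi>) \<xi>1 \<xi>2)"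
    and "norm (U_lower_right \<xi>1 \<xi>2) \<le>
      (LINT x|lborel. norm (fourier_integrand (restrict_field lower_right \<phi>) \<xi>1 (\<i> * of_real y) x))"
proof -
  let ?\<psi> = "restrict_field lower_right \<phi>"
  have intg: "integrable lborel (fourier_integrand ?\<psi> \<xi>1 (\<i> * of_real y))"
    using assms by (intro integrable_fourier_restrict \<phi>_integrable region_measurable) auto
  have le: "Im \<xi>1 * fst x + Im (\<i> * of_real y) * snd x \<le> Im \<xi>1 * fst x + Im \<xi>2 * snd x"
    if "?\<psi> x \<noteq> 0" for x
  proof -
    have "snd x < 0" using that restrict_field_eq_0[of x lower_right \<phi>] by blast
    then show ?thesis using \<open>Im \<xi>2 \<le> y\<close> by (auto intro!: mult_right_mono_neg)
  qed
  show "integrable lborel (fourier_integrand ?\<psi> \<xi>1 \<xi>2)"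
    by (rule fourier_bound_by_support(1)[OF intg le])
  show "norm (U_lower_right \<xi>1 \<xi>2) \<le> (LINT x|lborel. norm (fourier_integrand ?\<psi> \<xi>1 (\<i> * of_real y) x))"
    by (rule fourier_bound_by_support(2)[OF intg le])
qed

lemma U_lower_right_holomorphic:
  assumes "\<bar>Im \<xi>1\<bar> < 2 * \<kappa>"
  shows "(\<lambda>\<xi>2. U_lower_right \<xi>1 \<xi>2) holomorphic_on {z. Im z < 2 * \<kappa>}"
proof (rule fourier2_holomorphic_snd)
  fix z assume "z \<in> {z. Im z < 2 * \<kappa>}"
  then show "integrable lborel (fourier_integrand (restrict_field lower_right \<phi>) \<xi>1 z)"
    using assms \<kappa> by (intro U_lower_right_bound(1)[of _ "max 0 (Im z)"]) auto
qed (rule open_halfspace_Im_lt)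

lemma U_upper_right_eq:
  assumes "\<bar>Im \<xi>1\<bar> < \<kappa>" "\<bar>Im \<xi>2\<bar> \<le> \<kappa>"
  shows "U_upper_right \<xi>1 \<xi>2 = 1 / ((\<xi>1 + k1) * (\<xi>2 + k2))"
  unfolding restrict_field_def
proof (rule fourier2_quarter_plane_wave)
  have "fourier_integrand \<phi> 0 0 = \<phi>" by (auto simp: fourier_integrand_def)
  then show "\<phi> \<in> borel_measurable lborel"
    using \<phi>_integrable[of 0 0] \<kappa>(1) by (simp add: borel_measurable_integrable)
qed (use assms \<kappa> \<phi>_quarter in auto)

lemma KW_decay:
  obtains C where "0 \<le> C" "\<And>\<xi>1 \<xi>2. \<bar>Im \<xi>1\<bar> \<le> \<kappa> \<Longrightarrow> \<bar>Im \<xi>2\<bar> \<le> \<kappa> \<Longrightarrow>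
    norm (K \<xi>1 \<xi>2 * W \<xi>1 \<xi>2) \<le> C * ((1 + \<bar>Re \<xi>1\<bar>) powr (- 1/4) * (1 + \<bar>Re \<xi>2\<bar>) powr (- 3/4))"
proof -
  obtain M where M: "0 \<le> M" "\<And>\<xi>1 \<xi>2. - \<kappa> \<le> Im \<xi>1 \<Longrightarrow> - \<kappa> \<le> Im \<xi>2 \<Longrightarrow> norm (W \<xi>1 \<xi>2) \<le> M"
    using W_bounded by blast
  show thesis
  proof (rule that[of "sqrt (80 / eps) * M"])
    fix \<xi>1 \<xi>2 :: complex assume im: "\<bar>Im \<xi>1\<bar> \<le> \<kappa>" "\<bar>Im \<xi>2\<bar> \<le> \<kappa>"
    let ?d = "(1 + \<bar>Re \<xi>1\<bar>) powr (- 1/4) * (1 + \<bar>Re \<xi>2\<bar>) powr (- 3/4)"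
    have "norm (K \<xi>1 \<xi>2 * W \<xi>1 \<xi>2) \<le> (sqrt (80 / eps) * ?d) * M"
      unfolding norm_mult using im \<kappa> M(1) eps
      by (intro mult_mono norm_K_spec_le[OF eps k] M(2)) auto
    then show "norm (K \<xi>1 \<xi>2 * W \<xi>1 \<xi>2) \<le> sqrt (80 / eps) * M * ?d"
      by (simp only: mult_ac)
  qed (use M(1) eps in simp)
qed

lemma KW_over_pole_decay:
  assumes p: "Im p < \<kappa>"
  obtains C where "0 \<le> C" "\<And>\<eta> t. \<bar>Im \<eta>\<bar> \<le> \<kappa> \<Longrightarrow>
    norm (K (Complex t \<kappa>) \<eta> * W (Complex t \<kappa>) \<eta> / (Complex t \<kappa> - p)) \<le>
      C * (1 + \<bar>Re \<eta>\<bar>) powr (- 3/4) * (1 + \<bar>t\<bar>) powr (- 5/4)"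
proof -
  obtain C where C: "0 \<le> C" "\<And>\<xi>1 \<xi>2. \<bar>Im \<xi>1\<bar> \<le> \<kappa> \<Longrightarrow> \<bar>Im \<xi>2\<bar> \<le> \<kappa> \<Longrightarrow>
      norm (K \<xi>1 \<xi>2 * W \<xi>1 \<xi>2) \<le> C * ((1 + \<bar>Re \<xi>1\<bar>) powr (- 1/4) * (1 + \<bar>Re \<xi>2\<bar>) powr (- 3/4))"
    using KW_decay by blast
  obtain m where m: "0 < m" "\<And>t. m * (1 + \<bar>t\<bar>) \<le> norm (Complex t \<kappa> - p)"
    using line_distance_lower_bound[of p \<kappa>] p by blast
  show thesis
  proof (rule that[of "C / m"])
    fix \<eta> :: complex and t :: real assume \<eta>: "\<bar>Im \<eta>\<bar> \<le> \<kappa>"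
    let ?b = "(1 + \<bar>Re \<eta>\<bar>) powr (- 3/4)"
    let ?z = "Complex t \<kappa>"
    have "norm (K ?z \<eta> * W ?z \<eta> / (?z - p)) \<le> (C * ((1 + \<bar>t\<bar>) powr (- 1/4) * ?b)) / (m * (1 + \<bar>t\<bar>))"
      unfolding norm_divide using C(1) C(2)[of ?z \<eta>] m(1) m(2)[of t] \<kappa> \<eta>
      by (intro frac_le) auto
    also have "\<dots> = C / m * ?b * ((1 + \<bar>t\<bar>) powr (- 1/4) / (1 + \<bar>t\<bar>) powr 1)"
      by simp
    also have "(1 + \<bar>t\<bar>) powr (- 1/4) / (1 + \<bar>t\<bar>) powr 1 = (1 + \<bar>t\<bar>) powr (- 5/4)"
      using powr_diff[of "1 + \<bar>t\<bar>" "- 1/4" 1] by simp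
    finally show "norm (K ?z \<eta> * W ?z \<eta> / (?z - p)) \<le> C / m * ?b * (1 + \<bar>t\<bar>) powr (- 5/4)" .
  qed (use C(1) m(1) in simp)
qed

text \<open>
  The additive projection in the first variable; the functional equation replaces \<open>K W\<close> by a multiple
  of \<open>U_right + U_left\<close>, and \<open>U_left\<close> survives.
\<close>

lemma inner_line_integral:
  assumes p: "Im p < \<kappa>" and \<eta>: "\<bar>Im \<eta>\<bar> \<le> \<kappa>"
  shows "line_integrable \<kappa> (\<lambda>\<zeta>. K \<zeta> \<eta> * W \<zeta> \<eta> / (\<zeta> - p))"
    and "line_integral \<kappa> (\<lambda>\<zeta>. K \<zeta> \<eta> * W \<zeta> \<eta> / (\<zeta> - p)) = 2 * of_real pi * U_left p \<eta>"
proof -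
  have \<eta>': "\<bar>Im \<eta>\<bar> < 2 * \<kappa>" using \<eta> \<kappa> by linarith
  obtain C where C: "0 \<le> C" "\<And>\<eta> t. \<bar>Im \<eta>\<bar> \<le> \<kappa> \<Longrightarrow>
      norm (K (Complex t \<kappa>) \<eta> * W (Complex t \<kappa>) \<eta> / (Complex t \<kappa> - p)) \<le>
        C * (1 + \<bar>Re \<eta>\<bar>) powr (- 3/4) * (1 + \<bar>t\<bar>) powr (- 5/4)"
    using KW_over_pole_decay[OF p] by blast
  show int: "line_integrable \<kappa> (\<lambda>\<zeta>. K \<zeta> \<eta> * W \<zeta> \<eta> / (\<zeta> - p))"
  proof (rule line_integrable_if_decay[where e = "- 5/4" and B = "C * (1 + \<bar>Re \<eta>\<bar>) powr (- 3/4)"])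
    have "{z. Im z = \<kappa>} \<subseteq> {z. \<bar>Im z\<bar> < 2 * \<kappa>}" "{z. Im z = \<kappa>} \<subseteq> {z. - 2 * \<kappa> < Im z}"
      using \<kappa> by auto
    moreover have "- 2 * \<kappa> < Im \<eta>" using \<eta>' by linarith
    ultimately have "continuous_on {z. Im z = \<kappa>} (\<lambda>\<zeta>. K \<eta> \<zeta>)" "continuous_on {z. Im z = \<kappa>} (\<lambda>\<zeta>. W \<zeta> \<eta>)"
      using K_holomorphic[OF \<eta>'] W_holomorphic(1)[of \<eta>]
      by (blast intro: holomorphic_on_imp_continuous_on holomorphic_on_subset)+
    then show "continuous_on {z. Im z = \<kappa>} (\<lambda>\<zeta>. K \<zeta> \<eta> * W \<zeta> \<eta> / (\<zeta> - p))"
      unfolding K_commute[of _ \<eta>] using p by (intro continuous_intros) auto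
    show "norm (K (Complex t \<kappa>) \<eta> * W (Complex t \<kappa>) \<eta> / (Complex t \<kappa> - p)) \<le>
        C * (1 + \<bar>Re \<eta>\<bar>) powr (- 3/4) * (1 + \<bar>t\<bar>) powr (- 5/4)" for t
      by (rule C(2)[OF \<eta>])
  qed simp
  have on_line: "K (Complex t \<kappa>) \<eta> * W (Complex t \<kappa>) \<eta> / (Complex t \<kappa> - p) =
      \<i> * ((U_right (Complex t \<kappa>) \<eta> + U_left (Complex t \<kappa>) \<eta>) / (Complex t \<kappa> - p))" for t
    using functional_strip[of "Complex t \<kappa>" \<eta>] U_split(1)[of "Complex t \<kappa>" \<eta>] \<eta>' \<kappa> by simp
  have intU: "line_integrable \<kappa> (\<lambda>\<zeta>. (U_right \<zeta> \<eta> + U_left \<zeta> \<eta>) / (\<zeta> - p))"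
    using integrable_mult_right[of "- \<i>", OF int[unfolded line_integrable_def on_line]]
    by (simp add: line_integrable_def add.commute)
  have U_int: "line_integral \<kappa> (\<lambda>\<zeta>. (U_right \<zeta> \<eta> + U_left \<zeta> \<eta>) / (\<zeta> - p)) =
      - 2 * of_real pi * \<i> * U_left p \<eta>"
  proof (rule Cauchy_lower_part_of_sum[OF U_right_holomorphic[OF \<eta>'] _ _ U_left_holomorphic[OF \<eta>'] _ _ _ p intU])
    show "norm (U_right z \<eta>) \<le>
        (LINT x|lborel. norm (fourier_integrand (restrict_field right_half \<phi>) (\<i> * of_real 0) \<eta> x))"
      if "\<kappa> \<le> Im z" for z
      by (rule U_right_bound(2)) (use \<eta>' \<kappa> that in auto)
    show "norm (U_left z \<eta>) \<le>
        (LINT x|lborel. norm (fourier_integrand (restrict_field left_half \<phi>) (\<i> * of_real \<kappa>) \<eta> x))"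
      if "Im z \<le> \<kappa>" for z
      by (rule U_left_bound(2)) (use \<eta>' \<kappa> that in auto)
    have "integrable lborel (fourier_integrand (restrict_field left_half \<phi>) 0 \<eta>)"
      by (intro integrable_fourier_restrict \<phi>_integrable region_measurable) (use \<eta>' \<kappa> in auto)
    then show "(\<lambda>n. U_left (- \<i> * of_real (real n)) \<eta>) \<longlonglongrightarrow> 0"
    proof (rule fourier2_vanishes_down)
      show "fst x < 0" if "restrict_field left_half \<phi> x \<noteq> 0" for x
        using that restrict_field_eq_0[of x left_half \<phi>] by blast
    qed
  qed (use \<kappa> in auto)
  have "line_integral \<kappa> (\<lambda>\<zeta>. K \<zeta> \<eta> * W \<zeta> \<eta> / (\<zeta> - p)) =
      \<i> * line_integral \<kappa> (\<lambda>\<zeta>. (U_right \<zeta> \<eta> + U_left \<zeta> \<eta>) / (\<zeta> - p))"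
    unfolding line_integral_def on_line by (rule integral_mult_right_zero)
  also have "\<dots> = 2 * of_real pi * U_left p \<eta>"
    unfolding U_int by (rule ii_cancel(1))
  finally show "line_integral \<kappa> (\<lambda>\<zeta>. K \<zeta> \<eta> * W \<zeta> \<eta> / (\<zeta> - p)) = 2 * of_real pi * U_left p \<eta>" .
qed

text \<open>
  \<open>U_left\<close> inherits its decay in the second variable from \<open>K\<close>, through the integral formula just
  proved; as a Fourier transform of an integrable function it has no rate of its own.
\<close>

lemma U_left_decay:
  assumes p: "Im p < \<kappa>"
  obtains C where "\<And>\<eta>. \<bar>Im \<eta>\<bar> \<le> \<kappa> \<Longrightarrow> norm (U_left p \<eta>) \<le> C * (1 + \<bar>Re \<eta>\<bar>) powr (- 3/4)"
proof -
  obtain C where C: "0 \<le> C" "\<And>\<eta> t. \<bar>Im \<eta>\<bar> \<le> \<kappa> \<Longrightarrow>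
      norm (K (Complex t \<kappa>) \<eta> * W (Complex t \<kappa>) \<eta> / (Complex t \<kappa> - p)) \<le>
        C * (1 + \<bar>Re \<eta>\<bar>) powr (- 3/4) * (1 + \<bar>t\<bar>) powr (- 5/4)"
    using KW_over_pole_decay[OF p] by blast
  let ?I = "LINT t|lborel. (1 + \<bar>t\<bar>) powr (- 5/4)"
  show thesis
  proof (rule that[of "C * ?I / (2 * pi)"])
    fix \<eta> :: complex assume \<eta>: "\<bar>Im \<eta>\<bar> \<le> \<kappa>"
    let ?b = "(1 + \<bar>Re \<eta>\<bar>) powr (- 3/4)"
    have "2 * pi * norm (U_left p \<eta>) = norm (line_integral \<kappa> (\<lambda>\<zeta>. K \<zeta> \<eta> * W \<zeta> \<eta> / (\<zeta> - p)))"
      by (simp add: inner_line_integral(2)[OF p \<eta>] norm_mult)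
    also have "\<dots> \<le> (LINT t|lborel. C * ?b * (1 + \<bar>t\<bar>) powr (- 5/4))"
      unfolding line_integral_def
    proof (rule order_trans[OF integral_norm_bound integral_mono])
      show "integrable lborel (\<lambda>t. norm (K (Complex t \<kappa>) \<eta> * W (Complex t \<kappa>) \<eta> / (Complex t \<kappa> - p)))"
        using inner_line_integral(1)[OF p \<eta>] unfolding line_integrable_def by (rule integrable_norm)
      show "integrable lborel (\<lambda>t. C * ?b * (1 + \<bar>t\<bar>) powr (- 5/4))"
        by (intro integrable_mult_right integrable_one_plus_abs_powr) simp
    qed (rule C(2)[OF \<eta>])
    also have "\<dots> = C * ?b * ?I" by (rule integral_mult_right_zero)
    finally show "norm (U_left p \<eta>) \<le> C * ?I / (2 * pi) * ?b"
      using pi_gt_zero by (simp add: field_simps)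
  qed
qed

text \<open>
  The exponents add up to \<open>1/2 - 3/4 - 1 = -5/4 < -1\<close>.
\<close>

lemma gamma_line_integrable:
  assumes p: "\<bar>Im p\<bar> < \<kappa>" and q: "\<bar>Im q\<bar> < \<kappa>"
    and cont: "continuous_on {z. Im z = - \<kappa>} X"
    and bound: "\<And>t. norm (X (Complex t (- \<kappa>))) \<le> C * (1 + \<bar>t\<bar>) powr (- 3/4)"
  shows "line_integrable (- \<kappa>) (\<lambda>\<eta>. \<gamma> p (- \<eta>) * X \<eta> / (\<eta> - q))"
proof -
  have "Im q \<noteq> - \<kappa>" using q by auto
  then obtain m where m: "0 < m" "\<And>t. m * (1 + \<bar>t\<bar>) \<le> norm (Complex t (- \<kappa>) - q)"
    using line_distance_lower_bound[of q "- \<kappa>"] by blast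
  define B where "B = sqrt (1 + norm (inner_root p)) * 2 powr (1/2)"
  have B: "0 \<le> B" by (simp add: B_def)
  have \<gamma>: "norm (\<gamma> p (- Complex t (- \<kappa>))) \<le> B * (1 + \<bar>t\<bar>) powr (1/2)" for t
  proof -
    have "norm (- Complex t (- \<kappa>)) \<le> \<bar>t\<bar> + \<bar>\<kappa>\<bar>"
      using cmod_le[of "- Complex t (- \<kappa>)"] by simp
    then have "1 + norm (- Complex t (- \<kappa>)) \<le> 2 * (1 + \<bar>t\<bar>)" using \<kappa> eps by simp
    then have "(1 + norm (- Complex t (- \<kappa>))) powr (1/2) \<le> 2 powr (1/2) * (1 + \<bar>t\<bar>) powr (1/2)"
      by (subst powr_mult[symmetric]) (auto intro!: powr_mono2)
    then have "sqrt (1 + norm (inner_root p)) * (1 + norm (- Complex t (- \<kappa>))) powr (1/2) \<le>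
        sqrt (1 + norm (inner_root p)) * (2 powr (1/2) * (1 + \<bar>t\<bar>) powr (1/2))"
      by (intro mult_left_mono) auto
    with norm_gamma_upper[of k p "- Complex t (- \<kappa>)"] show ?thesis
      by (simp add: B_def mult.assoc)
  qed
  show ?thesis
  proof (rule line_integrable_if_decay[where e = "- 5/4" and B = "B * C / m"])
    have "2 * \<kappa> < Im (inner_root p)" using Im_inner_root[of p] p by linarith
    then have "{z. Im z = - \<kappa>} \<subseteq> {z. Im z < Im (inner_root p)}" using \<kappa>(1) by auto
    then have "continuous_on {z. Im z = - \<kappa>} (\<lambda>\<eta>. \<gamma> p (- \<eta>))"
      by (rule holomorphic_on_imp_continuous_on[OF holomorphic_on_subset[OF gamma_reflected_holomorphic]])
    then show "continuous_on {z. Im z = - \<kappa>} (\<lambda>\<eta>. \<gamma> p (- \<eta>) * X \<eta> / (\<eta> - q))"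
      using q cont by (intro continuous_intros) auto
    fix t
    let ?z = "Complex t (- \<kappa>)" and ?d = "1 + \<bar>t\<bar>"
    have "norm (\<gamma> p (- ?z) * X ?z / (?z - q)) \<le>
        ((B * ?d powr (1/2)) * (C * ?d powr (- 3/4))) / (m * ?d)"
      unfolding norm_divide norm_mult using B m(1) m(2)[of t] order_trans[OF norm_ge_zero bound[of t]]
      by (intro frac_le mult_mono \<gamma> bound) auto
    also have "\<dots> = B * C / m * (?d powr (1/2) * ?d powr (- 3/4) / ?d powr 1)"
      by simp
    also have "?d powr (1/2) * ?d powr (- 3/4) / ?d powr 1 = ?d powr (- 5/4)"
      using powr_add[of ?d "1/2" "- 3/4"] powr_diff[of ?d "- 1/4" 1] by simp
    finally show "norm (\<gamma> p (- ?z) * X ?z / (?z - q)) \<le> B * C / m * ?d powr (- 5/4)" .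
  qed simp
qed

lemma lower_line: "{z. Im z = - \<kappa>} \<subseteq> {z. \<bar>Im z\<bar> < 2 * \<kappa>}"
  using \<kappa>(1) by auto

text \<open>
  On the line \<open>\<gamma> p (- \<eta>) * U p \<eta>\<close> equals \<open>W p \<eta> / \<gamma> p \<eta>\<close> up to the factor \<open>- \<i>\<close>, and this quotient is
  bounded and holomorphic above the line.
\<close>

lemma outer_U:
  assumes p: "\<bar>Im p\<bar> < \<kappa>" and q: "\<bar>Im q\<bar> < \<kappa>"
  shows "line_integrable (- \<kappa>) (\<lambda>\<eta>. \<gamma> p (- \<eta>) * U p \<eta> / (\<eta> - q))"
    and "line_integral (- \<kappa>) (\<lambda>\<eta>. \<gamma> p (- \<eta>) * U p \<eta> / (\<eta> - q)) = 2 * of_real pi * W p q / \<gamma> p q"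
proof -
  have p': "\<bar>Im p\<bar> < 2 * \<kappa>" using p by linarith
  have root: "2 * \<kappa> < Im (inner_root p)" by (rule Im_inner_root[OF p'])
  obtain C where C: "0 \<le> C" "\<And>\<xi>1 \<xi>2. \<bar>Im \<xi>1\<bar> \<le> \<kappa> \<Longrightarrow> \<bar>Im \<xi>2\<bar> \<le> \<kappa> \<Longrightarrow>
      norm (K \<xi>1 \<xi>2 * W \<xi>1 \<xi>2) \<le> C * ((1 + \<bar>Re \<xi>1\<bar>) powr (- 1/4) * (1 + \<bar>Re \<xi>2\<bar>) powr (- 3/4))"
    using KW_decay by blast
  show int: "line_integrable (- \<kappa>) (\<lambda>\<eta>. \<gamma> p (- \<eta>) * U p \<eta> / (\<eta> - q))"
  proof (rule gamma_line_integrable[OF p q])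
    show "continuous_on {z. Im z = - \<kappa>} (\<lambda>\<eta>. U p \<eta>)"
      by (rule holomorphic_on_imp_continuous_on[OF holomorphic_on_subset[OF U_holomorphic(2)[OF p'] lower_line]])
    fix t
    have "norm (U p (Complex t (- \<kappa>))) = norm (K p (Complex t (- \<kappa>)) * W p (Complex t (- \<kappa>)))"
      using functional_strip[of p "Complex t (- \<kappa>)"] p' \<kappa> by (simp add: norm_mult)
    also have "\<dots> \<le> C * ((1 + \<bar>Re p\<bar>) powr (- 1/4) * (1 + \<bar>t\<bar>) powr (- 3/4))"
      using C(2)[of p "Complex t (- \<kappa>)"] p \<kappa> by simp
    finally show "norm (U p (Complex t (- \<kappa>))) \<le> C * (1 + \<bar>Re p\<bar>) powr (- 1/4) * (1 + \<bar>t\<bar>) powr (- 3/4)"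
      by (simp only: mult.assoc)
  qed
  have on_line: "\<gamma> p (- \<eta>) * U p \<eta> / (\<eta> - q) = - \<i> * (W p \<eta> / \<gamma> p \<eta> / (\<eta> - q))"
    if "Im \<eta> = - \<kappa>" for \<eta>
  proof -
    have \<eta>: "\<bar>Im \<eta>\<bar> < 2 * \<kappa>" using that \<kappa> by simp
    have nz: "\<gamma> p \<eta> \<noteq> 0" "\<gamma> p (- \<eta>) \<noteq> 0" using \<eta> root by (auto intro!: gamma_nonzero)
    have "K p \<eta> = 1 / (\<gamma> p \<eta> * \<gamma> p (- \<eta>))"
      unfolding K_spec_def using gamma_mult_gamma[of \<eta> k p] \<eta> root by simp
    then have "W p \<eta> / (\<gamma> p \<eta> * \<gamma> p (- \<eta>)) = \<i> * U p \<eta>"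
      using functional_strip[OF p' \<eta>] by simp
    then have "W p \<eta> / \<gamma> p \<eta> = \<i> * U p \<eta> * \<gamma> p (- \<eta>)"
      using nz by (simp add: divide_simps mult_ac)
    then show ?thesis by (simp add: mult.assoc mult.commute[of "U p \<eta>"])
  qed
  have hol: "(\<lambda>\<eta>. W p \<eta> / \<gamma> p \<eta>) holomorphic_on {z. - 2 * \<kappa> < Im z}"
  proof (intro holomorphic_on_divide W_holomorphic)
    show "\<gamma> p holomorphic_on {z. - 2 * \<kappa> < Im z}"
      by (rule holomorphic_on_subset[OF gamma_holomorphic]) (use root in auto)
  qed (use p root in \<open>auto intro!: gamma_nonzero\<close>)
  obtain M where M: "0 \<le> M" "\<And>\<xi>1 \<xi>2. - \<kappa> \<le> Im \<xi>1 \<Longrightarrow> - \<kappa> \<le> Im \<xi>2 \<Longrightarrow> norm (W \<xi>1 \<xi>2) \<le> M"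
    using W_bounded by blast
  have lim: "((\<lambda>\<eta>. W p \<eta> / \<gamma> p \<eta> / \<eta>) \<longlongrightarrow> 0) (upper_infinity (- \<kappa>))"
  proof (rule tendsto_div_bounded)
    fix z assume "z \<in> {z. - \<kappa> \<le> Im z}"
    then have z: "- \<kappa> \<le> Im z" by simp
    have "\<kappa> \<le> Im (inner_root p + z)" using z root by simp
    also have "\<dots> \<le> norm (inner_root p + z)" by (rule order_trans[OF abs_ge_self abs_Im_le_cmod])
    finally have "sqrt \<kappa> \<le> norm (\<gamma> p z)" unfolding norm_gamma by simp
    then show "norm (W p z / \<gamma> p z) \<le> M / sqrt \<kappa>"
      unfolding norm_divide using M(1) M(2)[of p z] z p \<kappa> by (intro frac_le) auto
  qed
  have intW: "line_integrable (- \<kappa>) (\<lambda>\<eta>. W p \<eta> / \<gamma> p \<eta> / (\<eta> - q))"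
    using integrable_mult_right[of \<i>, OF int[unfolded line_integrable_def]]
    by (simp add: line_integrable_def on_line)
  have "line_integral (- \<kappa>) (\<lambda>\<eta>. \<gamma> p (- \<eta>) * U p \<eta> / (\<eta> - q)) =
      - \<i> * line_integral (- \<kappa>) (\<lambda>\<eta>. W p \<eta> / \<gamma> p \<eta> / (\<eta> - q))"
    unfolding line_integral_def by (simp only: on_line complex.sel integral_mult_right_zero)
  also have "line_integral (- \<kappa>) (\<lambda>\<eta>. W p \<eta> / \<gamma> p \<eta> / (\<eta> - q)) = 2 * of_real pi * \<i> * (W p q / \<gamma> p q)"
    using q \<kappa> by (subst Cauchy_one_pole_upper[OF hol _ lim _ intW]) auto
  also have "- \<i> * (2 * of_real pi * \<i> * (W p q / \<gamma> p q)) = 2 * of_real pi * (W p q / \<gamma> p q)"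
    by (rule ii_cancel(2))
  finally show "line_integral (- \<kappa>) (\<lambda>\<eta>. \<gamma> p (- \<eta>) * U p \<eta> / (\<eta> - q)) = 2 * of_real pi * W p q / \<gamma> p q"
    by simp
qed

text \<open>
  \<open>gamma\<close> grows only like the square root of its argument.
\<close>

lemma gamma_reflected_growth:
  assumes "\<And>z. Im z \<le> - \<kappa> \<Longrightarrow> norm (X z) \<le> M"
  shows "((\<lambda>\<eta>. \<gamma> p (- \<eta>) * X \<eta> / \<eta>) \<longlongrightarrow> 0) (lower_infinity (- \<kappa>))"
proof (rule tendsto_div_sublinear[where e = "1/2" and B = "sqrt (1 + norm (inner_root p)) * M"])
  fix z assume "z \<in> {z. Im z \<le> - \<kappa>}"
  then have "norm (\<gamma> p (- z) * X z) \<le> (sqrt (1 + norm (inner_root p)) * (1 + norm z) powr (1/2)) * M"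
    unfolding norm_mult using norm_gamma_upper[of k p "- z"] assms[of z]
    by (intro mult_mono) auto
  then show "norm (\<gamma> p (- z) * X z) \<le> sqrt (1 + norm (inner_root p)) * M * (1 + norm z) powr (1/2)"
    by (simp only: mult_ac)
qed simp

text \<open>
  Closing the contour downwards meets the single pole \<open>- k2\<close>, where \<open>\<gamma> p (- \<eta>)\<close> takes the value \<open>\<gamma> p k2\<close>.
\<close>

lemma outer_U_upper_right:
  assumes p: "\<bar>Im p\<bar> < \<kappa>" and q: "\<bar>Im q\<bar> < \<kappa>"
  shows "line_integrable (- \<kappa>) (\<lambda>\<eta>. \<gamma> p (- \<eta>) * (1 / ((p + k1) * (\<eta> + k2))) / (\<eta> - q))"
    and "line_integral (- \<kappa>) (\<lambda>\<eta>. \<gamma> p (- \<eta>) * (1 / ((p + k1) * (\<eta> + k2))) / (\<eta> - q)) =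
      2 * of_real pi * \<i> * \<gamma> p k2 / ((p + k1) * (q + k2))"
proof -
  have root: "2 * \<kappa> < Im (inner_root p)" using Im_inner_root[of p] p by linarith
  have pk1: "p + k1 \<noteq> 0"
  proof
    assume "p + k1 = 0"
    then have "Im p + Im k1 = 0" by (metis plus_complex.simps(2) zero_complex.simps(2))
    then show False using p \<kappa> by linarith
  qed
  have qk2: "q + k2 \<noteq> 0"
  proof
    assume "q + k2 = 0"
    then have "Im q + Im k2 = 0" by (metis plus_complex.simps(2) zero_complex.simps(2))
    then show False using q \<kappa> by linarith
  qed
  have k2: "Im (- k2) \<noteq> - \<kappa>" using \<kappa> by simp
  obtain m where m: "0 < m" "\<And>t. m * (1 + \<bar>t\<bar>) \<le> norm (Complex t (- \<kappa>) - (- k2))"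
    using line_distance_lower_bound[OF k2] by blast
  show int: "line_integrable (- \<kappa>) (\<lambda>\<eta>. \<gamma> p (- \<eta>) * (1 / ((p + k1) * (\<eta> + k2))) / (\<eta> - q))"
  proof (rule gamma_line_integrable[OF p q])
    have "\<eta> + k2 \<noteq> 0" if "Im \<eta> = - \<kappa>" for \<eta>
    proof
      assume "\<eta> + k2 = 0"
      then have "Im \<eta> + Im k2 = 0" by (metis plus_complex.simps(2) zero_complex.simps(2))
      then show False using that \<kappa> by linarith
    qed
    then show "continuous_on {z. Im z = - \<kappa>} (\<lambda>\<eta>. 1 / ((p + k1) * (\<eta> + k2)))"
      using pk1 by (intro continuous_intros) auto
    fix t
    have "norm (1 / ((p + k1) * (Complex t (- \<kappa>) + k2))) \<le> 1 / (norm (p + k1) * (m * (1 + \<bar>t\<bar>)))"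
      using m(1) m(2)[of t] pk1 by (auto simp: norm_divide norm_mult intro!: frac_le mult_left_mono)
    also have "\<dots> = 1 / (norm (p + k1) * m) * (1 + \<bar>t\<bar>) powr (- 1)"
      by (simp add: powr_minus_divide)
    also have "\<dots> \<le> 1 / (norm (p + k1) * m) * (1 + \<bar>t\<bar>) powr (- 3/4)"
      using m(1) by (intro mult_left_mono powr_mono) auto
    finally show "norm (1 / ((p + k1) * (Complex t (- \<kappa>) + k2))) \<le>
        1 / (norm (p + k1) * m) * (1 + \<bar>t\<bar>) powr (- 3/4)" .
  qed
  have eq: "\<gamma> p (- \<eta>) * (1 / ((p + k1) * (\<eta> + k2))) / (\<eta> - q) =
      1 / (p + k1) * (\<gamma> p (- \<eta>) / ((\<eta> - (- k2)) * (\<eta> - q)))" for \<eta>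
    by simp
  have int': "line_integrable (- \<kappa>) (\<lambda>\<eta>. \<gamma> p (- \<eta>) / ((\<eta> - (- k2)) * (\<eta> - q)))"
    using integrable_mult_right[of "p + k1", OF int[unfolded line_integrable_def eq]] pk1
    by (simp add: line_integrable_def)
  have "line_integral (- \<kappa>) (\<lambda>\<eta>. \<gamma> p (- \<eta>) * (1 / ((p + k1) * (\<eta> + k2))) / (\<eta> - q)) =
      1 / (p + k1) * line_integral (- \<kappa>) (\<lambda>\<eta>. \<gamma> p (- \<eta>) / ((\<eta> - (- k2)) * (\<eta> - q)))"
    unfolding line_integral_def eq by (rule integral_mult_right_zero)
  also have "line_integral (- \<kappa>) (\<lambda>\<eta>. \<gamma> p (- \<eta>) / ((\<eta> - (- k2)) * (\<eta> - q))) =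
      - 2 * of_real pi * \<i> * ((if Im (- k2) < - \<kappa> then \<gamma> p (- (- k2)) else 0) -
        (if Im q < - \<kappa> then \<gamma> p (- q) else 0)) / (- k2 - q)"
  proof (rule Cauchy_two_poles_lower[OF gamma_reflected_holomorphic _ _ k2 _ _ int'])
    show "((\<lambda>\<eta>. \<gamma> p (- \<eta>) / \<eta>) \<longlongrightarrow> 0) (lower_infinity (- \<kappa>))"
      using gamma_reflected_growth[of "\<lambda>_. 1" 1] by simp
    show "- k2 \<noteq> q" using qk2 by (auto simp: add_eq_0_iff)
  qed (use root \<kappa> q in auto)
  also have "\<dots> = 2 * of_real pi * \<i> * \<gamma> p k2 / (q + k2)"
  proof -
    have "- k2 - q = - (q + k2)" by simp
    then show ?thesis using q \<kappa> by (simp only: divide_minus_right) simp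
  qed
  finally show "line_integral (- \<kappa>) (\<lambda>\<eta>. \<gamma> p (- \<eta>) * (1 / ((p + k1) * (\<eta> + k2))) / (\<eta> - q)) =
      2 * of_real pi * \<i> * \<gamma> p k2 / ((p + k1) * (q + k2))"
    by (simp add: mult.commute[of "p + k1"])
qed

text \<open>
  \<open>U_lower_right\<close> is holomorphic and bounded below the line, so its integral vanishes; its absolute
  convergence is not visible directly and comes from writing it as \<open>U - U_upper_right - U_left\<close>.
\<close>

lemma outer_U_left:
  assumes p: "\<bar>Im p\<bar> < \<kappa>" and q: "\<bar>Im q\<bar> < \<kappa>"
  shows "line_integrable (- \<kappa>) (\<lambda>\<eta>. \<gamma> p (- \<eta>) * U_left p \<eta> / (\<eta> - q))"
    and "line_integral (- \<kappa>) (\<lambda>\<eta>. \<gamma> p (- \<eta>) * U_left p \<eta> / (\<eta> - q)) =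
      2 * of_real pi * W p q / \<gamma> p q - 2 * of_real pi * \<i> * \<gamma> p k2 / ((p + k1) * (q + k2))"
proof -
  have p': "\<bar>Im p\<bar> < 2 * \<kappa>" "Im p < 2 * \<kappa>" "Im p < \<kappa>" using p by linarith+
  have root: "2 * \<kappa> < Im (inner_root p)" by (rule Im_inner_root[OF p'(1)])
  obtain C where C: "\<And>\<eta>. \<bar>Im \<eta>\<bar> \<le> \<kappa> \<Longrightarrow> norm (U_left p \<eta>) \<le> C * (1 + \<bar>Re \<eta>\<bar>) powr (- 3/4)"
    using U_left_decay[OF p'(3)] by blast
  show int: "line_integrable (- \<kappa>) (\<lambda>\<eta>. \<gamma> p (- \<eta>) * U_left p \<eta> / (\<eta> - q))"
  proof (rule gamma_line_integrable[OF p q])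
    show "continuous_on {z. Im z = - \<kappa>} (\<lambda>\<eta>. U_left p \<eta>)"
      by (rule holomorphic_on_imp_continuous_on[OF holomorphic_on_subset[OF U_left_holomorphic_snd[OF p'(2)] lower_line]])
    show "norm (U_left p (Complex t (- \<kappa>))) \<le> C * (1 + \<bar>t\<bar>) powr (- 3/4)" for t
      using C[of "Complex t (- \<kappa>)"] \<kappa> by simp
  qed
  have split: "U_lower_right p \<eta> = U p \<eta> - 1 / ((p + k1) * (\<eta> + k2)) - U_left p \<eta>" if "Im \<eta> = - \<kappa>" for \<eta>
    using U_split[OF p'(1), of \<eta>] U_upper_right_eq[OF p, of \<eta>] that \<kappa> by simp
  let ?a = "\<lambda>\<eta>. \<gamma> p (- \<eta>) * U p \<eta> / (\<eta> - q)"
  let ?b = "\<lambda>\<eta>. \<gamma> p (- \<eta>) * (1 / ((p + k1) * (\<eta> + k2))) / (\<eta> - q)"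
  let ?c = "\<lambda>\<eta>. \<gamma> p (- \<eta>) * U_left p \<eta> / (\<eta> - q)"
  have on_line: "\<gamma> p (- Complex t (- \<kappa>)) * U_lower_right p (Complex t (- \<kappa>)) / (Complex t (- \<kappa>) - q) =
      ?a (Complex t (- \<kappa>)) - ?b (Complex t (- \<kappa>)) - ?c (Complex t (- \<kappa>))" for t
    by (subst split) (simp_all only: complex.sel right_diff_distrib diff_divide_distrib)
  note ints = outer_U(1)[OF p q, unfolded line_integrable_def]
    outer_U_upper_right(1)[OF p q, unfolded line_integrable_def] int[unfolded line_integrable_def]
  have int_lower_right: "line_integrable (- \<kappa>) (\<lambda>\<eta>. \<gamma> p (- \<eta>) * U_lower_right p \<eta> / (\<eta> - q))"
    unfolding line_integrable_def on_line by (intro Bochner_Integration.integrable_diff ints)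
  have "line_integral (- \<kappa>) (\<lambda>\<eta>. \<gamma> p (- \<eta>) * U_lower_right p \<eta> / (\<eta> - q)) = 0"
  proof -
    have "(\<lambda>\<eta>. \<gamma> p (- \<eta>) * U_lower_right p \<eta>) holomorphic_on {z. Im z < 2 * \<kappa>}"
      by (intro holomorphic_intros U_lower_right_holomorphic p'
          holomorphic_on_subset[OF gamma_reflected_holomorphic]) (use root in auto)
    moreover have "((\<lambda>\<eta>. \<gamma> p (- \<eta>) * U_lower_right p \<eta> / \<eta>) \<longlongrightarrow> 0) (lower_infinity (- \<kappa>))"
      by (rule gamma_reflected_growth, rule U_lower_right_bound(2)[of _ 0]) (use p' \<kappa> in auto)
    ultimately show ?thesis
      using q \<kappa> by (subst Cauchy_one_pole_lower[OF _ _ _ _ int_lower_right]) auto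
  qed
  moreover have "line_integral (- \<kappa>) (\<lambda>\<eta>. \<gamma> p (- \<eta>) * U_lower_right p \<eta> / (\<eta> - q)) =
      line_integral (- \<kappa>) ?a - line_integral (- \<kappa>) ?b - line_integral (- \<kappa>) ?c"
    unfolding line_integral_def on_line
    by (subst Bochner_Integration.integral_diff[OF Bochner_Integration.integrable_diff[OF ints(1,2)] ints(3)],
        subst Bochner_Integration.integral_diff[OF ints(1,2)]) (rule refl)
  ultimately show "line_integral (- \<kappa>) ?c =
      2 * of_real pi * W p q / \<gamma> p q - 2 * of_real pi * \<i> * \<gamma> p k2 / ((p + k1) * (q + k2))"
    unfolding outer_U(2)[OF p q] outer_U_upper_right(2)[OF p q] by simp
qed

text \<open>
  The inner integral is known by \<open>inner_line_integral\<close> and the outer one by \<open>outer_U_left\<close>; what is left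
  is to solve for \<open>W p q\<close>.
\<close>

lemma first_relation:
  assumes p: "\<bar>Im p\<bar> < \<kappa>" and q: "\<bar>Im q\<bar> < \<kappa>"
  defines "F \<equiv> (\<lambda>\<zeta> \<eta>. \<gamma> p (- \<eta>) * K \<zeta> \<eta> * W \<zeta> \<eta> / ((\<zeta> - p) * (\<eta> - q)))"
  shows "iterated_integrable \<kappa> (- \<kappa>) F"
    and "W p q = \<gamma> p q / (4 * (of_real pi)\<^sup>2) * iterated_integral \<kappa> (- \<kappa>) F
      + \<i> * \<gamma> p q * \<gamma> p k2 / ((p + k1) * (q + k2))"
proof -
  have p': "\<bar>Im p\<bar> < 2 * \<kappa>" "Im p < \<kappa>" using p by linarith+
  have F: "F \<zeta> \<eta> = \<gamma> p (- \<eta>) / (\<eta> - q) * (K \<zeta> \<eta> * W \<zeta> \<eta> / (\<zeta> - p))" for \<zeta> \<eta>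
    by (simp add: F_def mult.assoc mult.commute[of "\<zeta> - p"])
  have inner: "line_integrable \<kappa> (\<lambda>\<zeta>. F \<zeta> \<eta>)"
      "line_integral \<kappa> (\<lambda>\<zeta>. F \<zeta> \<eta>) = 2 * of_real pi * (\<gamma> p (- \<eta>) * U_left p \<eta> / (\<eta> - q))"
    if "Im \<eta> = - \<kappa>" for \<eta>
  proof -
    have \<eta>: "\<bar>Im \<eta>\<bar> \<le> \<kappa>" using that \<kappa> by simp
    show "line_integrable \<kappa> (\<lambda>\<zeta>. F \<zeta> \<eta>)"
      unfolding F line_integrable_def
      by (rule integrable_mult_right) (rule inner_line_integral(1)[OF p'(2) \<eta>, unfolded line_integrable_def])
    have "line_integral \<kappa> (\<lambda>\<zeta>. F \<zeta> \<eta>) =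
        \<gamma> p (- \<eta>) / (\<eta> - q) * line_integral \<kappa> (\<lambda>\<zeta>. K \<zeta> \<eta> * W \<zeta> \<eta> / (\<zeta> - p))"
      unfolding F line_integral_def by (rule integral_mult_right_zero)
    then show "line_integral \<kappa> (\<lambda>\<zeta>. F \<zeta> \<eta>) = 2 * of_real pi * (\<gamma> p (- \<eta>) * U_left p \<eta> / (\<eta> - q))"
      by (simp add: inner_line_integral(2)[OF p'(2) \<eta>])
  qed
  show "iterated_integrable \<kappa> (- \<kappa>) F"
    unfolding iterated_integrable_def
  proof (intro conjI allI impI inner)
    show "line_integrable (- \<kappa>) (\<lambda>\<eta>. line_integral \<kappa> (\<lambda>\<zeta>. F \<zeta> \<eta>))"
      unfolding line_integrable_def
      by (simp only: inner(2) complex.sel)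
        (rule integrable_mult_right, rule outer_U_left(1)[OF p q, unfolded line_integrable_def])
  qed
  have "iterated_integral \<kappa> (- \<kappa>) F =
      2 * of_real pi * line_integral (- \<kappa>) (\<lambda>\<eta>. \<gamma> p (- \<eta>) * U_left p \<eta> / (\<eta> - q))"
    unfolding iterated_integral_def line_integral_def[of "- \<kappa>"]
    by (simp only: inner(2) complex.sel integral_mult_right_zero)
  also have "\<dots> = 4 * (of_real pi)\<^sup>2 * (W p q / \<gamma> p q - \<i> * \<gamma> p k2 / ((p + k1) * (q + k2)))"
    unfolding outer_U_left(2)[OF p q] by (simp add: power2_eq_square algebra_simps)
  finally have "\<gamma> p q / (4 * (of_real pi)\<^sup>2) * iterated_integral \<kappa> (- \<kappa>) F =
      \<gamma> p q * (W p q / \<gamma> p q - \<i> * \<gamma> p k2 / ((p + k1) * (q + k2)))"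
    by simp
  moreover have "\<gamma> p q \<noteq> 0"
    using Im_inner_root[OF p'(1)] q \<kappa> by (intro gamma_nonzero) (subst plus_complex.simps(2), linarith)
  ultimately show "W p q = \<gamma> p q / (4 * (of_real pi)\<^sup>2) * iterated_integral \<kappa> (- \<kappa>) F
      + \<i> * \<gamma> p q * \<gamma> p k2 / ((p + k1) * (q + k2))"
    by (simp add: right_diff_distrib)
qed

end

section \<open>Exchanging the two variables\<close>

lemma (in quarter_plane_spectrum) swapped:
  "quarter_plane_spectrum eps \<kappa> k k2 k1 (\<phi> \<circ> prod.swap) (w \<circ> prod.swap)"
proof
  have meas: "\<phi> \<in> borel_measurable lborel" "w \<in> borel_measurable lborel"
  proof -
    have "fourier_integrand \<psi> 0 0 = \<psi>" for \<psi> by (auto simp: fourier_integrand_def)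
    then show "\<phi> \<in> borel_measurable lborel" "w \<in> borel_measurable lborel"
      using borel_measurable_integrable[OF \<phi>_integrable[of 0 0]]
        borel_measurable_integrable[OF w_integrable[of 0 0]] \<kappa>(1) by auto
  qed
  show "K_spec k \<xi>1 \<xi>2 * fourier2 (w \<circ> prod.swap) \<xi>1 \<xi>2 = \<i> * fourier2 (\<phi> \<circ> prod.swap) \<xi>1 \<xi>2"
    if "\<xi>1 \<in> \<real>" "\<xi>2 \<in> \<real>" for \<xi>1 \<xi>2
    using functional_real[OF that(2,1)] by (simp only: fourier2_swap[OF meas(1)] fourier2_swap[OF meas(2)] K_commute[of \<xi>1])
  show "integrable lborel (fourier_integrand (\<phi> \<circ> prod.swap) \<xi>1 \<xi>2)"
    if "\<bar>Im \<xi>1\<bar> < 2 * \<kappa>" "\<bar>Im \<xi>2\<bar> < 2 * \<kappa>" for \<xi>1 \<xi>2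
    unfolding fourier_integrand_swap integrable_swap_real2 by (rule \<phi>_integrable[OF that(2,1)])
  show "integrable lborel (fourier_integrand (w \<circ> prod.swap) \<xi>1 \<xi>2)"
    if "- 2 * \<kappa> < Im \<xi>1" "- 2 * \<kappa> < Im \<xi>2" for \<xi>1 \<xi>2
    unfolding fourier_integrand_swap integrable_swap_real2 by (rule w_integrable[OF that(2,1)])
  show "(\<phi> \<circ> prod.swap) (x1, x2) = - exp (\<i> * (k2 * of_real x1 + k1 * of_real x2))"
    if "0 < x1" "0 < x2" for x1 x2
    using \<phi>_quarter[OF that(2,1)] by (simp add: add.commute)
  show "(w \<circ> prod.swap) (x1, x2) = 0" if "x1 < 0 \<or> x2 < 0" for x1 x2
    using w_support[of x2 x1] that by auto
qed (use eps k \<kappa> in auto)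

lemma (in quarter_plane_spectrum) second_relation:
  assumes \<xi>1: "\<bar>Im \<xi>1\<bar> < \<kappa>" and \<xi>2: "\<bar>Im \<xi>2\<bar> < \<kappa>"
  defines "F \<equiv> (\<lambda>\<xi>2' \<xi>1'. \<gamma> \<xi>2 (- \<xi>1') * K \<xi>1' \<xi>2' * W \<xi>1' \<xi>2' / ((\<xi>1' - \<xi>1) * (\<xi>2' - \<xi>2)))"
  shows "iterated_integrable \<kappa> (- \<kappa>) F"
    and "W \<xi>1 \<xi>2 = \<gamma> \<xi>2 \<xi>1 / (4 * (of_real pi)\<^sup>2) * iterated_integral \<kappa> (- \<kappa>) F
      + \<i> * \<gamma> \<xi>2 \<xi>1 * \<gamma> \<xi>2 k1 / ((\<xi>1 + k1) * (\<xi>2 + k2))"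
proof -
  interpret swapped: quarter_plane_spectrum eps \<kappa> k k2 k1 "\<phi> \<circ> prod.swap" "w \<circ> prod.swap"
    by (rule swapped)
  have "fourier_integrand w 0 0 = w" by (auto simp: fourier_integrand_def)
  then have "w \<in> borel_measurable lborel"
    using borel_measurable_integrable[OF w_integrable[of 0 0]] \<kappa>(1) by auto
  then have W: "swapped.W \<zeta> \<eta> = W \<eta> \<zeta>" for \<zeta> \<eta> by (rule fourier2_swap)
  have F: "F = (\<lambda>\<zeta> \<eta>. \<gamma> \<xi>2 (- \<eta>) * K \<zeta> \<eta> * swapped.W \<zeta> \<eta> / ((\<zeta> - \<xi>2) * (\<eta> - \<xi>1)))"
    unfolding F_def W by (intro ext) (simp only: K_commute mult.commute[of "_ - \<xi>1"])
  show "iterated_integrable \<kappa> (- \<kappa>) F"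
    unfolding F by (rule swapped.first_relation(1)[OF \<xi>2 \<xi>1])
  show "W \<xi>1 \<xi>2 = \<gamma> \<xi>2 \<xi>1 / (4 * (of_real pi)\<^sup>2) * iterated_integral \<kappa> (- \<kappa>) F
      + \<i> * \<gamma> \<xi>2 \<xi>1 * \<gamma> \<xi>2 k1 / ((\<xi>1 + k1) * (\<xi>2 + k2))"
    using swapped.first_relation(2)[OF \<xi>2 \<xi>1, folded F]
    by (simp only: W mult.commute[of "\<xi>2 + k2"])
qed

section \<open>Traces of the field\<close>

lemma C_on_1_continuous:
  assumes "C_on 1 f S"
  shows "continuous_on S f"
proof -
  obtain f' where "\<forall>x\<in>S. (f has_derivative f' x) (at x)"
    using assms by (auto simp: One_nat_def)
  then show ?thesis
    by (auto intro!: continuous_at_imp_continuous_on has_derivative_continuous)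
qed

lemma partial_deriv_eq:
  assumes "(f has_derivative f') (at x)"
  shows "partial_deriv b f x = f' b"
proof -
  have "((\<lambda>t. x + t *\<^sub>R b) has_derivative (\<lambda>t. t *\<^sub>R b)) (at 0)"
    by (auto intro!: derivative_eq_intros)
  moreover have "(f has_derivative f') (at (x + 0 *\<^sub>R b))" using assms by simp
  ultimately have "((\<lambda>t. f (x + t *\<^sub>R b)) has_derivative (\<lambda>t. f' (t *\<^sub>R b))) (at 0)"
    by (rule has_derivative_compose)
  moreover have "f' (t *\<^sub>R b) = t *\<^sub>R f' b" for t
    using has_derivative_linear[OF assms] by (rule linear_scale)
  ultimately show ?thesis
    unfolding partial_deriv_def by (intro vector_derivative_at) (simp add: has_vector_derivative_def)
qed

text \<open>
  Off the closed quarter-plane the field is twice continuously differentiable, so its normal derivative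
  is continuous across \<open>x3 = 0\<close> and the trace is its value there.
\<close>

lemma trace_up_d3_eq_0:
  assumes problem: "quarter_plane_problem k k1 k2 k3 u" and x: "x1 < 0 \<or> x2 < 0"
  shows "trace_up (d3 u) (x1, x2) = 0"
proof -
  let ?S = "- closed_quarter_plane"
  have "C_on 2 u ?S" using problem by (simp add: quarter_plane_problem_def)
  then obtain u' where u': "\<And>x. x \<in> ?S \<Longrightarrow> (u has_derivative u' x) (at x)"
      and C1: "\<And>h. C_on 1 (\<lambda>x. u' x h) ?S"
    unfolding numeral_2_eq_2 One_nat_def C_on.simps(2)[of "Suc 0"] by blast
  have in_S: "(x1, x2, x3) \<in> ?S" for x3 using x by (auto simp: closed_quarter_plane_def)
  have d3: "d3 u (x1, x2, x3) = u' (x1, x2, x3) (0, 0, 1)" for x3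
    unfolding d3_def by (rule partial_deriv_eq[OF u'[OF in_S]])
  have "continuous_on ?S (\<lambda>x. u' x (0, 0, 1))"
    by (rule C_on_1_continuous[OF C1])
  then have "continuous_on UNIV (\<lambda>x3. u' (x1, x2, x3) (0, 0, 1))"
    by (rule continuous_on_compose2) (use in_S in \<open>auto intro!: continuous_intros\<close>)
  then have "continuous_on UNIV (\<lambda>x3. d3 u (x1, x2, x3))" by (simp only: d3)
  then have "isCont (\<lambda>x3. d3 u (x1, x2, x3)) 0" by (simp add: continuous_on_eq_continuous_at)
  then have "((\<lambda>x3. d3 u (x1, x2, x3)) \<longlongrightarrow> d3 u (x1, x2, 0)) (at_right 0)"
    unfolding isCont_def by (rule tendsto_mono[rotated]) (simp add: at_le)
  moreover have "d3 u (x1, x2, 0) = 0" using problem x unfolding quarter_plane_problem_def by blast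
  ultimately show ?thesis
    by (simp add: trace_up_def tendsto_Lim)
qed

lemma trace_up_quarter:
  assumes problem: "quarter_plane_problem k k1 k2 k3 u" and x: "0 < x1" "0 < x2"
  shows "trace_up u (x1, x2) = - exp (\<i> * (k1 * of_real x1 + k2 * of_real x2))"
proof -
  have "continuous_on ({(x1, x2, x3). 0 \<le> x3} - {(0, 0, 0)}) u"
    using problem by (simp add: quarter_plane_problem_def)
  then have "continuous_on {0..} (\<lambda>x3. u (x1, x2, x3))"
    by (rule continuous_on_compose2) (use x in \<open>auto intro!: continuous_intros\<close>)
  then have "((\<lambda>x3. u (x1, x2, x3)) \<longlongrightarrow> u (x1, x2, 0)) (at 0 within {0..})"
    by (simp add: continuous_on_def)
  then have "((\<lambda>x3. u (x1, x2, x3)) \<longlongrightarrow> u (x1, x2, 0)) (at_right 0)"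
    by (rule tendsto_within_subset) auto
  moreover have "u (x1, x2, 0) = - exp (\<i> * (k1 * of_real x1 + k2 * of_real x2))"
    using problem x by (simp add: quarter_plane_problem_def)
  ultimately show ?thesis
    by (simp add: trace_up_def tendsto_Lim)
qed

text \<open>
  In the strips the imaginary parts have Euclidean norm below \<open>2 * sqrt 2 * \<kappa>\<close>, less than the decay rate
  \<open>4 * \<kappa>\<close> of the trace.
\<close>

lemma exp_decay_integrable:
  assumes "0 < \<kappa>" "exp_decay \<kappa> u" "integrable lborel (trace_up u)"
    and im: "\<bar>Im \<xi>1\<bar> < 2 * \<kappa>" "\<bar>Im \<xi>2\<bar> < 2 * \<kappa>"
  shows "integrable lborel (fourier_integrand (trace_up u) \<xi>1 \<xi>2)"
proof -
  obtain C where "\<forall>\<^sub>F (x1, x2) in at_infinity.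
      norm (trace_up u (x1, x2)) < C * exp (- 4 * \<kappa> * sqrt (x1\<^sup>2 + x2\<^sup>2))"
    using assms(2) by (auto simp: exp_decay_def)
  then have "\<forall>\<^sub>F x in at_infinity. norm (trace_up u x) \<le> C * exp (- (4 * \<kappa>) * norm x)"
    by eventually_elim (auto simp: norm_Pair)
  then show ?thesis
  proof (rule fourier_integrable_if_exp_decay[OF assms(3)])
    have "(Im \<xi>1)\<^sup>2 < (2 * \<kappa>)\<^sup>2" "(Im \<xi>2)\<^sup>2 < (2 * \<kappa>)\<^sup>2"
      using power_strict_mono[OF im(1), of 2] power_strict_mono[OF im(2), of 2] by auto
    moreover have "2 * (2 * \<kappa>)\<^sup>2 \<le> (4 * \<kappa>)\<^sup>2" by (simp add: power_mult_distrib)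
    ultimately show "(Im \<xi>1)\<^sup>2 + (Im \<xi>2)\<^sup>2 < (4 * \<kappa>)\<^sup>2" by linarith
  qed (use assms(1) in simp)
qed

section \<open>The two relations\<close>

theorem theorem3p1:
  fixes eps \<kappa> :: real
    and k k1 k2 k3 :: complex
    and u :: "real \<times> real \<times> real \<Rightarrow> complex"
    and U W K \<gamma> :: "complex \<Rightarrow> complex \<Rightarrow> complex"
  assumes eps: "0 < eps" "eps < 1"
    and k: "k\<^sup>2 = 1 + \<i> * complex_of_real eps" "0 < Re k"
    and k1: "0 < Re k1" "0 < Im k1"
    and k2: "0 < Re k2" "0 < Im k2"
    and k3: "k3\<^sup>2 = k\<^sup>2 - k1\<^sup>2 - k2\<^sup>2"
    and \<kappa>: "\<kappa> = kappa eps k1 k2"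
    and problem: "quarter_plane_problem k k1 k2 k3 u"
    and decay: "exp_decay \<kappa> u"
    and U: "U = U_spec u"
    and W: "W = W_spec u"
    and K: "K = K_spec k"
    and \<gamma>: "\<gamma> = gamma k"
    and U_converges: "integrable lborel (trace_up u)"
    and W_converges: "\<And>\<xi>1 \<xi>2. Im \<xi>1 > - 2 * \<kappa> \<Longrightarrow> Im \<xi>2 > - 2 * \<kappa> \<Longrightarrow>
            integrable lborel (fourier_integrand (trace_up (d3 u)) \<xi>1 \<xi>2)"
    and functional_eq: "\<And>\<xi>1 \<xi>2. \<xi>1 \<in> \<real> \<Longrightarrow> \<xi>2 \<in> \<real> \<Longrightarrow> K \<xi>1 \<xi>2 * W \<xi>1 \<xi>2 = \<i> * U \<xi>1 \<xi>2"
    and W_analytic: "holomorphic2_on W {(\<xi>1, \<xi>2). Im \<xi>1 > - 2 * \<kappa> \<and> Im \<xi>2 > - 2 * \<kappa>}"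
    and growth: "growth_conditions \<kappa> W"
  shows "\<forall>\<xi>1 \<xi>2. \<bar>Im \<xi>1\<bar> < \<kappa> \<and> \<bar>Im \<xi>2\<bar> < \<kappa> \<longrightarrow>
      (let F = (\<lambda>\<xi>1' \<xi>2'. \<gamma> \<xi>1 (- \<xi>2') * K \<xi>1' \<xi>2' * W \<xi>1' \<xi>2' / ((\<xi>1' - \<xi>1) * (\<xi>2' - \<xi>2))) in
         iterated_integrable \<kappa> (- \<kappa>) F \<and>
         W \<xi>1 \<xi>2 = \<gamma> \<xi>1 \<xi>2 / (4 * (complex_of_real pi)\<^sup>2) * iterated_integral \<kappa> (- \<kappa>) F
                    + \<i> * \<gamma> \<xi>1 \<xi>2 * \<gamma> \<xi>1 k2 / ((\<xi>1 + k1) * (\<xi>2 + k2))) \<and>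
      (let F = (\<lambda>\<xi>2' \<xi>1'. \<gamma> \<xi>2 (- \<xi>1') * K \<xi>1' \<xi>2' * W \<xi>1' \<xi>2' / ((\<xi>1' - \<xi>1) * (\<xi>2' - \<xi>2))) in
         iterated_integrable \<kappa> (- \<kappa>) F \<and>
         W \<xi>1 \<xi>2 = \<gamma> \<xi>2 \<xi>1 / (4 * (complex_of_real pi)\<^sup>2) * iterated_integral \<kappa> (- \<kappa>) F
                    + \<i> * \<gamma> \<xi>2 \<xi>1 * \<gamma> \<xi>2 k1 / ((\<xi>1 + k1) * (\<xi>2 + k2)))"
proof (intro allI impI)
  have \<kappa>_bounds: "0 < \<kappa>" "\<kappa> \<le> eps / 8" "\<kappa> < Im k1" "\<kappa> < Im k2"
    using eps k1 k2 by (auto simp: \<kappa> kappa_def)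
  interpret quarter_plane_spectrum eps \<kappa> k k1 k2 "trace_up u" "trace_up (d3 u)"
  proof
    show "K_spec k \<xi>1 \<xi>2 * fourier2 (trace_up (d3 u)) \<xi>1 \<xi>2 = \<i> * fourier2 (trace_up u) \<xi>1 \<xi>2"
      if "\<xi>1 \<in> \<real>" "\<xi>2 \<in> \<real>" for \<xi>1 \<xi>2
      using functional_eq[OF that] by (simp add: K W U W_spec_def U_spec_def)
    show "trace_up (d3 u) (x1, x2) = 0" if "x1 < 0 \<or> x2 < 0" for x1 x2
      by (rule trace_up_d3_eq_0[OF problem that])
    show "trace_up u (x1, x2) = - exp (\<i> * (k1 * of_real x1 + k2 * of_real x2))"
      if "0 < x1" "0 < x2" for x1 x2
      by (rule trace_up_quarter[OF problem that])
    show "integrable lborel (fourier_integrand (trace_up u) \<xi>1 \<xi>2)"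
      if "\<bar>Im \<xi>1\<bar> < 2 * \<kappa>" "\<bar>Im \<xi>2\<bar> < 2 * \<kappa>" for \<xi>1 \<xi>2
      by (rule exp_decay_integrable[OF \<kappa>_bounds(1) decay U_converges that])
    show "integrable lborel (fourier_integrand (trace_up (d3 u)) \<xi>1 \<xi>2)"
      if "- 2 * \<kappa> < Im \<xi>1" "- 2 * \<kappa> < Im \<xi>2" for \<xi>1 \<xi>2
      by (rule W_converges) (use that in auto)
  qed (use eps k(1) \<kappa>_bounds in auto)
  fix \<xi>1 \<xi>2 :: complex
  assume "\<bar>Im \<xi>1\<bar> < \<kappa> \<and> \<bar>Im \<xi>2\<bar> < \<kappa>"
  then have im: "\<bar>Im \<xi>1\<bar> < \<kappa>" "\<bar>Im \<xi>2\<bar> < \<kappa>" by auto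
  show "(let F = (\<lambda>\<xi>1' \<xi>2'. \<gamma> \<xi>1 (- \<xi>2') * K \<xi>1' \<xi>2' * W \<xi>1' \<xi>2' / ((\<xi>1' - \<xi>1) * (\<xi>2' - \<xi>2))) in
         iterated_integrable \<kappa> (- \<kappa>) F \<and>
         W \<xi>1 \<xi>2 = \<gamma> \<xi>1 \<xi>2 / (4 * (complex_of_real pi)\<^sup>2) * iterated_integral \<kappa> (- \<kappa>) F
                    + \<i> * \<gamma> \<xi>1 \<xi>2 * \<gamma> \<xi>1 k2 / ((\<xi>1 + k1) * (\<xi>2 + k2))) \<and>
      (let F = (\<lambda>\<xi>2' \<xi>1'. \<gamma> \<xi>2 (- \<xi>1') * K \<xi>1' \<xi>2' * W \<xi>1' \<xi>2' / ((\<xi>1' - \<xi>1) * (\<xi>2' - \<xi>2))) in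
         iterated_integrable \<kappa> (- \<kappa>) F \<and>
         W \<xi>1 \<xi>2 = \<gamma> \<xi>2 \<xi>1 / (4 * (complex_of_real pi)\<^sup>2) * iterated_integral \<kappa> (- \<kappa>) F
                    + \<i> * \<gamma> \<xi>2 \<xi>1 * \<gamma> \<xi>2 k1 / ((\<xi>1 + k1) * (\<xi>2 + k2)))"
    unfolding Let_def W K \<gamma> W_spec_def
    by (intro conjI first_relation[OF im] second_relation[OF im])
qed

end
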